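(* Consider the continuous-time LQR problem with data $(A,B,Q,R,\mathcal D)$, and suppose that the initial state distribution satisfies Assumption 1 and the workers satisfy Assumption 2 (both stated in the context). Fix constants $\beta>0$ and $C_0>0$. Then there are positive constants $C_1,C_2,C_3,C_4$ and positive functions $r_0,\theta_1,\theta_2,\theta_3,\theta'$ of $a$, depending on the parameters of the LQR problem, such that the following holds with $$C_g(a)=C_4\,\theta'(a)\,\beta\, mn\log N+2\sqrt{mn},\qquad T=C_0\lfloor \bar t/\underline t\rfloor+1 .$$ Given a desired accuracy $\epsilon>0$ and an initial policy $\mathsf K_0\in\mathcal Q(a)$, let the time-horizon $\tau$, the smooth radius $r>0$, the batch size $N$, the number of workers $M$ and the stepsize $\eta>0$ satisfy $$r<\min\{r_0(a),\theta_1(a)\sqrt{\epsilon}\},\qquad \tau\ge\theta_2(a)\log\frac{1}{\epsilon r},\qquad N\ge C_1\beta^4\theta_3(a)\log^6(nm)\,nm,$$ $$1\le M\le C_0N,\qquad \eta\le\frac{1}{128\,\mu_2(a)\,(C_g^2(a)+T\,C_g(a))}.$$ Then the AZOPG iteration started at $\mathsf K_0$ achieves $f(\mathsf K_j)-f(\mathsf K^* )\le\epsilon$ in at most $$j\le\frac{8}{\eta\,\mu_1(a)}\log\left(\frac{f(\mathsf K_0)-f(\mathsf K^* )}{\epsilon}\right)$$ iterations with probability not smaller than $$1-j\,(C_2N^{-\beta}+C_3e^{-N}).$$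
   Context: Notation: $\|\cdot\|_F$ is the Frobenius norm, $\langle A,B\rangle=\mathrm{Tr}(A^{\top}B)$, $\mathrm{vec}(\cdot)$ is vectorization, and $\mathcal S^{d-1}$ is the unit sphere of $\mathbb R^{d}$. LQR problem: $\dot x(t)=Ax(t)+Bu(t)$, $x(0)=\zeta\sim\mathcal D$, with $A\in\mathbb R^{n\times n}$, $B\in\mathbb R^{n\times m}$, $(A,B)$ controllable, and $Q\in\mathbb R^{n\times n}$, $R\in\mathbb R^{m\times m}$ positive definite. Policies are $u(t)=-\mathsf Kx(t)$ with $\mathsf K\in\mathbb R^{m\times n}$. The set of stabilizing policies is $\mathcal K_{\rm st}=\{\mathsf K: A-B\mathsf K\text{ is Hurwitz}\}$. For $\mathsf K\in\mathcal K_{\rm st}$, $P(\mathsf K)$ is the unique solution of $(A-B\mathsf K)^{\top}P+P(A-B\mathsf K)+\mathsf K^{\top}R\mathsf K+Q=0$; $X_0=\mathbb E[\zeta\zeta^{\top}]$; $f(\mathsf K)=\mathrm{Tr}(P(\mathsf K)X_0)$. $\mathsf K^*$ is the minimizer of $f$ over $\mathcal K_{\rm st}$, and $\mathcal Q(a)=\{\mathsf K\in\mathcal K_{\rm st}: f(\mathsf K)\le a\}$. The finite-horizon cost is $f_\zeta^\tau(\mathsf K)=\int_0^\tau (x^{\top}Qx+u^{\top}Ru)\,dt$ along $\dot x=Ax+Bu$, $u=-\mathsf Kx$, $x(0)=\zeta$. $\mu_1(a),\mu_2(a)>0$ are gradient dominance and smoothness parameters of $f$ over $\mathcal Q(a)$: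 for all $\mathsf K,\mathsf K'\in\mathcal Q(a)$, $f(\mathsf K)-f(\mathsf K^* )\le\frac{1}{2\mu_1(a)}\|\nabla f(\mathsf K)\|_F^2$ and $\|\nabla f(\mathsf K)-\nabla f(\mathsf K')\|_F\le\mu_2(a)\|\mathsf K-\mathsf K'\|_F$. Assumption 1: $\mathcal D$ has i.i.d. zero-mean entries and unit covariance, with bounded support, i.e. $\|\zeta\|\le\delta$ for some constant $\delta>0$. AZOPG (asynchronous parallel zero-order policy gradient): there are $M$ workers and one master. Each worker repeatedly runs the following procedure, without waiting for other workers: pull the latest policy $\mathsf K$ from the master; sample $\mathrm{vec}(\mathsf U)$ uniformly from $\sqrt{mn}\,\mathcal S^{mn-1}$ and $\zeta$ from $\mathcal D$ (all samples independent); compute $F_\zeta^\tau(\mathsf K,\mathsf U)=\frac{1}{2r}\left(f_\zeta^\tau(\mathsf K+r\mathsf U)-f_\zeta^\tau(\mathsf K-r\mathsf U)\right)\mathsf U$; push it to the master. Each time the master has collected $N$ estimates (possibly several from the same worker, possibly computed at older policies) it updates $$\overline G_j=\frac1N\sum_{i=1}^N F_{\zeta_{j,i}}^\tau(\mathsf K_{j-d_{j,i}},\mathsf U_{j,i}),\qquad \mathsf K_{j+1}=\mathsf K_j-\eta\,\overline G_j,$$ where $d_{j,i}\ge0$ is the delay (in number of master iterations) of the $i$-th estimate used in iteration $j$. Assumption 2: for each worker, the duration between two consecutive time instants of running the AZOPG worker procedure (pull the latest policy $\mathsf K$ from the master, sample $\mathsf U$ and $\zeta$, compute $F_\zeta^\tau(\mathsf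 K,\mathsf U)$, and push it to the master) lies in an interval $[\underline t,\bar t]$ with $0<\underline t<\bar t<\infty$.
   Formalization: The bound on the number of iterations j is rounded up to the next nonnegative integer; unrounded, the claim fails when ε is slightly below f(K_0)-f(K* ) (j=0 is forced) and no j≥0 exists when ε exceeds f(K_0)-f(K* ). *)

theory Defs
  imports "HOL-Probability.Probability"
begin

text \<open>
  States are vectors in \<open>real^'n\<close>, inputs in \<open>real^'m\<close>, policies matrices \<open>K :: real^'n^'m\<close>.
  The Euclidean norm, inner product and \<open>lborel\<close> on \<open>real^'n^'m\<close> are those of the vectorised matrix,
  so \<open>norm\<close> is the Frobenius norm and \<open>K \<bullet> L\<close> is the trace of \<open>transpose K ** L\<close>.
\<close>

definition positive_definite :: "real^'n^'n \<Rightarrow> bool" where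
  "positive_definite S \<longleftrightarrow> transpose S = S \<and> (\<forall>x. x \<noteq> 0 \<longrightarrow> 0 < x \<bullet> (S *v x))"

definition hurwitz :: "real^'n^'n \<Rightarrow> bool" where
  "hurwitz S \<longleftrightarrow>
    (\<forall>(l::complex) (v::complex^'n).
      v \<noteq> 0 \<and> (\<chi> i j. complex_of_real (S $ i $ j)) *v v = l *s v \<longrightarrow> Re l < 0)"

definition controllable :: "real^'n^'n \<Rightarrow> real^'m^'n \<Rightarrow> bool" where
  "controllable A B \<longleftrightarrow>
    (\<forall>x0 x1. \<forall>t1>0. \<exists>u x.
      continuous_on {0..t1} u \<and>
      (\<forall>t\<in>{0..t1}. (x has_vector_derivative (A *v x t + B *v u t)) (at t within {0..t1})) \<and>
      x 0 = x0 \<and> x t1 = x1)"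

definition stabilizing :: "real^'n^'n \<Rightarrow> real^'m^'n \<Rightarrow> (real^'n^'m) set" where
  "stabilizing A B = {K. hurwitz (A - B ** K)}"

definition lyapunov_sol ::
  "real^'n^'n \<Rightarrow> real^'m^'n \<Rightarrow> real^'n^'n \<Rightarrow> real^'m^'m \<Rightarrow> real^'n^'m \<Rightarrow> real^'n^'n" where
  "lyapunov_sol A B Q R K =
    (THE P. transpose (A - B ** K) ** P + P ** (A - B ** K) + transpose K ** R ** K + Q = 0)"

definition second_moment :: "(real^'n) measure \<Rightarrow> real^'n^'n" where
  "second_moment D = (\<chi> i j. \<integral>z. z $ i * z $ j \<partial>D)"

text \<open>The cost is only meaningful on \<open>stabilizing A B\<close>; elsewhere its value is arbitrary.\<close>

definition lqr_cost ::
  "real^'n^'n \<Rightarrow> real^'m^'n \<Rightarrow> real^'n^'n \<Rightarrow> real^'m^'m \<Rightarrow> (real^'n) measure \<Rightarrow>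
   real^'n^'m \<Rightarrow> real" where
  "lqr_cost A B Q R D K = trace (lyapunov_sol A B Q R K ** second_moment D)"

definition optimal_policy ::
  "real^'n^'n \<Rightarrow> real^'m^'n \<Rightarrow> real^'n^'n \<Rightarrow> real^'m^'m \<Rightarrow> (real^'n) measure \<Rightarrow> real^'n^'m" where
  "optimal_policy A B Q R D = arg_min_on (lqr_cost A B Q R D) (stabilizing A B)"

definition sublevel ::
  "real^'n^'n \<Rightarrow> real^'m^'n \<Rightarrow> real^'n^'n \<Rightarrow> real^'m^'m \<Rightarrow> (real^'n) measure \<Rightarrow>
   real \<Rightarrow> (real^'n^'m) set" where
  "sublevel A B Q R D a = {K \<in> stabilizing A B. lqr_cost A B Q R D K \<le> a}"

definition gradient :: "('a::real_inner \<Rightarrow> real) \<Rightarrow> 'a \<Rightarrow> 'a" where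
  "gradient f x = (THE g. GDERIV f x :> g)"

definition grad_dominated_on :: "('a::real_inner \<Rightarrow> real) \<Rightarrow> 'a \<Rightarrow> real \<Rightarrow> 'a set \<Rightarrow> bool" where
  "grad_dominated_on f xmin \<mu> S \<longleftrightarrow>
    (\<forall>x\<in>S. f x - f xmin \<le> 1 / (2 * \<mu>) * (norm (gradient f x))\<^sup>2)"

definition smooth_on_set :: "('a::real_inner \<Rightarrow> real) \<Rightarrow> real \<Rightarrow> 'a set \<Rightarrow> bool" where
  "smooth_on_set f \<mu> S \<longleftrightarrow>
    (\<forall>x\<in>S. \<forall>y\<in>S. norm (gradient f x - gradient f y) \<le> \<mu> * norm (x - y))"

definition admissible_init :: "(real^'n) measure \<Rightarrow> bool" where
  "admissible_init D \<longleftrightarrow>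
    prob_space D \<and> sets D = sets borel \<and>
    prob_space.indep_vars D (\<lambda>_. borel) (\<lambda>i z. z $ i) UNIV \<and>
    (\<forall>i j. distr D borel (\<lambda>z. z $ i) = distr D borel (\<lambda>z. z $ j)) \<and>
    (\<forall>i. (\<integral>z. z $ i \<partial>D) = 0) \<and>
    second_moment D = mat 1 \<and>
    (\<exists>\<delta>>0. AE z in D. norm z \<le> \<delta>)"

text \<open>
  The closed-loop system is linear, so its solution exists and is unique on the whole real line;
  only its values at nonnegative times enter the cost.
\<close>

definition closed_loop ::
  "real^'n^'n \<Rightarrow> real^'m^'n \<Rightarrow> real^'n^'m \<Rightarrow> real^'n \<Rightarrow> real \<Rightarrow> real^'n" where
  "closed_loop A B K z =
    (THE x. x 0 = z \<and>
      (\<forall>t. (x has_vector_derivative (A *v x t + B *v (- (K *v x t)))) (at t)))"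

definition finite_cost ::
  "real^'n^'n \<Rightarrow> real^'m^'n \<Rightarrow> real^'n^'n \<Rightarrow> real^'m^'m \<Rightarrow> real \<Rightarrow> real^'n \<Rightarrow>
   real^'n^'m \<Rightarrow> real" where
  "finite_cost A B Q R \<tau> z K =
    integral {0..\<tau>} (\<lambda>t. let x = closed_loop A B K z t; u = - (K *v x)
                           in x \<bullet> (Q *v x) + u \<bullet> (R *v u))"

definition grad_estimate ::
  "real^'n^'n \<Rightarrow> real^'m^'n \<Rightarrow> real^'n^'n \<Rightarrow> real^'m^'m \<Rightarrow> real \<Rightarrow> real \<Rightarrow>
   real^'n^'m \<Rightarrow> real^'n \<Rightarrow> real^'n^'m \<Rightarrow> real^'n^'m" where
  "grad_estimate A B Q R \<tau> r U z K =
    (1 / (2 * r) *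
      (finite_cost A B Q R \<tau> z (K + r *\<^sub>R U) - finite_cost A B Q R \<tau> z (K - r *\<^sub>R U))) *\<^sub>R U"

text \<open>
  Normalised surface measure on the sphere of radius \<open>\<rho>\<close> about the origin, as a cone measure:
  the radial projection of the uniform distribution on the unit ball.
\<close>

definition uniform_sphere :: "real \<Rightarrow> 'a::euclidean_space measure" where
  "uniform_sphere \<rho> =
    distr (uniform_measure lborel (ball 0 1)) borel (\<lambda>x. (\<rho> / norm x) *\<^sub>R x)"

text \<open>
  Joint law of all samples \<open>(U, \<zeta>)\<close>, indexed by pairs (worker, run of that worker). Taking the
  product measure makes all directions \<open>U\<close> and all initial states \<open>\<zeta>\<close> independent.
\<close>

definition sample_space ::
  "(real^'n) measure \<Rightarrow> nat \<Rightarrow> (nat \<times> nat \<Rightarrow> (real^'n^'m) \<times> (real^'n)) measure" where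
  "sample_space D M =
    PiM ({..<M} \<times> UNIV)
      (\<lambda>_. uniform_sphere (sqrt (real CARD('m) * real CARD('n))) \<Otimes>\<^sub>M D)"

text \<open>
  In its \<open>k\<close>-th run, worker \<open>w\<close> pulls the policy at time \<open>pull w k\<close> and pushes its estimate at time
  \<open>push w k\<close>.
\<close>

definition worker_timing ::
  "real \<Rightarrow> real \<Rightarrow> nat \<Rightarrow> (nat \<Rightarrow> nat \<Rightarrow> real) \<Rightarrow> (nat \<Rightarrow> nat \<Rightarrow> real) \<Rightarrow> bool" where
  "worker_timing tmin tmax M pull push \<longleftrightarrow>
    (\<forall>w<M. \<forall>k. pull w k < push w k \<and> push w k \<le> pull w (Suc k) \<and>
                pull w (Suc k) - pull w k \<in> {tmin..tmax})"

text \<open>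
  \<open>arr s\<close> is the run (worker, run number) whose estimate is the \<open>s\<close>-th to reach the master;
  simultaneous pushes may be ordered arbitrarily.
\<close>

definition arrival_order :: "nat \<Rightarrow> (nat \<Rightarrow> nat \<Rightarrow> real) \<Rightarrow> (nat \<Rightarrow> nat \<times> nat) \<Rightarrow> bool" where
  "arrival_order M push arr \<longleftrightarrow>
    bij_betw arr UNIV ({..<M} \<times> UNIV) \<and> mono (\<lambda>s. case_prod push (arr s))"

text \<open>
  Iteration \<open>j\<close> consumes the arrivals \<open>j * N, \<dots>, j * N + (N - 1)\<close> and produces policy \<open>Suc j\<close> when
  the last of them comes in.
\<close>

definition update_time :: "(nat \<Rightarrow> nat \<Rightarrow> real) \<Rightarrow> (nat \<Rightarrow> nat \<times> nat) \<Rightarrow> nat \<Rightarrow> nat \<Rightarrow> real" where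
  "update_time push arr N j = case_prod push (arr (j * N + (N - 1)))"

definition latest_index ::
  "(nat \<Rightarrow> nat \<Rightarrow> real) \<Rightarrow> (nat \<Rightarrow> nat \<times> nat) \<Rightarrow> nat \<Rightarrow> real \<Rightarrow> nat" where
  "latest_index push arr N t = card {j. update_time push arr N j \<le> t}"

text \<open>
  The subtraction never truncates: a run is pushed strictly after it pulled, so the policy used in
  iteration \<open>j\<close> has index at most \<open>j\<close>.
\<close>

definition delay ::
  "(nat \<Rightarrow> nat \<Rightarrow> real) \<Rightarrow> (nat \<Rightarrow> nat \<Rightarrow> real) \<Rightarrow> (nat \<Rightarrow> nat \<times> nat) \<Rightarrow> nat \<Rightarrow> nat \<Rightarrow> nat \<Rightarrow> nat" where
  "delay pull push arr N j i = j - latest_index push arr N (case_prod pull (arr (j * N + i)))"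

text \<open>
  \<open>G j i K\<close> is the \<open>i\<close>-th estimate (\<open>i < N\<close>) used in iteration \<open>j\<close>, evaluated at policy \<open>K\<close>.
\<close>

fun delayed_descent ::
  "'a::real_vector \<Rightarrow> real \<Rightarrow> nat \<Rightarrow> (nat \<Rightarrow> nat \<Rightarrow> nat) \<Rightarrow> (nat \<Rightarrow> nat \<Rightarrow> 'a \<Rightarrow> 'a) \<Rightarrow> nat \<Rightarrow> 'a"
where
  "delayed_descent K0 \<eta> N d G 0 = K0"
| "delayed_descent K0 \<eta> N d G (Suc j) =
    delayed_descent K0 \<eta> N d G j -
      \<eta> *\<^sub>R ((1 / real N) *\<^sub>R (\<Sum>i<N. G j i (delayed_descent K0 \<eta> N d G (j - d j i))))"

definition azopg ::
  "real^'n^'n \<Rightarrow> real^'m^'n \<Rightarrow> real^'n^'n \<Rightarrow> real^'m^'m \<Rightarrow> real \<Rightarrow> real \<Rightarrow> nat \<Rightarrow> real \<Rightarrow>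
   (nat \<Rightarrow> nat \<Rightarrow> real) \<Rightarrow> (nat \<Rightarrow> nat \<Rightarrow> real) \<Rightarrow> (nat \<Rightarrow> nat \<times> nat) \<Rightarrow> real^'n^'m \<Rightarrow>
   (nat \<times> nat \<Rightarrow> (real^'n^'m) \<times> (real^'n)) \<Rightarrow> nat \<Rightarrow> real^'n^'m" where
  "azopg A B Q R \<tau> r N \<eta> pull push arr K0 \<omega> =
    delayed_descent K0 \<eta> N (delay pull push arr N)
      (\<lambda>j i K. case \<omega> (arr (j * N + i)) of (U, z) \<Rightarrow> grad_estimate A B Q R \<tau> r U z K)"

end

theory Submission
  imports Defs "HOL-Computational_Algebra.Fundamental_Theorem_Algebra"
begin

text \<open>
  For a stabilizing policy the cost matrix \<open>P\<close> solves a Lyapunov equation, whose solution operator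
  preserves positive semidefiniteness because the closed-loop flow decays. Comparing solutions by
  positivity gives, uniformly on a sublevel set of the cost: bounded policies, a stabilizing
  neighbourhood of fixed radius, a Lipschitz derivative of \<open>P\<close>, and exponential convergence of the
  finite-horizon cost. Hence a two-point estimate is the linear functional
  \<open>U \<mapsto> z \<bullet> DP(U) z\<close> times \<open>U\<close>, up to an error that is small compared with \<open>sqrt \<epsilon>\<close>.

  Conditionally on all earlier arrivals, the samples of one iteration are independent and bounded,
  and the inner product of an estimate with the gradient has the squared gradient norm as its mean.
  By Hoeffding's inequality the averaged estimate attains at least half of it, except with
  probability \<open>exp (- \<kappa> N)\<close>. The delay is at most a multiple of \<open>T\<close>, and the stepsize bound makes
  the drift over a delay window negligible; on the good event the optimality gap therefore contracts
  geometrically until it reaches \<open>\<epsilon>\<close>, and it stays below \<open>\<epsilon>\<close> afterwards. The rate \<open>\<kappa>\<close> depends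
  on the level \<open>a\<close>, which only the lower bound on \<open>N\<close> can absorb; for \<open>mn = 1\<close> that bound is void,
  but then \<open>\<kappa>\<close> does not depend on \<open>a\<close>.
\<close>

section \<open>Matrices and quadratic forms\<close>

text \<open>The obstacle is that every error must be measured relative to the gradient. Near the
  optimum the gradient vanishes, so a concentration bound with an absolute error would force a batch
  size depending on \<epsilon>. A single idealised estimate is itself bounded by a multiple of the
  gradient norm (\<open>DP_bound\<close>); mean and range in Hoeffding's inequality therefore scale
  alike, and \<kappa> depends neither on \<epsilon> nor on the policy within the sublevel set. Delay
  and bias errors are compared with the root of the optimality gap, which gradient dominance and
  \<open>cost_grad_self_bound\<close> tie to the gradient norm from both sides. All smallness
  requirements on the stepsize are collected in one number \<open>h0 a\<close> that bounds \<eta>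
  times the delay. The function \<theta>' is then reverse-engineered so that
  \<open>\<theta>' a * \<beta> * mn\<close> equals \<open>1 / (32 * \<mu>2 a * h0 a)\<close>: as
  soon as \<open>ln N\<close> is at least 1, the stepsize condition delivers the bound
  \<open>h0 a\<close>. Small batch sizes are dismissed by choosing \<open>C2\<close> so large that
  the claimed probability is not positive.\<close>

lemma norm_matrix_vector_mult_le:
  fixes A :: "real^'n^'m"
  shows "norm (A *v x) \<le> norm A * norm x"
proof -
  have "norm (A *v x) \<le> L2_set (\<lambda>i. norm (A $ i) * norm x) UNIV"
    unfolding norm_vec_def[of "A *v x"]
    by (rule L2_set_mono) (auto simp: matrix_vector_mul_component Cauchy_Schwarz_ineq2)
  also have "\<dots> = norm A * norm x"
    by (simp add: L2_set_left_distrib norm_vec_def[of A])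
  finally show ?thesis .
qed

lemma norm_transpose [simp]: "norm (transpose A) = norm (A :: real^'n^'m)"
proof -
  have "(norm (transpose A))\<^sup>2 = (norm A)\<^sup>2"
    unfolding dot_square_norm[symmetric]
    by (simp add: inner_vec_def transpose_def) (rule sum.swap)
  then show ?thesis by simp
qed

lemma row_matrix_matrix_mult: "(A ** B) $ i = transpose B *v (A $ i)"
  for A :: "real^'k^'m" and B :: "real^'n^'k"
  by (simp del: transpose_matrix_vector 
     add: vec_eq_iff matrix_matrix_mult_def matrix_vector_mult_def transpose_def mult.commute)

text \<open>Row \<open>i\<close> of the product is \<open>transpose B\<close> applied to row
  \<open>i\<close> of \<open>A\<close>, so the bound for matrix-vector products applies row by
  row.\<close>

lemma norm_matrix_mult_le:
  fixes A :: "real^'k^'m" and B :: "real^'n^'k"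
  shows "norm (A ** B) \<le> norm A * norm B"
proof -
  have "norm (A ** B) \<le> L2_set (\<lambda>i. norm (A $ i) * norm B) UNIV"
    unfolding norm_vec_def[of "A ** B"]
  proof (rule L2_set_mono)
    fix i
    show "norm ((A ** B) $ i) \<le> norm (A $ i) * norm B"
      using norm_matrix_vector_mult_le[of "transpose B" "A $ i"]
      by (simp add: row_matrix_matrix_mult mult.commute del: transpose_matrix_vector)
  qed auto
  also have "\<dots> = norm A * norm B"
    by (simp add: L2_set_left_distrib norm_vec_def[of A])
  finally show ?thesis .
qed

lemma inner_eq_trace: "A \<bullet> B = trace (transpose A ** B)" for A B :: "real^'n^'m"
  by (simp add: inner_vec_def trace_def matrix_matrix_mult_def transpose_def) (rule sum.swap)

lemma trace_transpose: "trace (transpose A) = trace A"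
  by (simp add: trace_def transpose_def)

lemma abs_trace_mult_le: "\<bar>trace (A ** B)\<bar> \<le> norm A * norm B"
  for A :: "real^'n^'m" and B :: "real^'m^'n"
  using Cauchy_Schwarz_ineq2[of "transpose A" B] by (simp add: inner_eq_trace)

lemma inner_matrix_vector_left: "(A *v x) \<bullet> y = x \<bullet> (transpose A *v y)"
  for A :: "real^'n^'m"
  by (metis dot_lmul_matrix transpose_matrix_vector inner_commute)

lemma inner_transpose_matrix: "x \<bullet> (transpose A *v y) = (A *v x) \<bullet> y"
  for A :: "real^'n^'m"
  by (simp only: inner_matrix_vector_left)

lemma transpose_add: "transpose (A + B) = transpose A + transpose B"
  by (simp add: transpose_def vec_eq_iff)
lemma transpose_diff: "transpose (A - B) = transpose A - transpose (B :: 'a::ab_group_add^'n^'m)"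
  by (simp add: transpose_def vec_eq_iff)
lemma transpose_uminus: "transpose (- A) = - transpose (A :: 'a::ab_group_add^'n^'m)"
  by (simp add: transpose_def vec_eq_iff)
lemma matrix_add_rdistrib': "(A + B) ** C = A ** C + B ** (C :: real^'n^'k)"
  by (simp add: vec_eq_iff matrix_matrix_mult_def algebra_simps sum.distrib)
lemma matrix_diff_rdistrib: "(A - B) ** C = A ** C - B ** (C :: real^'n^'k)"
  by (simp add: vec_eq_iff matrix_matrix_mult_def algebra_simps sum_subtractf)
lemma matrix_diff_ldistrib: "A ** (B - C) = A ** B - A ** (C :: real^'n^'k)"
  by (simp add: vec_eq_iff matrix_matrix_mult_def algebra_simps sum_subtractf)
lemma matrix_uminus_left: "(- A) ** C = - (A ** (C :: real^'n^'k))"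
  by (simp add: vec_eq_iff matrix_matrix_mult_def sum_negf)
lemma matrix_uminus_right: "A ** (- C) = - (A ** (C :: real^'n^'k))"
  by (simp add: vec_eq_iff matrix_matrix_mult_def sum_negf)
lemma matrix_scaleR_left: "(c *\<^sub>R A) ** C = c *\<^sub>R (A ** (C :: real^'n^'k))"
  by (simp add: vec_eq_iff matrix_matrix_mult_def sum_distrib_left mult_ac)
lemma matrix_scaleR_right: "A ** (c *\<^sub>R C) = c *\<^sub>R (A ** (C :: real^'n^'k))"
  by (simp add: vec_eq_iff matrix_matrix_mult_def sum_distrib_left mult_ac)
lemma scaleR_matrix_vector: "(c *\<^sub>R A) *v x = c *\<^sub>R (A *v x)" for A :: "real^'n^'m"
  by (simp add: vec_eq_iff matrix_vector_mult_def sum_distrib_left mult_ac)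
lemma uminus_matrix_vector: "(- A) *v x = - (A *v x)" for A :: "real^'n^'m"
  by (simp add: vec_eq_iff matrix_vector_mult_def sum_negf)
lemma trace_scaleR: "trace (c *\<^sub>R A) = c * trace (A :: real^'n^'n)"
  by (simp add: trace_def sum_distrib_left)
lemma trace_uminus: "trace (- A) = - trace (A :: real^'n^'n)"
  by (simp add: trace_def sum_negf)

lemma trace_zero [simp]: "trace (0 :: real^'n^'n) = 0"
  by (simp add: trace_def)

lemmas matrix_ring_simps = matrix_add_ldistrib matrix_add_rdistrib' matrix_diff_ldistrib
  matrix_diff_rdistrib matrix_uminus_left matrix_uminus_right matrix_scaleR_left matrix_scaleR_right
  transpose_add transpose_diff transpose_uminus transpose_scalar matrix_transpose_mul
  matrix_mul_assoc

section \<open>Quadratic forms and their traces\<close>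

definition qform :: "real^'n^'n \<Rightarrow> real^'n \<Rightarrow> real" where
  "qform Y x = x \<bullet> (Y *v x)"

lemma qform_add: "qform (Y + Z) x = qform Y x + qform Z x"
  by (simp add: qform_def matrix_vector_mult_add_rdistrib inner_add_right)
lemma qform_diff: "qform (Y - Z) x = qform Y x - qform Z x"
  by (simp add: qform_def matrix_vector_mult_diff_rdistrib inner_diff_right)
lemma qform_uminus: "qform (- Y) x = - qform Y x"
  by (simp add: qform_def uminus_matrix_vector)
lemma qform_scaleR: "qform (c *\<^sub>R Y) x = c * qform Y x"
  by (simp add: qform_def scaleR_matrix_vector)
lemma qform_zero [simp]: "qform Y 0 = 0" "qform 0 x = 0"
  by (simp_all add: qform_def)

lemma abs_qform_le: "\<bar>qform Y x\<bar> \<le> norm Y * (norm x)\<^sup>2"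
proof -
  have "\<bar>qform Y x\<bar> \<le> norm x * norm (Y *v x)"
    unfolding qform_def by (rule Cauchy_Schwarz_ineq2)
  also have "\<dots> \<le> norm x * (norm Y * norm x)"
    by (intro mult_left_mono norm_matrix_vector_mult_le) auto
  finally show ?thesis by (simp add: power2_eq_square mult_ac)
qed

lemma qform_transpose_mult: "qform (transpose H ** S ** H) x = qform S (H *v x)"
  by (simp add: qform_def matrix_vector_mul_assoc[symmetric] inner_transpose_matrix
      del: transpose_matrix_vector)

lemma matrix_vector_axis_component: "(Y *v axis j 1) $ i = Y $ i $ j" for Y :: "real^'n^'m"
  by (simp add: matrix_vector_mult_def axis_def if_distrib cong: if_cong)

lemma qform_axis: "qform Y (axis i 1) = Y $ i $ i"
  by (simp add: qform_def inner_axis' matrix_vector_axis_component)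

lemma trace_eq_sum_qform: "trace Y = (\<Sum>i\<in>UNIV. qform Y (axis i 1))"
  by (simp add: trace_def qform_axis)

text \<open>Only a bound by some power of the dimension is needed, not the sharp one.\<close>

lemma norm_le_trace_of_qform_le:
  fixes Y P :: "real^'n^'n"
  assumes sym: "transpose Y = Y" and le: "\<And>x. \<bar>qform Y x\<bar> \<le> k * qform P x"
    and P: "\<And>x. 0 \<le> qform P x" and k: "0 \<le> k"
  shows "norm Y \<le> (real CARD('n))\<^sup>2 * k * trace P"
proof -
  have sy: "Y $ j $ i = Y $ i $ j" for i j
    using arg_cong[OF sym, of "\<lambda>M. M $ i $ j"] by (simp add: transpose_def)
  have dg: "P $ i $ i \<ge> 0" for i using P[of "axis i 1"] by (simp add: qform_axis)
  have ent: "\<bar>Y $ i $ j\<bar> \<le> k * trace P" for i j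
  proof -
    let ?e = "\<lambda>i. axis i (1::real) :: real^'n"
    have bil: "qform Z (?e i + ?e j) = Z$i$i + Z$i$j + Z$j$i + Z$j$j"
       "qform Z (?e i - ?e j) = Z$i$i - Z$i$j - Z$j$i + Z$j$j" for Z
      by (simp_all add: qform_def matrix_vector_right_distrib matrix_vector_mult_diff_distrib inner_add_left inner_add_right
         inner_diff_left inner_diff_right inner_axis' matrix_vector_axis_component)
    \<comment> \<open>Polarisation: by symmetry the forms of \<open>Y\<close> at the sum and the
      difference of two axis vectors differ by \<open>4 * Y$i$j\<close>, while those of
      \<open>P\<close> add up to \<open>2 * (P$i$i + P$j$j)\<close>.\<close>
    have "\<bar>4 * Y$i$j\<bar> \<le> k * qform P (?e i + ?e j) + k * qform P (?e i - ?e j)"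
      using le[of "?e i + ?e j"] le[of "?e i - ?e j"] sy[of i j]
      unfolding bil[of Y] by linarith
    also have "\<dots> = 2 * k * (P$i$i + P$j$j)" unfolding bil by (simp add: algebra_simps)
    finally have *: "\<bar>Y$i$j\<bar> \<le> k * ((P$i$i + P$j$j) / 2)" by simp
    have "P$i$i \<le> trace P" "P$j$j \<le> trace P"
      unfolding trace_def by (auto intro!: member_le_sum dg)
    with k have "k * ((P$i$i + P$j$j) / 2) \<le> k * trace P" by (intro mult_left_mono) auto
    with * show ?thesis by linarith
  qed
  have "norm Y \<le> (\<Sum>i\<in>UNIV. norm (Y $ i))" by (simp add: norm_vec_def L2_set_le_sum)
  also have "\<dots> \<le> (\<Sum>i\<in>(UNIV::'n set). \<Sum>j\<in>(UNIV::'n set). k * trace P)"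
    by (intro sum_mono order.trans[OF norm_le_l1_cart] ent)
  also have "\<dots> = (real CARD('n))\<^sup>2 * k * trace P" by (simp add: power2_eq_square)
  finally show ?thesis .
qed

lemma trace_nonneg: "(\<And>x. 0 \<le> qform Y x) \<Longrightarrow> 0 \<le> trace Y"
  by (simp add: trace_eq_sum_qform sum_nonneg)

lemma trace_mono_qform: "(\<And>x. qform Y x \<le> qform Z x) \<Longrightarrow> trace Y \<le> trace Z"
  by (simp add: trace_eq_sum_qform sum_mono)

lemma norm_le_trace:
  fixes P :: "real^'n^'n"
  assumes "transpose P = P" "\<And>x. 0 \<le> qform P x"
  shows "norm P \<le> (real CARD('n))\<^sup>2 * trace P"
  using norm_le_trace_of_qform_le[of P 1 P] assms by simp

text \<open>The form attains a positive minimum on the compact unit sphere, and homogeneity of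
  degree 2 carries it to all vectors.\<close>

lemma positive_definite_lower_bound:
  assumes "positive_definite (S :: real^'n^'n)"
  obtains c where "0 < c" "\<And>x. c * (norm x)\<^sup>2 \<le> qform S x"
proof -
  have "continuous_on (sphere 0 1) (qform S)"
    unfolding qform_def by (intro continuous_intros linear_continuous_on_compose[where f="\<lambda>x. x"] matrix_vector_mul_linear) 
  moreover have "sphere (0::real^'n) 1 \<noteq> {}" by simp
  ultimately obtain v where v: "v \<in> sphere 0 1" "\<And>y. y \<in> sphere 0 1 \<Longrightarrow> qform S v \<le> qform S y"
    using continuous_attains_inf[of "sphere 0 1" "qform S"] by auto
  have "0 < qform S v" using assms v(1) unfolding positive_definite_def qform_def
    by (metis dist_0_norm mem_sphere norm_zero zero_neq_one)
  moreover have "qform S v * (norm x)\<^sup>2 \<le> qform S x" for x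
  proof (cases "x = 0")
    case False
    have "qform S v \<le> qform S ((1 / norm x) *\<^sub>R x)" using v(2)[of "(1 / norm x) *\<^sub>R x"] False by simp
    also have "\<dots> = qform S x / (norm x)\<^sup>2"
      by (simp add: qform_def matrix_vector_mult_scaleR power2_eq_square)
    finally show ?thesis using False by (simp add: field_simps)
  qed simp
  ultimately show ?thesis using that by blast
qed

text \<open>This operator is differentiation along the flow: if \<open>x' = F x\<close>, then
  \<open>qform P x\<close> has time derivative \<open>qform (lyap F P) x\<close>. All decay
  statements below arise in this way.\<close>

definition lyap :: "real^'n^'n \<Rightarrow> real^'n^'n \<Rightarrow> real^'n^'n" where
  "lyap F P = transpose F ** P + P ** F"

lemma lyap_linear: "linear (lyap F)"
  by (rule linearI) (simp_all add: lyap_def matrix_ring_simps algebra_simps)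

lemma lyap_add: "lyap F (P + P') = lyap F P + lyap F P'"
  by (rule linear_add[OF lyap_linear])
lemma lyap_diff: "lyap F (P - P') = lyap F P - lyap F P'"
  by (rule linear_diff[OF lyap_linear])
lemma lyap_scaleR: "lyap F (c *\<^sub>R P) = c *\<^sub>R lyap F P"
  by (rule linear_scale[OF lyap_linear])
lemma transpose_lyap: "transpose (lyap F P) = lyap F (transpose P)"
  by (simp add: lyap_def matrix_ring_simps algebra_simps)

lemma norm_lyap_le: "norm (lyap F P) \<le> 2 * norm F * norm P"
  using norm_matrix_mult_le[of "transpose F" P] norm_matrix_mult_le[of P F]
    norm_triangle_ineq[of "transpose F ** P" "P ** F"]
  by (simp add: lyap_def mult_ac)

lemma inner_lyap: "x \<bullet> (lyap F P *v y) = (F *v x) \<bullet> (P *v y) + x \<bullet> (P *v (F *v y))"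
  by (simp add: lyap_def matrix_vector_mult_add_rdistrib inner_add_right
     matrix_vector_mul_assoc[symmetric] inner_transpose_matrix del: transpose_matrix_vector)

lemma trace_lyap: "trace (lyap F P) = 2 * trace (P ** F)" if "transpose P = P"
proof -
  have "trace (transpose F ** P) = trace (transpose (transpose F ** P))" by (simp add: trace_transpose)
  also have "\<dots> = trace (P ** F)" using that by (simp add: matrix_transpose_mul)
  finally show ?thesis by (simp add: lyap_def trace_add)
qed

lemma inner_symmetric: "transpose P = P \<Longrightarrow> (P *v x) \<bullet> y = x \<bullet> (P *v y)" for P :: "real^'n^'n"
  by (metis inner_matrix_vector_left)

text \<open>
  For a complex eigenvector \<open>a + i b\<close> of \<open>F\<close> with eigenvalue \<open>l\<close>, the values of the form
  \<open>lyap F P\<close> at \<open>a\<close> and \<open>b\<close> add up to \<open>2 Re l\<close> times the sum of those of \<open>P\<close>.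
\<close>

lemma hurwitz_if_lyap_negative:
  fixes F P :: "real^'n^'n"
  assumes sym: "transpose P = P" and psd: "\<And>x. 0 \<le> qform P x"
    and neg: "\<And>x. x \<noteq> 0 \<Longrightarrow> qform (lyap F P) x < 0"
  shows "hurwitz F"
  unfolding hurwitz_def
proof (intro allI impI, elim conjE)
  fix l :: complex and v :: "complex^'n"
  assume v: "v \<noteq> 0" and ev: "(\<chi> i j. complex_of_real (F $ i $ j)) *v v = l *s v"
  define a b where "a = (\<chi> i. Re (v $ i))" and "b = (\<chi> i. Im (v $ i))"
  have Fa: "F *v a = Re l *\<^sub>R a - Im l *\<^sub>R b" and Fb: "F *v b = Im l *\<^sub>R a + Re l *\<^sub>R b"
    using arg_cong[OF ev, of "\<lambda>w. \<chi> i. Re (w $ i)"] arg_cong[OF ev, of "\<lambda>w. \<chi> i. Im (w $ i)"]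
    by (auto simp: vec_eq_iff matrix_vector_mult_def a_def b_def)
  have ab: "a \<noteq> 0 \<or> b \<noteq> 0"
    using v by (auto simp: a_def b_def vec_eq_iff complex_eq_iff)
  have "qform (lyap F P) a + qform (lyap F P) b < 0"
    using ab neg[of a] neg[of b] by (cases "a = 0"; cases "b = 0") auto
  moreover have "qform (lyap F P) a + qform (lyap F P) b = 2 * Re l * (qform P a + qform P b)"
  proof -
    have "b \<bullet> (P *v a) = a \<bullet> (P *v b)"
      by (metis inner_symmetric[OF sym] inner_commute)
    then show ?thesis
      unfolding qform_def inner_lyap Fa Fb
      by (simp add: inner_add_left inner_add_right inner_diff_left inner_diff_right
          matrix_vector_right_distrib matrix_vector_mult_diff_distrib matrix_vector_mult_scaleR ring_distribs)
  qed
  ultimately have "Re l * (qform P a + qform P b) < 0" by simp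
  with psd[of a] psd[of b] show "Re l < 0"
    by (smt (verit) mult_nonneg_nonneg)
qed

section \<open>Linear flows\<close>

text \<open>The matrix exponential of \<open>t F\<close> applied to \<open>z\<close>. Each component
  is a real power series in \<open>t\<close>, so that termwise differentiation is available.\<close>

definition flow :: "real^'n^'n \<Rightarrow> real^'n \<Rightarrow> real \<Rightarrow> real^'n" where
  "flow F z t = (\<chi> i. \<Sum>k. ((((*v) F ^^ k) z) $ i / fact k) * t ^ k)"

lemma norm_funpow_matrix_vector_le: "norm (((*v) F ^^ k) z) \<le> norm F ^ k * norm z"
  for F :: "real^'n^'n"
proof (induction k)
  case (Suc k)
  have "norm (((*v) F ^^ Suc k) z) \<le> norm F * norm (((*v) F ^^ k) z)"
    by (simp add: norm_matrix_vector_mult_le)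
  also have "\<dots> \<le> norm F * (norm F ^ k * norm z)" by (intro mult_left_mono Suc) auto
  finally show ?case by (simp add: mult_ac)
qed simp

lemma summable_flow: "summable (\<lambda>k. ((((*v) F ^^ k) z) $ i / fact k) * t ^ k)"
  for F :: "real^'n^'n"
proof (rule summable_comparison_test')
  show "summable (\<lambda>k. norm z * ((norm F * \<bar>t\<bar>) ^ k / fact k))"
    by (intro summable_mult) (use summable_exp[of "norm F * \<bar>t\<bar>"] in \<open>simp add: field_simps\<close>)
  fix k :: nat
  have "\<bar>(((*v) F ^^ k) z) $ i\<bar> \<le> norm F ^ k * norm z"
    using norm_funpow_matrix_vector_le component_le_norm_cart order.trans by blast
  then have "\<bar>(((*v) F ^^ k) z) $ i\<bar> / fact k * \<bar>t\<bar> ^ k \<le> norm F ^ k * norm z / fact k * \<bar>t\<bar> ^ k"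
    by (intro mult_right_mono divide_right_mono) auto
  then show "norm ((((*v) F ^^ k) z) $ i / fact k * t ^ k) \<le> norm z * ((norm F * \<bar>t\<bar>) ^ k / fact k)"
    by (simp add: abs_mult power_abs power_mult_distrib field_simps)
qed

lemma has_vector_derivative_vec:
  assumes "\<And>i. ((\<lambda>t. f t $ i) has_vector_derivative f' $ i) (at t)"
  shows "(f has_vector_derivative (f' :: real^'n)) (at t)"
proof -
  have eq: "v = (\<Sum>i\<in>UNIV. v $ i *\<^sub>R axis i 1)" for v :: "real^'n"
    using basis_expansion[of v] by (simp add: scalar_mult_eq_scaleR)
  have "((\<lambda>t. \<Sum>i\<in>UNIV. f t $ i *\<^sub>R (axis i 1 :: real^'n)) has_vector_derivative
      (\<Sum>i\<in>UNIV. f' $ i *\<^sub>R axis i 1)) (at t)"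
    by (intro derivative_intros) (use assms in \<open>auto simp: has_real_derivative_iff_has_vector_derivative 
      intro!: has_vector_derivative_scaleR[where g="\<lambda>_. _" and g'=0, simplified]\<close>)
  then show ?thesis by (simp flip: eq)
qed

text \<open>Termwise differentiation: \<open>diffs\<close> turns the coefficient of index
  \<open>k\<close> into one with an additional factor \<open>F\<close>, so the differentiated series
  is \<open>F\<close> times the original one.\<close>

lemma flow_has_vector_derivative: "(flow F z has_vector_derivative (F *v flow F z t)) (at t)"
proof (rule has_vector_derivative_vec)
  fix i
  define c where "c j k = (((*v) F ^^ k) z) $ j / fact k" for j k
  have sm: "summable (\<lambda>k. c j k * s ^ k)" for j s unfolding c_def by (rule summable_flow)
  have "((\<lambda>x. \<Sum>n. c i n * x^n) has_field_derivative (\<Sum>n. diffs (c i) n * t^n)) (at t)"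
    by (intro termdiffs_strong_converges_everywhere sm)
  moreover have "diffs (c i) k = (\<Sum>j\<in>UNIV. F $ i $ j * c j k)" for k
  proof -
    have "diffs (c i) k = (((*v) F ^^ Suc k) z) $ i / fact k"
      by (simp add: diffs_def c_def field_simps del: of_nat_Suc)
    also have "\<dots> = (\<Sum>j\<in>UNIV. F $ i $ j * c j k)"
      by (simp add: c_def matrix_vector_mult_def sum_divide_distrib)
    finally show ?thesis .
  qed
  then have "(\<Sum>k. diffs (c i) k * t ^ k) = (\<Sum>k. \<Sum>j\<in>UNIV. F $ i $ j * (c j k * t ^ k))"
    by (simp add: sum_distrib_right mult.assoc)
  also have "\<dots> = (\<Sum>j\<in>UNIV. F $ i $ j * (\<Sum>k. c j k * t ^ k))"
    by (subst suminf_sum) (auto intro!: summable_mult sm sum.cong suminf_mult)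
  also have "\<dots> = (F *v flow F z t) $ i" by (simp add: flow_def c_def matrix_vector_mult_def)
  ultimately show "((\<lambda>t. flow F z t $ i) has_vector_derivative (F *v flow F z t) $ i) (at t)"
    by (simp add: flow_def c_def has_real_derivative_iff_has_vector_derivative)
qed

lemma flow_0 [simp]: "flow F z 0 = z"
proof -
  have "(\<Sum>k. ((((*v) F ^^ k) z) $ i / fact k) * 0 ^ k) = z $ i" for i
    using powser_zero[of "\<lambda>k. (((*v) F ^^ k) z) $ i / fact k"] by simp
  then show ?thesis by (simp add: flow_def vec_eq_iff)
qed

text \<open>Gronwall for the squared norm, which changes at a rate of at most
  \<open>2 * norm F\<close> times itself. Both time directions are treated because
  \<open>closed_loop\<close> demands a unique solution on the whole line.\<close>

lemma matrix_ode_zero: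
  fixes F :: "real^'n^'n"
  assumes x: "\<And>t. (x has_vector_derivative (F *v x t)) (at t)" and x0: "x 0 = 0"
  shows "x t = 0"
proof -
  define c where "c = 2 * norm F"
  define N where "N t = x t \<bullet> x t" for t
  have dN: "(N has_real_derivative 2 * (x t \<bullet> (F *v x t))) (at t)" for t
    unfolding N_def has_real_derivative_iff_has_vector_derivative
    using bounded_bilinear.has_vector_derivative[OF bounded_bilinear_inner x x, of t] by (simp add: inner_commute)
  have bd: "\<bar>2 * (x t \<bullet> (F *v x t))\<bar> \<le> c * N t" for t
    using abs_qform_le[of F "x t"] by (simp add: qform_def N_def c_def dot_square_norm)
  have N0: "N 0 = 0" and Nn: "N t \<ge> 0" for t by (auto simp: N_def x0)
  have "N t \<le> 0"
  proof (cases "t \<ge> 0")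
    case True
    have "N t * exp (- c * t) \<le> N 0 * exp (- c * 0)"
    proof (rule DERIV_nonpos_imp_nonincreasing[OF True])
      fix s
      have "((\<lambda>t. N t * exp (- c * t)) has_real_derivative (2 * (x s \<bullet> (F *v x s)) - c * N s) * exp (- c * s)) (at s)"
        by (auto intro!: derivative_eq_intros dN simp: algebra_simps)
      moreover have "(2 * (x s \<bullet> (F *v x s)) - c * N s) * exp (- c * s) \<le> 0"
        using bd[of s] by (intro mult_nonpos_nonneg) auto
      ultimately show "\<exists>y. ((\<lambda>t. N t * exp (- c * t)) has_real_derivative y) (at s) \<and> y \<le> 0" by blast
    qed
    then show ?thesis by (simp add: N0 mult_le_0_iff)
  next
    case False
    have "N t * exp (c * t) \<le> N 0 * exp (c * 0)"
    proof (rule DERIV_nonneg_imp_nondecreasing[of t 0])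
      show "t \<le> 0" using False by simp
      fix s
      have "((\<lambda>t. N t * exp (c * t)) has_real_derivative (2 * (x s \<bullet> (F *v x s)) + c * N s) * exp (c * s)) (at s)"
        by (auto intro!: derivative_eq_intros dN simp: algebra_simps)
      moreover have "(2 * (x s \<bullet> (F *v x s)) + c * N s) * exp (c * s) \<ge> 0"
        using bd[of s] by (intro mult_nonneg_nonneg) auto
      ultimately show "\<exists>y. ((\<lambda>t. N t * exp (c * t)) has_real_derivative y) (at s) \<and> 0 \<le> y" by blast
    qed
    then show ?thesis by (simp add: N0 mult_le_0_iff)
  qed
  then show ?thesis by (metis N_def inner_gt_zero_iff not_le)
qed

lemma flow_unique:
  assumes "\<And>t. (x has_vector_derivative (F *v x t)) (at t)"
  shows "x = flow F (x 0)"
proof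
  fix t
  have "x t - flow F (x 0) t = 0"
    by (rule matrix_ode_zero[of "\<lambda>t. x t - flow F (x 0) t" F])
      (auto intro!: derivative_eq_intros assms flow_has_vector_derivative simp: matrix_vector_mult_diff_distrib)
  then show "x t = flow F (x 0) t" by simp
qed

lemma closed_loop_eq_flow: "closed_loop A B K z = flow (A - B ** K) z"
proof -
  have eq: "A *v y + B *v (- (K *v y)) = (A - B ** K) *v y" for y
    by (simp add: matrix_vector_mult_diff_rdistrib matrix_vector_mul_assoc[symmetric]
       linear_neg[OF matrix_vector_mul_linear])
  show ?thesis unfolding closed_loop_def eq
  proof (rule the_equality)
    fix x assume "x 0 = z \<and> (\<forall>t. (x has_vector_derivative (A - B ** K) *v x t) (at t))"
    then show "x = flow (A - B ** K) z" using flow_unique[of x "A - B ** K"] by simp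
  qed (simp add: flow_has_vector_derivative)
qed

text \<open>Measurability is joint in matrix, initial state and time because in the algorithm the
  closed-loop matrix is random as well. Every term of the series is continuous in all three
  arguments.\<close>

lemma borel_measurable_flow [measurable]:
  "(\<lambda>(F, z, t). flow F z t) \<in> borel_measurable (borel :: ((real^'n^'n) \<times> (real^'n) \<times> real) measure)"
proof -
  have mv: "continuous_on UNIV (\<lambda>p :: (real^'n^'n) \<times> (real^'n) \<times> real. fst p *v g p)"
    if "continuous_on UNIV g" for g
    unfolding matrix_vector_mult_def by (intro continuous_intros that)
  have c: "continuous_on UNIV (\<lambda>p :: (real^'n^'n) \<times> (real^'n) \<times> real. (((*v) (fst p) ^^ k) (fst (snd p))))" for k
  proof (induction k)
    case (Suc k)
    show ?case unfolding funpow.simps comp_def by (rule mv[OF Suc])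
  qed (auto intro!: continuous_intros)
  have "(\<lambda>p :: (real^'n^'n) \<times> (real^'n) \<times> real. \<Sum>k. ((((*v) (fst p) ^^ k) (fst (snd p))) $ i / fact k) * (snd (snd p)) ^ k)
      \<in> borel_measurable borel" for i
    by (intro borel_measurable_suminf borel_measurable_continuous_onI continuous_intros c) auto
  then have "(\<lambda>p :: (real^'n^'n) \<times> (real^'n) \<times> real. flow (fst p) (fst (snd p)) (snd (snd p)) $ i) \<in> borel_measurable borel" for i
    unfolding flow_def by (simp only: vec_lambda_beta)
  then have "(\<lambda>p :: (real^'n^'n) \<times> (real^'n) \<times> real. flow (fst p) (fst (snd p)) (snd (snd p)) \<bullet> b) \<in> borel_measurable borel"
    if "b \<in> Basis" for b :: "real^'n"
    using that by (auto simp: Basis_vec_def inner_axis)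
  then show ?thesis
    unfolding split_beta' by (subst borel_measurable_euclidean_space) auto
qed

text \<open>Energy estimate: the squared modulus is damped at a positive rate and driven by a
  forcing that tends to 0. One application handles one linear factor of an annihilating
  polynomial.\<close>

lemma decay_of_perturbed_scalar_ode:
  fixes \<phi> \<psi> :: "real \<Rightarrow> complex"
  assumes d: "\<And>t. (\<phi> has_vector_derivative (l * \<phi> t + \<psi> t)) (at t)"
    and l: "Re l < 0" and \<psi>: "(\<psi> \<longlongrightarrow> 0) at_top"
  shows "(\<phi> \<longlongrightarrow> 0) at_top"
proof -
  define s where "s = - Re l"
  have s: "s > 0" using l by (simp add: s_def)
  define N where "N t = \<phi> t \<bullet> \<phi> t" for t
  define N' where "N' t = 2 * (\<phi> t \<bullet> (l * \<phi> t + \<psi> t))" for t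
  have dN: "(N has_real_derivative N' t) (at t)" for t
    unfolding N_def N'_def has_real_derivative_iff_has_vector_derivative
    using bounded_bilinear.has_vector_derivative[OF bounded_bilinear_inner d d, of t] by (simp add: inner_commute)
  have le: "N' t \<le> - s * N t + (norm (\<psi> t))\<^sup>2 / s" for t
  proof -
    have "N' t = - 2 * s * N t + 2 * (\<phi> t \<bullet> \<psi> t)"
      by (simp add: N'_def N_def s_def inner_complex_def algebra_simps)
    moreover have "2 * (\<phi> t \<bullet> \<psi> t) \<le> s * N t + (norm (\<psi> t))\<^sup>2 / s"
    proof -
      \<comment> \<open>Young's inequality with weight \<open>s\<close>: half of the damping
        \<open>2 * s\<close> absorbs the mixed term, the other half survives.\<close>
      have "0 \<le> (s * norm (\<phi> t) - norm (\<psi> t))\<^sup>2" by simp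
      then have "2 * s * (norm (\<phi> t) * norm (\<psi> t)) \<le> s\<^sup>2 * (norm (\<phi> t))\<^sup>2 + (norm (\<psi> t))\<^sup>2"
        by (simp add: power2_eq_square algebra_simps)
      with s have "2 * (norm (\<phi> t) * norm (\<psi> t)) \<le> s * (norm (\<phi> t))\<^sup>2 + (norm (\<psi> t))\<^sup>2 / s"
        by (simp add: field_simps power2_eq_square)
      moreover have "\<phi> t \<bullet> \<psi> t \<le> norm (\<phi> t) * norm (\<psi> t)" by (rule norm_cauchy_schwarz)
      ultimately show ?thesis by (simp add: N_def dot_square_norm)
    qed
    ultimately show ?thesis by linarith
  qed
  have "(N \<longlongrightarrow> 0) at_top"
  proof (rule tendstoI)
    fix e :: real assume "e > 0"
    define e2 where "e2 = e / 2"
    have e2: "e2 > 0" using \<open>e > 0\<close> by (simp add: e2_def)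
    have "((\<lambda>t. (norm (\<psi> t))\<^sup>2) \<longlongrightarrow> 0) at_top"
      using tendsto_power[OF tendsto_norm[OF \<psi>], of 2] by simp
    then have "\<forall>\<^sub>F t in at_top. (norm (\<psi> t))\<^sup>2 < s\<^sup>2 * e2"
      by (rule order_tendstoD) (use s e2 in auto)
    then obtain t0 where t0: "\<And>t. t \<ge> t0 \<Longrightarrow> (norm (\<psi> t))\<^sup>2 < s\<^sup>2 * e2"
      by (auto simp: eventually_at_top_linorder)
    \<comment> \<open>Beyond \<open>t0\<close> the forcing contributes at most
      \<open>s * e2\<close>, so with the integrating factor the excess of \<open>N\<close> over
      \<open>e2\<close> cannot grow, and without it the excess decays exponentially.\<close>
    define h where "h t = (N t - e2) * exp (s * t)" for t
    have dec: "h t \<le> h t0" if "t \<ge> t0" for t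
    proof (rule DERIV_nonpos_imp_nonincreasing[OF that])
      fix u assume "t0 \<le> u"
      have "(h has_real_derivative (N' u + s * (N u - e2)) * exp (s * u)) (at u)"
        unfolding h_def by (auto intro!: derivative_eq_intros dN simp: algebra_simps)
      moreover have "(N' u + s * (N u - e2)) * exp (s * u) \<le> 0"
      proof (rule mult_nonpos_nonneg)
        have "(norm (\<psi> u))\<^sup>2 / s \<le> s * e2"
          using t0[OF \<open>t0 \<le> u\<close>] s by (simp add: field_simps power2_eq_square)
        then show "N' u + s * (N u - e2) \<le> 0" using le[of u] by (simp add: algebra_simps)
      qed auto
      ultimately show "\<exists>y. (h has_real_derivative y) (at u) \<and> y \<le> 0" by blast
    qed
    have "((\<lambda>t. h t0 * exp (- (s * t))) \<longlongrightarrow> h t0 * 0) at_top"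
      by (intro tendsto_mult tendsto_const filterlim_compose[OF exp_at_bot])
        (use s in \<open>auto simp: filterlim_uminus_at_bot intro!: filterlim_tendsto_pos_mult_at_top[OF tendsto_const] filterlim_ident\<close>)
    then have "\<forall>\<^sub>F t in at_top. h t0 * exp (- (s * t)) < e2"
      by (rule order_tendstoD) (use e2 in auto)
    then show "\<forall>\<^sub>F t in at_top. dist (N t) 0 < e"
      using eventually_ge_at_top[of t0]
    proof eventually_elim
      case (elim t)
      have "N t = e2 + h t * exp (- (s * t))" by (simp add: h_def mult.assoc flip: exp_add)
      also have "\<dots> \<le> e2 + h t0 * exp (- (s * t))" using dec[OF elim(2)] by simp
      also have "\<dots> < e" using elim(1) by (simp add: e2_def)
      finally show ?case by (simp add: N_def)
    qed
  qed
  then have "((\<lambda>t. sqrt (N t)) \<longlongrightarrow> sqrt 0) at_top" by (rule tendsto_real_sqrt)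
  then have "((\<lambda>t. norm (\<phi> t)) \<longlongrightarrow> 0) at_top" by (simp add: N_def norm_eq_sqrt_inner)
  then show ?thesis by (rule tendsto_norm_zero_cancel)
qed

section \<open>Decay of Hurwitz flows by polynomials annihilating a vector\<close>

definition poly_action :: "complex^'n^'n \<Rightarrow> complex poly \<Rightarrow> complex^'n \<Rightarrow> complex^'n" where
  "poly_action F p c = (\<Sum>i\<le>degree p. coeff p i *s ((*v) F ^^ i) c)"

lemma poly_action_eq:
  "degree p \<le> N \<Longrightarrow> poly_action F p c = (\<Sum>i\<le>N. coeff p i *s ((*v) F ^^ i) c)"
  unfolding poly_action_def
  by (rule sum.mono_neutral_left) (auto simp: coeff_eq_0 not_le)

lemma funpow_matrix_vector_diff_scale:
  "((*v) F ^^ i) (x - a *s y) = ((*v) F ^^ i) x - a *s ((*v) F ^^ i) y" for F :: "complex^'n^'n"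
  by (induction i) (auto simp: matrix_vector_mult_diff_distrib vector_scalar_commute)

text \<open>The two forms have different uses when the product annihilates \<open>c\<close>: by the
  first, \<open>poly_action F q c\<close> is an eigenvector for \<open>l\<close> unless it is 0; by
  the second, \<open>q\<close>, of smaller degree, annihilates
  \<open>F *v c - l *s c\<close>.\<close>

lemma poly_action_linear_factor:
  fixes F :: "complex^'n^'n"
  shows "poly_action F ([:- l, 1:] * q) c = F *v poly_action F q c - l *s poly_action F q c"
    and "poly_action F ([:- l, 1:] * q) c = poly_action F q (F *v c - l *s c)"
proof -
  let ?N = "Suc (degree q)"
  have eq: "[:- l, 1:] * q = pCons 0 q - smult l q" by simp
  have dg: "degree ([:- l, 1:] * q) \<le> ?N"
    using degree_mult_le[of "[:- l, 1:]" q] by simp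
  have ss: "(\<Sum>i\<in>S. f i) *s v = (\<Sum>i\<in>S. f i *s v)" for f :: "nat \<Rightarrow> complex" and v :: "complex^'n" and S
    by (simp add: vec_eq_iff sum_distrib_right)
  have Fs: "F *v (\<Sum>i\<le>n. a i *s g i) = (\<Sum>i\<le>n. a i *s (F *v g i))" for n and a :: "nat \<Rightarrow> complex" and g
    by (induction n) (auto simp: matrix_vector_right_distrib vector_scalar_commute)
  have sc: "l *s (\<Sum>i\<in>S. f i) = (\<Sum>i\<in>S. l *s f i)" for f :: "nat \<Rightarrow> complex^'n" and S
    by (simp add: vec_eq_iff sum_distrib_left)
  have "poly_action F ([:- l, 1:] * q) c = (\<Sum>i\<le>?N. coeff (pCons 0 q - smult l q) i *s ((*v) F ^^ i) c)"
    using poly_action_eq[OF dg] unfolding eq .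
  also have "\<dots> = (\<Sum>i\<le>?N. coeff (pCons 0 q) i *s ((*v) F ^^ i) c) - l *s (\<Sum>i\<le>?N. coeff q i *s ((*v) F ^^ i) c)"
    unfolding sc sum_subtractf[symmetric] by (rule sum.cong) (auto simp: vector_smult_assoc vec_eq_iff algebra_simps)
  also have "(\<Sum>i\<le>?N. coeff (pCons 0 q) i *s ((*v) F ^^ i) c) = F *v poly_action F q c"
    unfolding sum.atMost_Suc_shift by (simp add: poly_action_def Fs)
  also have "(\<Sum>i\<le>?N. coeff q i *s ((*v) F ^^ i) c) = poly_action F q c"
    by (rule poly_action_eq[symmetric]) simp
  finally show 1: "poly_action F ([:- l, 1:] * q) c = F *v poly_action F q c - l *s poly_action F q c" .
  have "poly_action F q (F *v c - l *s c) = (\<Sum>i\<le>degree q. coeff q i *s (F *v ((*v) F ^^ i) c)) - l *s poly_action F q c"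
    unfolding poly_action_def funpow_matrix_vector_diff_scale sc sum_subtractf[symmetric]
    by (rule sum.cong) (auto simp: vec_eq_iff algebra_simps funpow_swap1)
  also have "\<dots> = F *v poly_action F q c - l *s poly_action F q c"
    by (simp add: poly_action_def Fs)
  finally show "poly_action F ([:- l, 1:] * q) c = poly_action F q (F *v c - l *s c)" using 1 by simp
qed

text \<open>There is one vector more than the dimension. Repetitions are treated separately because
  \<open>dependent\<close> speaks of the set of vectors, in which equal members of the family
  coincide.\<close>

lemma linear_relation_exists:
  fixes w :: "nat \<Rightarrow> 'a::euclidean_space"
  shows "\<exists>u. (\<exists>k\<le>DIM('a). u k \<noteq> 0) \<and> (\<Sum>k\<le>DIM('a). u k *\<^sub>R w k) = 0"
proof (cases "inj_on w {..DIM('a)}")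
  case True
  then have "card (w ` {..DIM('a)}) > DIM('a)" by (simp add: card_image)
  then have "dependent (w ` {..DIM('a)})" by (intro dependent_biggerset) auto
  then obtain u where u: "\<exists>v\<in>w ` {..DIM('a)}. u v \<noteq> 0" "(\<Sum>v\<in>w ` {..DIM('a)}. u v *\<^sub>R v) = 0"
    by (subst (asm) real_vector.dependent_finite) auto
  then show ?thesis
    by (intro exI[of _ "\<lambda>k. u (w k)"]) (auto simp: sum.reindex[OF True])
next
  case False
  then obtain i j where ij: "i \<le> DIM('a)" "j \<le> DIM('a)" "i \<noteq> j" "w i = w j"
    by (auto simp: inj_on_def)
  let ?u = "\<lambda>k. if k = i then 1 else if k = j then - 1 else (0::real)"
  have "(\<Sum>k\<le>DIM('a). ?u k *\<^sub>R w k) = (\<Sum>k\<in>{i, j}. ?u k *\<^sub>R w k)"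
    using ij by (intro sum.mono_neutral_right) auto
  also have "\<dots> = 0" using ij by simp
  finally show ?thesis using ij by (intro exI[of _ ?u]) auto
qed

text \<open>The iterates of \<open>F\<close> on \<open>c\<close> satisfy a real linear relation,
  since \<open>complex^'n\<close> has finite real dimension; its coefficients are those of the
  polynomial.\<close>

lemma annihilating_poly_exists:
  fixes F :: "complex^'n^'n"
  shows "\<exists>p. p \<noteq> 0 \<and> poly_action F p c = 0"
proof -
  let ?d = "DIM(complex^'n)"
  obtain u k where u: "k \<le> ?d" "u k \<noteq> 0" "(\<Sum>k\<le>?d. u k *\<^sub>R (((*v) F ^^ k) c)) = 0"
    using linear_relation_exists[of "\<lambda>k. ((*v) F ^^ k) c"] by auto
  define p where "p = (\<Sum>k\<le>?d. monom (complex_of_real (u k)) k)"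
  have cf: "coeff p i = (if i \<le> ?d then complex_of_real (u i) else 0)" for i
    unfolding p_def coeff_sum coeff_monom by (simp add: sum.delta)
  have "p \<noteq> 0" using cf[of k] u by auto
  moreover have "degree p \<le> ?d" by (rule degree_le) (simp add: cf)
  then have "poly_action F p c = (\<Sum>k\<le>?d. u k *\<^sub>R (((*v) F ^^ k) c))"
    by (subst poly_action_eq) (auto intro!: sum.cong simp: cf vec_eq_iff scaleR_conv_of_real[where 'a=complex])
  ultimately show ?thesis using u by auto
qed

text \<open>A matrix and its transpose have the same determinant. This is needed because
  \<open>hurwitz\<close> speaks of \<open>F\<close>, whereas linear functionals of the flow evolve
  under the transpose.\<close>

lemma eigenvalue_transpose:
  fixes C :: "complex^'n^'n"
  assumes "w \<noteq> 0" and "transpose C *v w = l *s w"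
  shows "\<exists>v. v \<noteq> 0 \<and> C *v v = l *s v"
proof -
  have tr: "transpose (C - mat l) = transpose C - mat l"
    by (auto simp: transpose_def mat_def vec_eq_iff)
  have ml: "mat l *v v = l *s v" for v :: "complex^'n"
    by (simp add: vec_eq_iff matrix_vector_mult_def mat_def if_distrib if_distribR cong: if_cong)
  have "transpose (C - mat l) *v w = 0"
    unfolding tr matrix_vector_mult_diff_rdistrib assms ml by simp
  then have "\<not> invertible (transpose (C - mat l))"
    unfolding invertible_left_inverse matrix_left_invertible_ker using assms(1) by blast
  then have "\<not> invertible (C - mat l)" by (simp add: invertible_det_nz)
  then obtain v where "v \<noteq> 0" "(C - mat l) *v v = 0"
    unfolding invertible_left_inverse matrix_left_invertible_ker by blast
  then show ?thesis by (auto simp: matrix_vector_mult_diff_rdistrib ml)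
qed

text \<open>The functional \<open>\<phi> c\<close> of the flow has derivative
  \<open>\<phi> (G *v c)\<close>. Splitting a root \<open>l\<close> off a polynomial that
  annihilates \<open>c\<close> turns this into a scalar equation with coefficient \<open>l\<close>,
  forced by a functional whose vector has an annihilating polynomial of smaller degree; induction on
  the degree gives decay.\<close>

lemma hurwitz_flow_tendsto_0:
  fixes F :: "real^'n^'n"
  assumes "hurwitz F"
  shows "(flow F z \<longlongrightarrow> 0) at_top"
proof -
  define C :: "complex^'n^'n" where "C = (\<chi> i j. complex_of_real (F $ i $ j))"
  define G where "G = transpose C"
  define \<phi> where "\<phi> c t = (\<Sum>i\<in>UNIV. c $ i * complex_of_real (flow F z t $ i))" for c :: "complex^'n" and t
  have ev: "Re l < 0" if "G *v w = l *s w" "w \<noteq> 0" for l w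
    using eigenvalue_transpose[of w C l] that assms unfolding G_def C_def hurwitz_def by blast
  have d\<phi>: "(\<phi> c has_vector_derivative \<phi> (G *v c) t) (at t)" for c t
  proof -
    have fl: "((\<lambda>t. flow F z t $ i) has_real_derivative (F *v flow F z t) $ i) (at t)" for i
      unfolding has_real_derivative_iff_has_vector_derivative
      using bounded_linear.has_vector_derivative[OF bounded_linear_vec_nth flow_has_vector_derivative] .
    have "(\<phi> c has_vector_derivative (\<Sum>i\<in>UNIV. c $ i * complex_of_real ((F *v flow F z t) $ i))) (at t)"
      unfolding \<phi>_def
      by (intro derivative_intros has_vector_derivative_mult_right has_vector_derivative_of_real
fl)
    also have "(\<Sum>i\<in>UNIV. c $ i * complex_of_real ((F *v flow F z t) $ i)) = 
       (\<Sum>i\<in>UNIV. \<Sum>j\<in>UNIV. c $ i * (C $ i $ j * complex_of_real (flow F z t $ j)))"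
      by (simp add: matrix_vector_mult_def C_def sum_distrib_left)
    also have "\<dots> = \<phi> (G *v c) t"
      unfolding \<phi>_def G_def by (subst sum.swap)
        (simp add: matrix_vector_mult_def transpose_def sum_distrib_right sum_distrib_left mult_ac del: transpose_matrix_vector)
    finally show ?thesis .
  qed
  have lin: "\<phi> (x - l *s y) t = \<phi> x t - l * \<phi> y t" for x y l t
    by (simp add: \<phi>_def algebra_simps sum_subtractf sum_distrib_left)
  have key: "(\<phi> c \<longlongrightarrow> 0) at_top" if "p \<noteq> 0" "poly_action G p c = 0" for p c
    using that
  proof (induction "degree p" arbitrary: p c)
    case 0
    then have "c = 0" by (auto simp: poly_action_def vec_eq_iff elim!: degree_eq_zeroE)
    then show ?case by (simp add: \<phi>_def)
  next
    case (Suc n)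
    then obtain l where "poly p l = 0"
      using fundamental_theorem_of_algebra[of p] by (auto simp: constant_degree)
    then obtain q where p: "p = [:- l, 1:] * q" by (auto simp: poly_eq_0_iff_dvd)
    with Suc.prems have q: "q \<noteq> 0" by auto
    have "degree p = Suc (degree q)" unfolding p by (subst degree_mult_eq) (use q in auto)
    then have n: "n = degree q" using Suc by simp
    \<comment> \<open>Either \<open>q\<close> already annihilates \<open>c\<close>, or
      \<open>poly_action G q c\<close> is an eigenvector for \<open>l\<close>; only in the second
      case is the sign of \<open>Re l\<close> available.\<close>
    show ?case
    proof (cases "poly_action G q c = 0")
      case True
      then show ?thesis using Suc.hyps(1)[OF n q] by blast
    next
      case False
      have "G *v poly_action G q c = l *s poly_action G q c"
        using Suc.prems(2) unfolding p poly_action_linear_factor(1) by simp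
      then have l: "Re l < 0" using ev False by blast
      have \<psi>: "(\<phi> (G *v c - l *s c) \<longlongrightarrow> 0) at_top"
        using Suc.prems(2) unfolding p poly_action_linear_factor(2) by (rule Suc.hyps(1)[OF n q])
      show ?thesis
        by (rule decay_of_perturbed_scalar_ode[OF _ l \<psi>]) (use d\<phi>[of c] in \<open>simp add: lin\<close>)
    qed
  qed
  have "((\<lambda>t. flow F z t $ i) \<longlongrightarrow> 0) at_top" for i
  proof -
    obtain p where "p \<noteq> 0" "poly_action G p (axis i 1) = 0"
      using annihilating_poly_exists by blast
    then have "(\<phi> (axis i 1) \<longlongrightarrow> 0) at_top" by (rule key)
    moreover have "\<phi> (axis i 1) t = complex_of_real (flow F z t $ i)" for t
      by (simp add: \<phi>_def axis_def if_distrib if_distribR cong: if_cong)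
    ultimately show ?thesis using tendsto_Re[of "\<phi> (axis i 1)" 0 at_top] by simp
  qed
  then show ?thesis by (intro vec_tendstoI) auto
qed

section \<open>Lyapunov equations\<close>

lemma inner_flow_has_real_derivative:
  "((\<lambda>t. flow F u t \<bullet> (P *v flow F v t)) has_real_derivative
     flow F u t \<bullet> (lyap F P *v flow F v t)) (at t)"
proof -
  have "((\<lambda>t. P *v flow F v t) has_vector_derivative P *v (F *v flow F v t)) (at t)"
    by (intro bounded_linear.has_vector_derivative[OF matrix_vector_mul_bounded_linear] flow_has_vector_derivative)
  from bounded_bilinear.has_vector_derivative[OF bounded_bilinear_inner flow_has_vector_derivative[of F u t] this]
  show ?thesis unfolding has_real_derivative_iff_has_vector_derivative inner_lyap by (simp add: add.commute)
qed

lemma qform_flow_has_real_derivative: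
  "((\<lambda>t. qform P (flow F z t)) has_real_derivative qform (lyap F P) (flow F z t)) (at t)"
  unfolding qform_def by (rule inner_flow_has_real_derivative)

lemma inner_flow_tendsto_0:
  assumes "hurwitz F"
  shows "((\<lambda>t. flow F u t \<bullet> (P *v flow F v t)) \<longlongrightarrow> 0) at_top"
proof -
  have "((\<lambda>t. P *v flow F v t) \<longlongrightarrow> P *v 0) at_top"
    by (intro bounded_linear.tendsto[OF matrix_vector_mul_bounded_linear] hurwitz_flow_tendsto_0 assms)
  from tendsto_inner[OF hurwitz_flow_tendsto_0[OF assms, of u] this] show ?thesis by simp
qed

lemma qform_flow_tendsto_0: "hurwitz F \<Longrightarrow> ((\<lambda>t. qform P (flow F z t)) \<longlongrightarrow> 0) at_top"
  unfolding qform_def by (rule inner_flow_tendsto_0)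

text \<open>With \<open>lyap F P = 0\<close> the bilinear form of \<open>P\<close> is constant along
  two flow lines, yet it tends to 0; hence it vanishes at the starting points, which are
  arbitrary.\<close>

lemma lyap_eq_0_iff:
  fixes F P :: "real^'n^'n"
  assumes F: "hurwitz F" and P: "lyap F P = 0"
  shows "P = 0"
proof -
  have "u \<bullet> (P *v v) = 0" for u v
  proof -
    let ?g = "\<lambda>t. flow F u t \<bullet> (P *v flow F v t)"
    have "\<And>t. (?g has_real_derivative 0) (at t)"
      using inner_flow_has_real_derivative[of F u P v] P by simp
    then have "?g t = ?g 0" for t by (rule DERIV_isconst_all[rule_format]) 
    then have "?g = (\<lambda>_. u \<bullet> (P *v v))" by (auto simp: fun_eq_iff)
    then have "((\<lambda>_. u \<bullet> (P *v v)) \<longlongrightarrow> 0) (at_top :: real filter)"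
      using inner_flow_tendsto_0[OF F, of u P v] by simp
    then show ?thesis by (simp add: tendsto_const_iff)
  qed
  then have "P $ i $ j = 0" for i j
    by (metis inner_axis' matrix_vector_axis_component mult.left_neutral real_inner_1_left)
  then show ?thesis by (simp add: vec_eq_iff)
qed

text \<open>For Hurwitz \<open>F\<close> this is the integral over nonnegative times of
  \<open>S\<close> transported by the flow, that is of
  \<open>transpose (exp (t F)) ** S ** exp (t F)\<close>. The sign in the equation is what makes it
  preserve positive semidefiniteness.\<close>

definition lyap_inv :: "real^'n^'n \<Rightarrow> real^'n^'n \<Rightarrow> real^'n^'n" where
  "lyap_inv F S = (THE P. lyap F P + S = 0)"

text \<open>A linear endomorphism of a finite-dimensional space with trivial kernel is bijective, so
  uniqueness yields existence.\<close>

lemma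
  fixes F :: "real^'n^'n"
  assumes F: "hurwitz F"
  shows lyap_inv_unique: "lyap F P + S = 0 \<Longrightarrow> lyap_inv F S = P"
    and lyap_inv_eq: "lyap F (lyap_inv F S) = - S"
proof -
  have "inj (lyap F)"
    unfolding linear_injective_0[OF lyap_linear] using lyap_eq_0_iff[OF F] by blast
  then have bij: "bij (lyap F)"
    using linear_injective_imp_surjective[OF lyap_linear] by (auto simp: bij_def)
  show u: "lyap_inv F S = P" if "lyap F P + S = 0" for P
    unfolding lyap_inv_def
    by (rule the_equality) (use that \<open>inj (lyap F)\<close> in \<open>auto simp: add_eq_0_iff2 inj_def\<close>)
  obtain P where "lyap F P = - S" using bij by (metis bij_pointE)
  with u[of P] show "lyap F (lyap_inv F S) = - S" by simp
qed

lemma lyap_inv_eqI: "hurwitz F \<Longrightarrow> lyap F P = - S \<Longrightarrow> lyap_inv F S = P"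
  by (rule lyap_inv_unique) auto

lemma lyap_inv_add: "hurwitz F \<Longrightarrow> lyap_inv F (S + T) = lyap_inv F S + lyap_inv F T"
  by (rule lyap_inv_eqI) (auto simp: lyap_add lyap_inv_eq)
lemma lyap_inv_diff: "hurwitz F \<Longrightarrow> lyap_inv F (S - T) = lyap_inv F S - lyap_inv F T"
  by (rule lyap_inv_eqI) (auto simp: lyap_diff lyap_inv_eq)
lemma lyap_inv_scaleR: "hurwitz F \<Longrightarrow> lyap_inv F (c *\<^sub>R S) = c *\<^sub>R lyap_inv F S"
  by (rule lyap_inv_eqI) (auto simp: lyap_scaleR lyap_inv_eq)
lemma transpose_lyap_inv:
  "hurwitz F \<Longrightarrow> transpose S = S \<Longrightarrow> transpose (lyap_inv F S) = lyap_inv F S"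
  by (rule lyap_inv_eqI[symmetric]) (auto simp: transpose_lyap[symmetric] lyap_inv_eq transpose_uminus)

text \<open>Along the flow the form of the solution has derivative \<open>- qform S\<close>, so it
  decreases to its limit 0 and must have started nonnegative.\<close>

lemma qform_lyap_inv_nonneg:
  assumes F: "hurwitz F" and S: "\<And>x. 0 \<le> qform S x"
  shows "0 \<le> qform (lyap_inv F S) z"
proof (rule tendsto_upperbound[OF qform_flow_tendsto_0[OF F, of "lyap_inv F S" z]])
  have "qform (lyap_inv F S) (flow F z t) \<le> qform (lyap_inv F S) (flow F z 0)" if "t \<ge> 0" for t
  proof (rule DERIV_nonpos_imp_nonincreasing[OF that])
    fix s
    show "\<exists>y. ((\<lambda>t. qform (lyap_inv F S) (flow F z t)) has_real_derivative y) (at s) \<and> y \<le> 0"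
      using qform_flow_has_real_derivative[of "lyap_inv F S" F z s] S
      by (auto simp: lyap_inv_eq[OF F] qform_uminus)
  qed
  then show "\<forall>\<^sub>F t in at_top. qform (lyap_inv F S) (flow F z t) \<le> qform (lyap_inv F S) z"
    using eventually_ge_at_top[of "0::real"] by (auto simp: eventually_at_top_linorder)
qed auto

lemma qform_lyap_inv_mono:
  assumes F: "hurwitz F" and S: "\<And>x. qform S x \<le> qform T x"
  shows "qform (lyap_inv F S) z \<le> qform (lyap_inv F T) z"
  using qform_lyap_inv_nonneg[OF F, of "T - S" z] S by (simp add: lyap_inv_diff[OF F] qform_diff)

text \<open>The two-sided comparison of \<open>S\<close> with \<open>k\<close> times
  \<open>W\<close> passes through the solution operator by monotonicity. One trace then controls the
  solutions for all such \<open>S\<close>; with the cost weight as \<open>W\<close>, that trace is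
  the cost.\<close>

lemma norm_lyap_inv_le:
  fixes F :: "real^'n^'n"
  assumes F: "hurwitz F" and sym: "transpose S = S" and k: "0 \<le> k"
    and W: "\<And>x. 0 \<le> qform W x" and le: "\<And>x. \<bar>qform S x\<bar> \<le> k * qform W x"
  shows "norm (lyap_inv F S) \<le> (real CARD('n))\<^sup>2 * k * trace (lyap_inv F W)"
proof (rule norm_le_trace_of_qform_le)
  show "\<bar>qform (lyap_inv F S) x\<bar> \<le> k * qform (lyap_inv F W) x" for x
  proof -
    have bd: "qform S x \<le> k * qform W x" "- k * qform W x \<le> qform S x" for x
      using le[of x] by auto
    have "qform (lyap_inv F S) x \<le> qform (lyap_inv F (k *\<^sub>R W)) x"
      by (rule qform_lyap_inv_mono[OF F]) (simp only: qform_scaleR bd)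
    moreover have "qform (lyap_inv F ((- k) *\<^sub>R W)) x \<le> qform (lyap_inv F S) x"
      by (rule qform_lyap_inv_mono[OF F]) (simp only: qform_scaleR bd)
    ultimately show ?thesis unfolding lyap_inv_scaleR[OF F] qform_scaleR by linarith
  qed
qed (use assms qform_lyap_inv_nonneg[OF F W] transpose_lyap_inv[OF F sym] in auto)

text \<open>Taking the trace of the Lyapunov equation gives
  \<open>trace S = - 2 * trace (Y ** F)\<close> for the solution \<open>Y\<close>. This is a lower
  bound on the solution, opposite in direction to \<open>norm_lyap_inv_le\<close>.\<close>

lemma trace_le_trace_lyap_inv:
  fixes F :: "real^'n^'n"
  assumes F: "hurwitz F" and sym: "transpose S = S" and S: "\<And>x. 0 \<le> qform S x"
  shows "trace S \<le> 2 * (real CARD('n))\<^sup>2 * norm F * trace (lyap_inv F S)"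
proof -
  let ?Y = "lyap_inv F S"
  have tY: "transpose ?Y = ?Y" by (rule transpose_lyap_inv[OF F sym])
  have "trace S = - trace (lyap F ?Y)" by (simp add: lyap_inv_eq[OF F] trace_uminus)
  also have "\<dots> = - 2 * trace (?Y ** F)" by (simp add: trace_lyap[OF tY])
  also have "\<dots> \<le> 2 * (norm ?Y * norm F)" using abs_trace_mult_le[of ?Y F] by linarith
  also have "\<dots> \<le> 2 * (((real CARD('n))\<^sup>2 * trace ?Y) * norm F)"
    by (intro mult_left_mono mult_right_mono norm_le_trace tY qform_lyap_inv_nonneg[OF F S]) auto
  finally show ?thesis by (simp add: mult_ac)
qed

text \<open>The analogue of the resolvent identity; it turns a change of closed-loop matrix into a
  change of right-hand side.\<close>

lemma lyap_inv_resolvent: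
  assumes F: "hurwitz F" and G: "hurwitz G"
  shows "lyap_inv G S - lyap_inv F S = lyap_inv G (lyap (G - F) (lyap_inv F S))"
proof (rule lyap_inv_eqI[OF G, symmetric])
  have "lyap (G - F) Y = lyap G Y - lyap F Y" for Y
    by (simp add: lyap_def matrix_ring_simps)
  then show "lyap G (lyap_inv G S - lyap_inv F S) = - lyap (G - F) (lyap_inv F S)"
    by (simp add: lyap_diff lyap_inv_eq[OF F] lyap_inv_eq[OF G])
qed

section \<open>The cost matrix on a sublevel set\<close>

locale lqr =
  fixes A :: "real^'n^'n" and B :: "real^'m^'n" and Q :: "real^'n^'n" and R :: "real^'m^'m"
    and q0 \<rho>0 :: real
  assumes Q_sym: "transpose Q = Q" and R_sym: "transpose R = R"
    and q0_pos: "0 < q0" and Q_lower: "\<And>x. q0 * (norm x)\<^sup>2 \<le> qform Q x"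
    and \<rho>0_pos: "0 < \<rho>0" and R_lower: "\<And>x. \<rho>0 * (norm x)\<^sup>2 \<le> qform R x"
begin

abbreviation "stab \<equiv> stabilizing A B"

definition Acl :: "real^'n^'m \<Rightarrow> real^'n^'n" where "Acl K = A - B ** K"
definition W :: "real^'n^'m \<Rightarrow> real^'n^'n" where "W K = transpose K ** R ** K + Q"
definition P :: "real^'n^'m \<Rightarrow> real^'n^'n" where "P K = lyap_inv (Acl K) (W K)"
text \<open>The defect in the stationarity condition \<open>R ** K = transpose B ** P K\<close> for
  the optimal gain.\<close>

definition E :: "real^'n^'m \<Rightarrow> real^'n^'m" where "E K = R ** K - transpose B ** P K"
definition sym_mult :: "real^'n^'m \<Rightarrow> real^'n^'m \<Rightarrow> real^'n^'n" where
  "sym_mult V E' = transpose V ** E' + transpose E' ** V"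
text \<open>The derivative of \<open>P\<close> at \<open>K\<close> in direction \<open>V\<close>,
  found by linearising the Lyapunov equation; \<open>P_taylor\<close> justifies the name.\<close>

definition DP :: "real^'n^'m \<Rightarrow> real^'n^'m \<Rightarrow> real^'n^'n" where
  "DP K V = lyap_inv (Acl K) (sym_mult V (E K))"
text \<open>The initial state has second moment \<open>mat 1\<close>, so the trace of
  \<open>P K\<close> alone is the LQR cost.\<close>

definition cost :: "real^'n^'m \<Rightarrow> real" where "cost K = trace (P K)"
text \<open>The Riesz representative of the functional that sends \<open>V\<close> to
  \<open>trace (DP K V)\<close>, written in coordinates.\<close>

definition cost_grad :: "real^'n^'m \<Rightarrow> real^'n^'m" where
  "cost_grad K = (\<Sum>b\<in>Basis. trace (DP K b) *\<^sub>R b)"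
definition sub :: "real \<Rightarrow> (real^'n^'m) set" where "sub a = {K \<in> stab. cost K \<le> a}"

lemma lyapunov_sol_eq: "lyapunov_sol A B Q R K = P K"
  by (simp add: lyapunov_sol_def P_def lyap_inv_def lyap_def W_def Acl_def add.assoc)

lemma stabD: "K \<in> stab \<Longrightarrow> hurwitz (Acl K)"
  by (simp add: stabilizing_def Acl_def)

lemma subD: "K \<in> sub a \<Longrightarrow> K \<in> stab" "K \<in> sub a \<Longrightarrow> hurwitz (Acl K)" "K \<in> sub a \<Longrightarrow> cost K \<le> a"
  by (auto simp: sub_def stabD)

lemma sub_mono: "a \<le> b \<Longrightarrow> sub a \<subseteq> sub b"
  by (auto simp: sub_def)

lemma W_sym: "transpose (W K) = W K"
  by (simp add: W_def matrix_ring_simps Q_sym R_sym)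

lemma qform_R_nonneg: "0 \<le> qform R x"
  using R_lower[of x] \<rho>0_pos by (smt (verit) mult_nonneg_nonneg zero_le_power2)

lemma W_lower: "qform Q x \<le> qform (W K) x" "q0 * (norm x)\<^sup>2 \<le> qform (W K) x"
  using Q_lower[of x] qform_R_nonneg[of "K *v x"] by (auto simp: W_def qform_add qform_transpose_mult)

lemma qform_W_nonneg: "0 \<le> qform (W K) x"
  using W_lower(2)[of x K] q0_pos by (smt (verit) mult_nonneg_nonneg zero_le_power2)

lemma P_eq: "K \<in> stab \<Longrightarrow> lyap (Acl K) (P K) = - W K"
  by (simp add: P_def lyap_inv_eq stabD)

lemma P_sym: "K \<in> stab \<Longrightarrow> transpose (P K) = P K"
  by (simp add: P_def transpose_lyap_inv stabD W_sym)

lemma P_nonneg: "K \<in> stab \<Longrightarrow> 0 \<le> qform (P K) x"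
  unfolding P_def by (intro qform_lyap_inv_nonneg stabD qform_W_nonneg)

lemma cost_nonneg: "K \<in> stab \<Longrightarrow> 0 \<le> cost K"
  unfolding cost_def by (intro trace_nonneg P_nonneg)

lemma norm_P_le: "K \<in> sub a \<Longrightarrow> norm (P K) \<le> (real CARD('n))\<^sup>2 * a"
  using norm_le_trace[OF P_sym P_nonneg, of K] subD[of K a]
  by (smt (verit) cost_def mult_left_mono zero_le_power2)

lemma sym_mult_sym: "transpose (sym_mult V F) = sym_mult V F"
  by (simp add: sym_mult_def matrix_ring_simps add.commute)

lemma norm_sym_mult_le: "norm (sym_mult V F) \<le> 2 * norm V * norm F"
  using norm_matrix_mult_le[of "transpose V" F] norm_matrix_mult_le[of "transpose F" V]
    norm_triangle_ineq[of "transpose V ** F" "transpose F ** V"]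
  by (simp add: sym_mult_def mult_ac)

lemma sym_mult_linear:
  "sym_mult (V + V') F = sym_mult V F + sym_mult V' F" "sym_mult (c *\<^sub>R V) F = c *\<^sub>R sym_mult V F" "sym_mult V (F - F') = sym_mult V F - sym_mult V F'"
  by (simp_all add: sym_mult_def matrix_ring_simps algebra_simps)

lemma DP_linear: "K \<in> stab \<Longrightarrow> linear (DP K)"
  by (rule linearI) (simp_all add: DP_def sym_mult_linear lyap_inv_add lyap_inv_scaleR stabD)

lemma trace_DP:
  assumes "K \<in> stab"
  shows "trace (DP K V) = cost_grad K \<bullet> V"
proof -
  have lin: "linear (\<lambda>V. trace (DP K V))"
    using linear_add[OF DP_linear[OF assms]] linear_scale[OF DP_linear[OF assms]]
    by (intro linearI) (simp_all add: trace_add trace_scaleR)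
  have "trace (DP K V) = trace (DP K (\<Sum>b\<in>Basis. (V \<bullet> b) *\<^sub>R b))" by (simp add: euclidean_representation)
  also have "\<dots> = (\<Sum>b\<in>Basis. (V \<bullet> b) * trace (DP K b))"
    using linear_sum[OF lin, of "\<lambda>b. (V \<bullet> b) *\<^sub>R b" Basis] linear_scale[OF lin] by simp
  also have "\<dots> = cost_grad K \<bullet> V"
    unfolding cost_grad_def inner_sum_left by (simp add: inner_commute mult.commute)
  finally show ?thesis .
qed

text \<open>Since \<open>W K\<close> is at least \<open>q0\<close> times the squared norm,
  \<open>S\<close> is dominated by \<open>norm S / q0\<close> times \<open>W K\<close>, and the
  Lyapunov solution of \<open>W K\<close> has trace \<open>cost K\<close>. The cost level thus
  bounds the solution operator uniformly.\<close>

lemma lyap_inv_bound: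
  "\<exists>c>0. \<forall>K\<in>sub a. \<forall>S. transpose S = S \<longrightarrow> norm (lyap_inv (Acl K) S) \<le> c * norm S"
proof (intro exI conjI ballI allI impI)
  let ?c = "(real CARD('n))\<^sup>2 * \<bar>a\<bar> / q0 + 1"
  show "0 < ?c" using q0_pos by (intro add_nonneg_pos) auto
  fix K S assume K: "K \<in> sub a" and S: "transpose S = (S :: real^'n^'n)"
  have "norm (lyap_inv (Acl K) S) \<le> (real CARD('n))\<^sup>2 * (norm S / q0) * trace (lyap_inv (Acl K) (W K))"
  proof (rule norm_lyap_inv_le)
    show "\<bar>qform S x\<bar> \<le> norm S / q0 * qform (W K) x" for x
    proof -
      have "\<bar>qform S x\<bar> \<le> norm S / q0 * (q0 * (norm x)\<^sup>2)"
        using abs_qform_le[of S x] q0_pos by simp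
      also have "\<dots> \<le> norm S / q0 * qform (W K) x"
        using q0_pos by (intro mult_left_mono W_lower) auto
      finally show ?thesis .
    qed
  qed (use q0_pos K S subD qform_W_nonneg in auto)
  also have "\<dots> \<le> (real CARD('n))\<^sup>2 * (norm S / q0) * \<bar>a\<bar>"
    using subD(3)[OF K] q0_pos unfolding cost_def P_def by (intro mult_left_mono) auto
  also have "\<dots> \<le> ?c * norm S" by (simp add: algebra_simps)
  finally show "norm (lyap_inv (Acl K) S) \<le> ?c * norm S" .
qed

lemma norm_Acl_le: "norm (Acl K) \<le> norm A + norm B * norm K"
  unfolding Acl_def using norm_triangle_ineq4[of A "B ** K"] norm_matrix_mult_le[of B K] by linarith

lemma trace_quadratic_lower: "\<rho>0 * (norm K)\<^sup>2 \<le> trace (transpose K ** R ** K)" for K :: "real^'n^'m"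
proof -
  have "(norm K)\<^sup>2 = (norm (transpose K))\<^sup>2" by simp
  also have "\<dots> = (\<Sum>i\<in>UNIV. (norm (K *v axis i 1))\<^sup>2)"
    unfolding norm_vec_def[of "transpose K"] L2_set_def
    by (simp add: sum_nonneg matrix_vector_axis_component vec_eq_iff transpose_def norm_vec_def L2_set_def)
  finally have "\<rho>0 * (norm K)\<^sup>2 = (\<Sum>i\<in>UNIV. \<rho>0 * (norm (K *v axis i 1))\<^sup>2)"
    by (simp add: sum_distrib_left)
  also have "\<dots> \<le> trace (transpose K ** R ** K)"
    unfolding trace_eq_sum_qform qform_transpose_mult by (intro sum_mono R_lower)
  finally show ?thesis .
qed

text \<open>
  The cost dominates \<open>trace (W K) / norm (Acl K)\<close>, which grows linearly in \<open>norm K\<close>.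
\<close>

lemma sub_bounded: "\<exists>k>0. \<forall>K\<in>sub a. norm K \<le> k"
proof (intro exI conjI ballI)
  let ?\<alpha> = "2 * (real CARD('n))\<^sup>2 * \<bar>a\<bar> * norm A / \<rho>0" and ?\<beta> = "2 * (real CARD('n))\<^sup>2 * \<bar>a\<bar> * norm B / \<rho>0"
  let ?k = "1 + ?\<alpha> + ?\<beta>"
  have nn: "?\<alpha> \<ge> 0" "?\<beta> \<ge> 0" using \<rho>0_pos by auto
  then show "0 < ?k" by linarith
  fix K assume K: "K \<in> sub a"
  have "0 \<le> trace Q" using Q_lower q0_pos by (intro trace_nonneg) (smt (verit) mult_nonneg_nonneg zero_le_power2)
  then have "\<rho>0 * (norm K)\<^sup>2 \<le> trace (W K)" using trace_quadratic_lower[of K] by (simp add: W_def trace_add)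
  also have "\<dots> \<le> 2 * (real CARD('n))\<^sup>2 * norm (Acl K) * trace (P K)"
    unfolding P_def by (intro trace_le_trace_lyap_inv subD W_sym qform_W_nonneg) (rule K)
  also have "\<dots> \<le> 2 * (real CARD('n))\<^sup>2 * (norm A + norm B * norm K) * \<bar>a\<bar>"
    using subD(3)[OF K] norm_Acl_le[of K] cost_nonneg[OF subD(1)[OF K]] unfolding cost_def
    by (intro mult_mono mult_left_mono mult_nonneg_nonneg) auto
  finally have "(norm K)\<^sup>2 \<le> ?\<alpha> + ?\<beta> * norm K" using \<rho>0_pos by (simp add: field_simps)
  show "norm K \<le> ?k"
  \<comment> \<open>The norm satisfies a quadratic inequality whose leading term wins once the norm
    exceeds 1 plus both coefficients.\<close>
  proof (rule ccontr)
    assume c: "\<not> norm K \<le> ?k"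
    then have g: "norm K > ?k" by simp
    then have "norm K \<ge> 1" using nn by linarith
    have "?k * norm K \<le> (norm K)\<^sup>2" using g by (simp add: power2_eq_square mult_right_mono)
    moreover have "?\<alpha> * 1 \<le> ?\<alpha> * norm K" using nn \<open>norm K \<ge> 1\<close> by (intro mult_left_mono) auto
    ultimately show False using \<open>(norm K)\<^sup>2 \<le> ?\<alpha> + ?\<beta> * norm K\<close> \<open>norm K \<ge> 1\<close>
      by (simp add: algebra_simps)
  qed
qed

lemma E_bounded: "\<exists>k>0. \<forall>K\<in>sub a. norm (E K) \<le> k"
proof -
  obtain k where k: "k > 0" "\<And>K. K \<in> sub a \<Longrightarrow> norm K \<le> k" using sub_bounded by blast
  show ?thesis
  proof (intro exI conjI ballI)
    show "0 < norm R * k + norm B * ((real CARD('n))\<^sup>2 * \<bar>a\<bar>) + 1" using k by (intro add_nonneg_pos add_nonneg_nonneg) auto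
    fix K assume K: "K \<in> sub a"
    have "norm (E K) \<le> norm R * norm K + norm B * norm (P K)"
      unfolding E_def using norm_triangle_ineq4[of "R ** K" "transpose B ** P K"]
        norm_matrix_mult_le[of R K] norm_matrix_mult_le[of "transpose B" "P K"] by simp
    also have "\<dots> \<le> norm R * k + norm B * ((real CARD('n))\<^sup>2 * \<bar>a\<bar>)"
    proof (intro add_mono mult_left_mono)
      have "(real CARD('n))\<^sup>2 * a \<le> (real CARD('n))\<^sup>2 * \<bar>a\<bar>" by (intro mult_left_mono) auto
      then show "norm (P K) \<le> (real CARD('n))\<^sup>2 * \<bar>a\<bar>" using norm_P_le[OF K] by linarith
    qed (use k K in auto)
    finally show "norm (E K) \<le> norm R * k + norm B * ((real CARD('n))\<^sup>2 * \<bar>a\<bar>) + 1" by simp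
  qed
qed

lemma lyap_Acl_add:
  "lyap (Acl (K + H)) Y = lyap (Acl K) Y - sym_mult H (transpose B ** Y)" if "transpose Y = Y"
  by (simp add: lyap_def Acl_def sym_mult_def matrix_ring_simps that)

text \<open>\<open>P K\<close> remains a strict Lyapunov function for nearby policies, which gives
  stability; a multiple of it dominates \<open>P (K + H)\<close> by comparison, which gives a bound
  on the cost there. Only bounds valid on all of \<open>sub a\<close> enter, so the radius is
  uniform.\<close>

lemma sub_neighbourhood: "\<exists>\<rho>>0. \<exists>b\<ge>a. \<forall>K\<in>sub a. \<forall>H. norm H \<le> \<rho> \<longrightarrow> K + H \<in> sub b"
proof -
  obtain k where k: "k > 0" "\<And>K. K \<in> sub a \<Longrightarrow> norm K \<le> k" using sub_bounded by blast
  \<comment> \<open>Chosen so that \<open>?c / 4\<close> exceeds the bound on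
    \<open>transpose B ** P K\<close>: a perturbation of norm at most \<open>q0 / ?c\<close> then
    costs at most half of the decay rate \<open>q0\<close>.\<close>
  let ?c = "4 * (norm B * ((real CARD('n))\<^sup>2 * \<bar>a\<bar>) + 1)"
  define \<rho> where "\<rho> = q0 / ?c"
  have cpos: "?c > 0" by (intro mult_pos_pos add_nonneg_pos mult_nonneg_nonneg) auto
  have \<rho>: "\<rho> > 0" using cpos q0_pos by (simp add: \<rho>_def)
  define s where "s = norm Q + norm R * (k + \<rho>)\<^sup>2"
  have s: "s \<ge> 0" by (simp add: s_def)
  define b where "b = (2 * s / q0 + 1) * \<bar>a\<bar>"
  have "b \<ge> 1 * \<bar>a\<bar>" unfolding b_def using s q0_pos by (intro mult_right_mono) auto
  then have "b \<ge> a" by linarith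
  have "K + H \<in> sub b" if K: "K \<in> sub a" and H: "norm H \<le> \<rho>" for K H
  proof -
    note Ks = subD(1)[OF K]
    have neg: "qform (lyap (Acl (K + H)) (P K)) x \<le> - (q0 / 2) * (norm x)\<^sup>2" for x
    proof -
      have "norm (sym_mult H (transpose B ** P K)) \<le> 2 * norm H * norm (transpose B ** P K)" by (rule norm_sym_mult_le)
      also have "\<dots> \<le> 2 * \<rho> * (norm B * ((real CARD('n))\<^sup>2 * \<bar>a\<bar>))"
      proof (intro mult_mono)
        have "(real CARD('n))\<^sup>2 * a \<le> (real CARD('n))\<^sup>2 * \<bar>a\<bar>" by (intro mult_left_mono) auto
        then have "norm (P K) \<le> (real CARD('n))\<^sup>2 * \<bar>a\<bar>" using norm_P_le[OF K] by linarith
        then show "norm (transpose B ** P K) \<le> norm B * ((real CARD('n))\<^sup>2 * \<bar>a\<bar>)"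
          using norm_matrix_mult_le[of "transpose B" "P K"]
          by (smt (verit, best) mult_left_mono norm_ge_zero norm_transpose)
      qed (use H \<rho> in auto)
      also have "\<dots> \<le> 2 * \<rho> * (?c / 4)" using \<rho> by (intro mult_left_mono) auto
      also have "\<dots> = q0 / 2" using cpos by (simp add: \<rho>_def)
      finally have "norm (sym_mult H (transpose B ** P K)) * (norm x)\<^sup>2 \<le> q0 / 2 * (norm x)\<^sup>2"
        by (intro mult_right_mono) auto
      with abs_qform_le[of "sym_mult H (transpose B ** P K)" x]
      have "\<bar>qform (sym_mult H (transpose B ** P K)) x\<bar> \<le> q0 / 2 * (norm x)\<^sup>2" by linarith
      with W_lower(2)[of x K] show ?thesis
        by (simp add: lyap_Acl_add P_sym[OF Ks] P_eq[OF Ks] qform_diff qform_uminus)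
    qed
    have hur: "hurwitz (Acl (K + H))"
    proof (rule hurwitz_if_lyap_negative[OF P_sym[OF Ks] P_nonneg[OF Ks]])
      fix x :: "real^'n" assume "x \<noteq> 0"
      then have "q0 / 2 * (norm x)\<^sup>2 > 0" using q0_pos by simp
      with neg[of x] show "qform (lyap (Acl (K + H)) (P K)) x < 0" by linarith
    qed
    then have st: "K + H \<in> stab" by (simp add: stabilizing_def Acl_def)
    \<comment> \<open>The weight \<open>W (K + H)\<close> is at most \<open>s\<close> times the
      squared norm, while the surviving decay is \<open>q0 / 2\<close> times it; the quotient of the
      two makes \<open>c *\<^sub>R P K\<close> a supersolution.\<close>
    define c where "c = 2 * s / q0"
    have c: "c \<ge> 0" using s q0_pos by (simp add: c_def)
    have Wle: "qform (W (K + H)) x \<le> qform (- (c *\<^sub>R lyap (Acl (K + H)) (P K))) x" for x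
    proof -
      have "norm (K + H) \<le> k + \<rho>" using norm_triangle_ineq[of K H] k(2)[OF K] H by linarith
      then have "norm R * (norm (K + H))\<^sup>2 \<le> norm R * (k + \<rho>)\<^sup>2" by (intro mult_left_mono power_mono) auto
      have "qform (W (K + H)) x \<le> norm Q * (norm x)\<^sup>2 + norm R * (norm ((K + H) *v x))\<^sup>2"
        unfolding W_def qform_add qform_transpose_mult
        using abs_qform_le[of Q x] abs_qform_le[of R "(K + H) *v x"] by linarith
      also have "\<dots> \<le> norm Q * (norm x)\<^sup>2 + norm R * (norm (K + H) * norm x)\<^sup>2"
        by (intro add_left_mono mult_left_mono power_mono norm_matrix_vector_mult_le) auto
      also have "\<dots> \<le> s * (norm x)\<^sup>2"
        using mult_right_mono[OF \<open>norm R * (norm (K + H))\<^sup>2 \<le> norm R * (k + \<rho>)\<^sup>2\<close>, of "(norm x)\<^sup>2"]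
        by (simp add: s_def algebra_simps power_mult_distrib)
      also have "\<dots> = c * (q0 / 2 * (norm x)\<^sup>2)" using q0_pos by (simp add: c_def)
      also have "\<dots> \<le> c * (- qform (lyap (Acl (K + H)) (P K)) x)"
        using neg[of x] c by (intro mult_left_mono) auto
      finally show ?thesis by (simp add: qform_uminus qform_scaleR)
    qed
    have "lyap_inv (Acl (K + H)) (- (c *\<^sub>R lyap (Acl (K + H)) (P K))) = c *\<^sub>R P K"
      by (rule lyap_inv_eqI[OF hur]) (simp add: lyap_scaleR)
    with qform_lyap_inv_mono[OF hur Wle] have "qform (P (K + H)) x \<le> qform (c *\<^sub>R P K) x" for x
      by (simp add: P_def)
    then have "cost (K + H) \<le> c * cost K"
      unfolding cost_def using trace_mono_qform[of "P (K + H)" "c *\<^sub>R P K"] by (simp add: trace_scaleR)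
    also have "\<dots> \<le> c * \<bar>a\<bar>" using subD(3)[OF K] c by (intro mult_left_mono) auto
    also have "\<dots> \<le> b" by (simp add: b_def c_def algebra_simps)
    finally show ?thesis using st by (simp add: sub_def)
  qed
  with \<rho> \<open>b \<ge> a\<close> show ?thesis by blast
qed

text \<open>Subtracting the two Lyapunov equations is exact: beyond the linear term there is only
  one quadratic term in \<open>H\<close>. The price is that the solution operator belongs to
  \<open>K + H\<close> instead of \<open>K\<close>.\<close>

lemma P_difference:
  assumes K: "K \<in> stab" and KH: "K + H \<in> stab"
  shows "P (K + H) - P K = lyap_inv (Acl (K + H)) (sym_mult H (E K) + transpose H ** R ** H)"
proof (rule lyap_inv_eqI[OF stabD[OF KH], symmetric])
  have "lyap (Acl (K + H)) (P (K + H) - P K) = - W (K + H) + W K + sym_mult H (transpose B ** P K)"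
    by (simp add: lyap_diff P_eq[OF KH] lyap_Acl_add[OF P_sym[OF K]] P_eq[OF K])
  also have "\<dots> = - (sym_mult H (E K) + transpose H ** R ** H)"
    by (simp add: W_def sym_mult_def E_def matrix_ring_simps R_sym P_sym[OF K])
  finally show "lyap (Acl (K + H)) (P (K + H) - P K) = - (sym_mult H (E K) + transpose H ** R ** H)" .
qed

lemma transpose_quadratic: "transpose (transpose H ** R ** H) = transpose H ** R ** H" for H :: "real^'n^'m"
  by (simp add: matrix_ring_simps R_sym)

lemma norm_quadratic_le: "norm (transpose H ** R ** H) \<le> norm R * (norm H)\<^sup>2" for H :: "real^'n^'m"
proof -
  have "norm (transpose H ** R ** H) \<le> norm (transpose H ** R) * norm H" by (rule norm_matrix_mult_le)
  also have "\<dots> \<le> (norm (transpose H) * norm R) * norm H" by (intro mult_right_mono norm_matrix_mult_le) auto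
  finally show ?thesis by (simp add: power2_eq_square mult_ac)
qed

text \<open>The closed-loop matrices differ by \<open>- (B ** H)\<close>, so the resolvent identity
  together with two uses of \<open>lyap_inv_bound\<close> yields a factor
  \<open>norm H\<close>.\<close>

lemma lyap_inv_lipschitz:
  "\<exists>c>0. \<forall>K\<in>sub a. \<forall>H. K + H \<in> sub a \<longrightarrow> (\<forall>S. transpose S = S \<longrightarrow>
     norm (lyap_inv (Acl (K + H)) S - lyap_inv (Acl K) S) \<le> c * norm H * norm S)"
proof -
  obtain c where c: "c > 0" "\<And>K S. K \<in> sub a \<Longrightarrow> transpose S = S \<Longrightarrow> norm (lyap_inv (Acl K) S) \<le> c * norm S"
    using lyap_inv_bound by blast
  show ?thesis
  proof (intro exI conjI ballI allI impI)
    show "0 < 2 * c\<^sup>2 * norm B + 1" by (intro add_nonneg_pos) auto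
    fix K H S assume K: "K \<in> sub a" and KH: "K + H \<in> sub a" and S: "transpose S = (S :: real^'n^'n)"
    let ?Y = "lyap_inv (Acl K) S"
    have "norm (lyap (Acl (K + H) - Acl K) ?Y) \<le> 2 * norm (B ** H) * norm ?Y"
      using norm_lyap_le[of "Acl (K + H) - Acl K" ?Y]
      by (simp add: Acl_def matrix_ring_simps norm_minus_commute)
    also have "\<dots> \<le> 2 * (norm B * norm H) * (c * norm S)"
      by (intro mult_mono mult_left_mono norm_matrix_mult_le c K S) auto
    finally have 1: "norm (lyap (Acl (K + H) - Acl K) ?Y) \<le> 2 * norm B * norm H * (c * norm S)" by (simp add: mult_ac)
    have "norm (lyap_inv (Acl (K + H)) S - ?Y) \<le> c * norm (lyap (Acl (K + H) - Acl K) ?Y)"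
      unfolding lyap_inv_resolvent[OF subD(2)[OF K] subD(2)[OF KH]]
      by (rule c(2)[OF KH]) (simp add: transpose_lyap transpose_lyap_inv[OF subD(2)[OF K] S])
    also have "\<dots> \<le> c * (2 * norm B * norm H * (c * norm S))" using c 1 by (intro mult_left_mono) auto
    also have "\<dots> \<le> (2 * c\<^sup>2 * norm B + 1) * norm H * norm S"
      by (simp add: algebra_simps power2_eq_square)
    finally show "norm (lyap_inv (Acl (K + H)) S - ?Y) \<le> (2 * c\<^sup>2 * norm B + 1) * norm H * norm S" .
  qed
qed

lemma P_lipschitz: "\<exists>L>0. \<forall>K\<in>sub a. \<forall>H. K + H \<in> sub a \<longrightarrow> norm (P (K + H) - P K) \<le> L * norm H"
proof -
  obtain c where c: "c > 0" "\<And>K S. K \<in> sub a \<Longrightarrow> transpose S = S \<Longrightarrow> norm (lyap_inv (Acl K) S) \<le> c * norm S"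
    using lyap_inv_bound by blast
  obtain k where k: "k > 0" "\<And>K. K \<in> sub a \<Longrightarrow> norm K \<le> k" using sub_bounded by blast
  obtain e where e: "e > 0" "\<And>K. K \<in> sub a \<Longrightarrow> norm (E K) \<le> e" using E_bounded by blast
  show ?thesis
  proof (intro exI conjI ballI allI impI)
    show "0 < c * (2 * e + norm R * (2 * k))" using c k e by (intro mult_pos_pos add_pos_nonneg) auto
    fix K H assume K: "K \<in> sub a" and KH: "K + H \<in> sub a"
    \<comment> \<open>Both policies lie in the bounded sublevel set, so one factor
      \<open>norm H\<close> of the quadratic term may be traded for a constant.\<close>
    have nH: "norm H \<le> 2 * k" using norm_triangle_ineq4[of "K + H" K] k(2)[OF K] k(2)[OF KH] by simp
    have "norm (P (K + H) - P K) \<le> c * norm (sym_mult H (E K) + transpose H ** R ** H)"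
      unfolding P_difference[OF subD(1)[OF K] subD(1)[OF KH]]
      by (rule c(2)[OF KH]) (simp add: transpose_add sym_mult_sym transpose_quadratic)
    also have "\<dots> \<le> c * (2 * norm H * e + norm R * norm H * (2 * k))"
    proof (intro mult_left_mono)
      have "norm (sym_mult H (E K)) \<le> 2 * norm H * e"
        using norm_sym_mult_le[of H "E K"] e(2)[OF K] by (smt (verit) mult_left_mono norm_ge_zero)
      moreover have "norm (transpose H ** R ** H) \<le> norm R * norm H * (2 * k)"
      proof -
        have "norm R * (norm H * norm H) \<le> norm R * (norm H * (2 * k))"
          by (intro mult_left_mono nH) auto
        with norm_quadratic_le[of H] show ?thesis unfolding power2_eq_square mult.assoc by linarith
      qed
      ultimately show "norm (sym_mult H (E K) + transpose H ** R ** H) \<le> 2 * norm H * e + norm R * norm H * (2 * k)"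
        using norm_triangle_ineq[of "sym_mult H (E K)" "transpose H ** R ** H"] by linarith
    qed (use c in auto)
    finally show "norm (P (K + H) - P K) \<le> c * (2 * e + norm R * (2 * k)) * norm H" by (simp add: algebra_simps)
  qed
qed

text \<open>In \<open>P_difference\<close>, replacing the solution operator at \<open>K + H\<close>
  by the one at \<open>K\<close> costs another factor \<open>norm H\<close>, and the linear term
  becomes \<open>DP K H\<close>.\<close>

lemma P_taylor:
  "\<exists>L>0. \<forall>K\<in>sub a. \<forall>H. K + H \<in> sub a \<longrightarrow> norm (P (K + H) - P K - DP K H) \<le> L * (norm H)\<^sup>2"
proof -
  obtain c where c: "c > 0" "\<And>K S. K \<in> sub a \<Longrightarrow> transpose S = S \<Longrightarrow> norm (lyap_inv (Acl K) S) \<le> c * norm S"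
    using lyap_inv_bound by blast
  obtain l where l: "l > 0" "\<And>K H S. K \<in> sub a \<Longrightarrow> K + H \<in> sub a \<Longrightarrow> transpose S = S \<Longrightarrow>
     norm (lyap_inv (Acl (K + H)) S - lyap_inv (Acl K) S) \<le> l * norm H * norm S"
    using lyap_inv_lipschitz by blast
  obtain e where e: "e > 0" "\<And>K. K \<in> sub a \<Longrightarrow> norm (E K) \<le> e" using E_bounded by blast
  show ?thesis
  proof (intro exI conjI ballI allI impI)
    show "0 < 2 * l * e + c * norm R" using c l e by (intro add_pos_nonneg) auto
    fix K H assume K: "K \<in> sub a" and KH: "K + H \<in> sub a"
    have "P (K + H) - P K - DP K H = (lyap_inv (Acl (K + H)) (sym_mult H (E K)) - lyap_inv (Acl K) (sym_mult H (E K)))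
        + lyap_inv (Acl (K + H)) (transpose H ** R ** H)"
      unfolding P_difference[OF subD(1)[OF K] subD(1)[OF KH]] DP_def
      by (simp add: lyap_inv_add[OF subD(2)[OF KH]])
    also have "norm \<dots> \<le> l * norm H * norm (sym_mult H (E K)) + c * norm (transpose H ** R ** H)"
      by (intro norm_triangle_mono l c K KH sym_mult_sym transpose_quadratic)
    also have "\<dots> \<le> l * norm H * (2 * norm H * e) + c * (norm R * (norm H)\<^sup>2)"
    proof (intro add_mono mult_left_mono norm_quadratic_le)
      show "norm (sym_mult H (E K)) \<le> 2 * norm H * e"
        using norm_sym_mult_le[of H "E K"] e(2)[OF K] by (smt (verit) mult_left_mono norm_ge_zero)
    qed (use c l in auto)
    finally show "norm (P (K + H) - P K - DP K H) \<le> (2 * l * e + c * norm R) * (norm H)\<^sup>2"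
      by (simp add: algebra_simps power2_eq_square)
  qed
qed

text \<open>\<open>DP\<close> depends on the policy through \<open>E\<close> and through the
  solution operator; each is changed separately. This later pays for estimates computed at delayed
  policies.\<close>

lemma DP_lipschitz:
  "\<exists>L>0. \<forall>K\<in>sub a. \<forall>H. K + H \<in> sub a \<longrightarrow> (\<forall>V. norm (DP (K + H) V - DP K V) \<le> L * norm H * norm V)"
proof -
  obtain c where c: "c > 0" "\<And>K S. K \<in> sub a \<Longrightarrow> transpose S = S \<Longrightarrow> norm (lyap_inv (Acl K) S) \<le> c * norm S"
    using lyap_inv_bound by blast
  obtain l where l: "l > 0" "\<And>K H S. K \<in> sub a \<Longrightarrow> K + H \<in> sub a \<Longrightarrow> transpose S = S \<Longrightarrow>
     norm (lyap_inv (Acl (K + H)) S - lyap_inv (Acl K) S) \<le> l * norm H * norm S"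
    using lyap_inv_lipschitz by blast
  obtain p where p: "p > 0" "\<And>K H. K \<in> sub a \<Longrightarrow> K + H \<in> sub a \<Longrightarrow> norm (P (K + H) - P K) \<le> p * norm H"
    using P_lipschitz by blast
  obtain e where e: "e > 0" "\<And>K. K \<in> sub a \<Longrightarrow> norm (E K) \<le> e" using E_bounded by blast
  show ?thesis
  proof (intro exI conjI ballI allI impI)
    show "0 < 2 * l * e + 2 * c * (norm R + norm B * p)" using c l e p
      by (intro add_pos_nonneg mult_nonneg_nonneg add_nonneg_nonneg) auto
    fix K H V assume K: "K \<in> sub a" and KH: "K + H \<in> sub a"
    have dE: "norm (E (K + H) - E K) \<le> (norm R + norm B * p) * norm H"
    proof -
      have "E (K + H) - E K = R ** H - transpose B ** (P (K + H) - P K)"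
        by (simp add: E_def matrix_ring_simps algebra_simps)
      also have "norm \<dots> \<le> norm R * norm H + norm B * norm (P (K + H) - P K)"
        using norm_triangle_ineq4[of "R ** H" "transpose B ** (P (K + H) - P K)"]
          norm_matrix_mult_le[of R H] norm_matrix_mult_le[of "transpose B" "P (K + H) - P K"] by simp
      also have "\<dots> \<le> norm R * norm H + norm B * (p * norm H)"
        by (intro add_left_mono mult_left_mono p K KH) auto
      finally show ?thesis by (simp add: algebra_simps)
    qed
    have "DP (K + H) V - DP K V = lyap_inv (Acl (K + H)) (sym_mult V (E (K + H) - E K)) + 
       (lyap_inv (Acl (K + H)) (sym_mult V (E K)) - lyap_inv (Acl K) (sym_mult V (E K)))"
      unfolding DP_def by (simp add: sym_mult_linear lyap_inv_diff[OF subD(2)[OF KH]])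
    also have "norm \<dots> \<le> c * norm (sym_mult V (E (K + H) - E K)) + l * norm H * norm (sym_mult V (E K))"
      by (intro norm_triangle_mono l c K KH sym_mult_sym)
    also have "\<dots> \<le> c * (2 * norm V * ((norm R + norm B * p) * norm H)) + l * norm H * (2 * norm V * e)"
    proof (intro add_mono mult_left_mono)
      show "norm (sym_mult V (E K)) \<le> 2 * norm V * e"
        using norm_sym_mult_le[of V "E K"] e(2)[OF K] by (smt (verit) mult_left_mono norm_ge_zero)
      show "norm (sym_mult V (E (K + H) - E K)) \<le> 2 * norm V * ((norm R + norm B * p) * norm H)"
        using norm_sym_mult_le[of V "E (K + H) - E K"] dE by (smt (verit) mult_left_mono norm_ge_zero)
    qed (use c l in auto)
    finally show "norm (DP (K + H) V - DP K V) \<le> (2 * l * e + 2 * c * (norm R + norm B * p)) * norm H * norm V"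
      by (simp add: algebra_simps)
  qed
qed

text \<open>
  Testing the derivative of the cost in the direction \<open>E K\<close> bounds \<open>E K\<close>, and with it every
  directional derivative of \<open>P\<close>, by the gradient of the cost.
\<close>

lemma DP_bound:
  "\<exists>c>0. \<forall>K\<in>sub a. \<forall>V. norm (DP K V) \<le> c * norm (cost_grad K) * norm V"
proof -
  obtain c where c: "c > 0" "\<And>K S. K \<in> sub a \<Longrightarrow> transpose S = S \<Longrightarrow> norm (lyap_inv (Acl K) S) \<le> c * norm S"
    using lyap_inv_bound by blast
  obtain k where k: "k > 0" "\<And>K. K \<in> sub a \<Longrightarrow> norm K \<le> k" using sub_bounded by blast
  define d where "d = (real CARD('n))\<^sup>2 * (norm A + norm B * k) + 1"
  have d: "d > 0" unfolding d_def using k by (intro add_nonneg_pos mult_nonneg_nonneg add_nonneg_nonneg) auto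
  show ?thesis
  proof (intro exI conjI ballI allI)
    show "0 < 2 * c * d" using c d by simp
    fix K V assume K: "K \<in> sub a"
    note Ks = subD(1)[OF K]
    have "qform (transpose X ** X) x \<ge> 0" for X :: "real^'n^'m" and x
      using qform_transpose_mult[of X "mat 1" x] by (simp add: qform_def)
    then have sym_mult_nonneg: "0 \<le> qform (sym_mult (E K) (E K)) x" for x
      unfolding sym_mult_def qform_add by (intro add_nonneg_nonneg)
    have "trace (sym_mult (E K) (E K)) = 2 * (norm (E K))\<^sup>2"
      unfolding sym_mult_def trace_add using inner_eq_trace[of "E K" "E K"] by (simp add: dot_square_norm)
    moreover have "trace (sym_mult (E K) (E K)) \<le> 2 * (real CARD('n))\<^sup>2 * norm (Acl K) * trace (DP K (E K))"
      unfolding DP_def by (rule trace_le_trace_lyap_inv[OF subD(2)[OF K] sym_mult_sym sym_mult_nonneg])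
    moreover have "(real CARD('n))\<^sup>2 * norm (Acl K) * trace (DP K (E K)) \<le> d * (norm (cost_grad K) * norm (E K))"
    proof (rule mult_mono')
      show "(real CARD('n))\<^sup>2 * norm (Acl K) \<le> d"
      unfolding d_def using norm_Acl_le[of K] k(2)[OF K]
      by (smt (verit) mult_left_mono norm_ge_zero zero_le_power2)
      show "trace (DP K (E K)) \<le> norm (cost_grad K) * norm (E K)"
        unfolding trace_DP[OF Ks] by (rule norm_cauchy_schwarz)
      show "0 \<le> trace (DP K (E K))"
        unfolding DP_def by (intro trace_nonneg qform_lyap_inv_nonneg subD(2)[OF K] sym_mult_nonneg)
    qed auto
    ultimately have "(norm (E K))\<^sup>2 \<le> d * (norm (cost_grad K) * norm (E K))" by linarith
    then have nE: "norm (E K) \<le> d * norm (cost_grad K)"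
      by (cases "E K = 0") (use d in \<open>auto simp: power2_eq_square\<close>)
    have "norm (DP K V) \<le> c * norm (sym_mult V (E K))" unfolding DP_def by (intro c K sym_mult_sym)
    also have "\<dots> \<le> c * (2 * norm V * (d * norm (cost_grad K)))"
      using c norm_sym_mult_le[of V "E K"] nE by (smt (verit) mult_left_mono norm_ge_zero)
    finally show "norm (DP K V) \<le> 2 * c * d * norm (cost_grad K) * norm V" by (simp add: mult_ac)
  qed
qed

end

section \<open>Cost, gradient and two-point estimates\<close>

lemma abs_trace_le: "\<bar>trace Y\<bar> \<le> norm Y * real CARD('n)" for Y :: "real^'n^'n"
proof -
  have "\<bar>Y $ i $ i\<bar> \<le> norm Y" for i
    using component_le_norm_cart[of "Y $ i" i] Finite_Cartesian_Product.norm_nth_le[of Y i] by linarith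
  then have "(\<Sum>i\<in>UNIV. \<bar>Y $ i $ i\<bar>) \<le> (\<Sum>i\<in>(UNIV::'n set). norm Y)" by (rule sum_mono)
  then have "(\<Sum>i\<in>UNIV. \<bar>Y $ i $ i\<bar>) \<le> norm Y * real CARD('n)" by (simp add: mult.commute)
  then show ?thesis
    unfolding trace_def using sum_abs[of "\<lambda>i. Y $ i $ i" UNIV] by (rule order.trans[rotated])
qed

lemma GDERIV_if_quadratic_remainder:
  fixes f :: "'a::euclidean_space \<Rightarrow> real"
  assumes "0 < \<rho>" "0 < L" and q: "\<And>h. norm h \<le> \<rho> \<Longrightarrow> \<bar>f (x + h) - f x - g \<bullet> h\<bar> \<le> L * (norm h)\<^sup>2"
  shows "GDERIV f x :> g"
  unfolding gderiv_def has_derivative_at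
proof (intro conjI)
  show "bounded_linear (\<lambda>h. h \<bullet> g)" by (rule bounded_linear_inner_left)
  show "(\<lambda>h. norm (f (x + h) - f x - h \<bullet> g) / norm h) \<midarrow>0\<rightarrow> 0"
  proof (rule Lim_null_comparison[where g="\<lambda>h. L * norm h"])
    show "(\<lambda>h. L * norm h) \<midarrow>0\<rightarrow> 0" by (auto intro!: tendsto_eq_intros)
    have "\<forall>\<^sub>F h in at 0. dist h (0 :: 'a) < \<rho>" using \<open>0 < \<rho>\<close> by (auto simp: eventually_at)
    then show "\<forall>\<^sub>F h in at 0. norm (norm (f (x + h) - f x - h \<bullet> g) / norm h) \<le> L * norm h"
    proof eventually_elim
      case (elim h)
      with q[of h] show ?case
        by (cases "h = 0") (auto simp: divide_le_eq power2_eq_square inner_commute mult.assoc)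
    qed
  qed
qed

lemma gradient_eqI:
  fixes f :: "'a::euclidean_space \<Rightarrow> real"
  assumes "GDERIV f x :> g"
  shows "gradient f x = g"
  unfolding gradient_def
proof (rule the_equality[where P="\<lambda>g. GDERIV f x :> g", OF assms])
  fix g' assume "GDERIV f x :> g'"
  with assms have "(\<lambda>h. h \<bullet> g') = (\<lambda>h. h \<bullet> g)" unfolding gderiv_def using has_derivative_unique by blast
  then have "h \<bullet> g' = h \<bullet> g" for h by meson
  then have "(g' - g) \<bullet> (g' - g) = 0" by (metis inner_diff_right right_minus_eq)
  then show "g' = g" by simp
qed

context lqr
begin

text \<open>The point \<open>K + H\<close> may leave \<open>sub a\<close>, so the expansion of
  \<open>P\<close> is taken on a larger sublevel set containing a whole neighbourhood of
  \<open>sub a\<close>.\<close>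

lemma cost_taylor:
  "\<exists>\<rho>>0. \<exists>L>0. \<forall>K\<in>sub a. \<forall>H. norm H \<le> \<rho> \<longrightarrow>
     K + H \<in> stab \<and> \<bar>cost (K + H) - cost K - cost_grad K \<bullet> H\<bar> \<le> L * (norm H)\<^sup>2"
proof -
  obtain \<rho> b where \<rho>: "\<rho> > 0" "b \<ge> a" "\<And>K H. K \<in> sub a \<Longrightarrow> norm H \<le> \<rho> \<Longrightarrow> K + H \<in> sub b"
    using sub_neighbourhood by blast
  obtain L where L: "L > 0" "\<And>K H. K \<in> sub b \<Longrightarrow> K + H \<in> sub b \<Longrightarrow> norm (P (K + H) - P K - DP K H) \<le> L * (norm H)\<^sup>2"
    using P_taylor by blast
  let ?I = "real CARD('n)"
  show ?thesis
  proof (intro exI conjI ballI allI impI)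
    show "\<rho> > 0" "L * ?I > 0" using \<rho> L by auto
    fix K and H :: "real^'n^'m" assume K: "K \<in> sub a" and H: "norm H \<le> \<rho>"
    have Kb: "K \<in> sub b" using sub_mono[OF \<rho>(2)] K by blast
    have KH: "K + H \<in> sub b" by (rule \<rho>(3)[OF K H])
    show "K + H \<in> stab" by (rule subD[OF KH])
    have "cost (K + H) - cost K - cost_grad K \<bullet> H = trace (P (K + H) - P K - DP K H)"
      unfolding trace_DP[OF subD(1)[OF K], symmetric] cost_def by (simp add: trace_sub)
    also have "\<bar>\<dots>\<bar> \<le> norm (P (K + H) - P K - DP K H) * ?I"
      by (rule abs_trace_le)
    also have "\<dots> \<le> L * (norm H)\<^sup>2 * ?I" by (intro mult_right_mono L Kb KH) auto
    finally show "\<bar>cost (K + H) - cost K - cost_grad K \<bullet> H\<bar> \<le> L * ?I * (norm H)\<^sup>2" by (simp add: mult_ac)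
  qed
qed

lemma gradient_cost: "K \<in> stab \<Longrightarrow> gradient cost K = cost_grad K"
proof -
  assume "K \<in> stab"
  then have K: "K \<in> sub (cost K)" by (simp add: sub_def)
  obtain \<rho> L where "\<rho> > 0" "L > 0" "\<forall>K\<in>sub (cost K). \<forall>H. norm H \<le> \<rho> \<longrightarrow>
     K + H \<in> stab \<and> \<bar>cost (K + H) - cost K - cost_grad K \<bullet> H\<bar> \<le> L * (norm H)\<^sup>2"
    using cost_taylor by metis
  with K show ?thesis by (intro gradient_eqI GDERIV_if_quadratic_remainder[of \<rho> L]) auto
qed

text \<open>Test the derivative in the direction of the gradient itself; one factor of its norm
  cancels.\<close>

lemma cost_grad_bounded: "\<exists>c>0. \<forall>K\<in>sub a. norm (cost_grad K) \<le> c"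
proof -
  obtain c where c: "c > 0" "\<And>K S. K \<in> sub a \<Longrightarrow> transpose S = S \<Longrightarrow> norm (lyap_inv (Acl K) S) \<le> c * norm S"
    using lyap_inv_bound by blast
  obtain e where e: "e > 0" "\<And>K. K \<in> sub a \<Longrightarrow> norm (E K) \<le> e" using E_bounded by blast
  let ?I = "real CARD('n)"
  show ?thesis
  proof (intro exI conjI ballI)
    show "0 < 2 * c * e * ?I" using c e by auto
    fix K assume K: "K \<in> sub a"
    let ?g = "cost_grad K"
    have "(norm ?g)\<^sup>2 = trace (DP K ?g)"
      unfolding trace_DP[OF subD(1)[OF K]] by (simp add: dot_square_norm)
    also have "\<dots> \<le> norm (DP K ?g) * ?I" using abs_trace_le[of "DP K ?g"] by linarith
    also have "\<dots> \<le> (c * (2 * norm ?g * e)) * ?I"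
    proof (intro mult_right_mono)
      have "norm (sym_mult ?g (E K)) \<le> 2 * norm ?g * e"
        using norm_sym_mult_le[of ?g "E K"] e(2)[OF K] by (smt (verit) mult_left_mono norm_ge_zero)
      then show "norm (DP K ?g) \<le> c * (2 * norm ?g * e)"
        unfolding DP_def using c(2)[OF K sym_mult_sym, of ?g "E K"] c(1) by (smt (verit) mult_left_mono)
    qed auto
    finally have "norm ?g * norm ?g \<le> norm ?g * (2 * c * e * ?I)"
      by (simp add: power2_eq_square mult_ac)
    then show "norm ?g \<le> 2 * c * e * ?I"
      using c e by (cases "?g = 0") auto
  qed
qed

text \<open>A short gradient step decreases the cost by a multiple of the squared gradient norm, and
  it cannot go below the lower bound \<open>m\<close>.\<close>

lemma cost_grad_self_bound:
  "\<exists>c>0. \<forall>K\<in>sub a. \<forall>m. (\<forall>K'\<in>stab. m \<le> cost K') \<longrightarrow> (norm (cost_grad K))\<^sup>2 \<le> c * (cost K - m)"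
proof -
  obtain \<rho> L where \<rho>: "\<rho> > 0" "L > 0" "\<And>K H. K \<in> sub a \<Longrightarrow> norm H \<le> \<rho> \<Longrightarrow>
     K + H \<in> stab \<and> \<bar>cost (K + H) - cost K - cost_grad K \<bullet> H\<bar> \<le> L * (norm H)\<^sup>2"
    using cost_taylor by metis
  obtain c where c: "c > 0" "\<And>K. K \<in> sub a \<Longrightarrow> norm (cost_grad K) \<le> c" using cost_grad_bounded by blast
  \<comment> \<open>The first bound keeps the quadratic remainder below half of the linear decrease,
    the second keeps the step inside the neighbourhood where the expansion holds.\<close>
  define s where "s = min (1 / (2 * L)) (\<rho> / c)"
  have s: "s > 0" "s * (2 * L) \<le> 1" "s * c \<le> \<rho>"
    using \<rho> c by (auto simp: s_def min_def field_simps)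
  show ?thesis
  proof (intro exI conjI ballI allI impI)
    show "2 / s > 0" using s by simp
    fix K m assume K: "K \<in> sub a" and m: "\<forall>K'\<in>stab. m \<le> cost K'"
    let ?g = "cost_grad K"
    have ns: "norm (- s *\<^sub>R ?g) \<le> \<rho>" using s c(2)[OF K] by (simp) (smt (verit) mult_left_mono)
    have "m \<le> cost (K + (- s *\<^sub>R ?g))" using m \<rho>(3)[OF K ns] by blast
    also have "\<dots> \<le> cost K - s * (norm ?g)\<^sup>2 + L * (s * norm ?g)\<^sup>2"
      using \<rho>(3)[OF K ns] s(1) by (simp add: dot_square_norm abs_le_iff)
    also have "L * (s * norm ?g)\<^sup>2 = (s * (2 * L)) * (s / 2 * (norm ?g)\<^sup>2)" by (simp add: power2_eq_square)
    also have "cost K - s * (norm ?g)\<^sup>2 + \<dots> \<le> cost K - s * (norm ?g)\<^sup>2 + 1 * (s / 2 * (norm ?g)\<^sup>2)"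
      using s by (intro add_left_mono mult_right_mono) auto
    finally have "s / 2 * (norm ?g)\<^sup>2 \<le> cost K - m" by simp
    then show "(norm ?g)\<^sup>2 \<le> 2 / s * (cost K - m)" using s by (simp add: field_simps)
  qed
qed

lemma cost_lipschitz:
  "\<exists>\<rho>>0. \<exists>L>0. \<forall>K\<in>sub a. \<forall>H. norm H \<le> \<rho> \<longrightarrow> K + H \<in> stab \<and> \<bar>cost (K + H) - cost K\<bar> \<le> L * norm H"
proof -
  obtain \<rho> L where \<rho>: "\<rho> > 0" "L > 0" "\<And>K H. K \<in> sub a \<Longrightarrow> norm H \<le> \<rho> \<Longrightarrow>
     K + H \<in> stab \<and> \<bar>cost (K + H) - cost K - cost_grad K \<bullet> H\<bar> \<le> L * (norm H)\<^sup>2"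
    using cost_taylor by metis
  obtain c where c: "c > 0" "\<And>K. K \<in> sub a \<Longrightarrow> norm (cost_grad K) \<le> c" using cost_grad_bounded by blast
  show ?thesis
  proof (intro exI conjI ballI allI impI)
    show "\<rho> > 0" "c + L * \<rho> > 0" using \<rho> c by (auto intro!: add_pos_pos)
    fix K and H :: "real^'n^'m" assume K: "K \<in> sub a" and H: "norm H \<le> \<rho>"
    show "K + H \<in> stab" using \<rho>(3)[OF K H] by blast
    have "\<bar>cost_grad K \<bullet> H\<bar> \<le> c * norm H"
      using Cauchy_Schwarz_ineq2[of "cost_grad K" H] c(2)[OF K] by (smt (verit) mult_right_mono norm_ge_zero)
    moreover have "L * (norm H)\<^sup>2 \<le> L * \<rho> * norm H"
      using H \<rho> by (simp add: power2_eq_square mult_right_mono)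
    ultimately show "\<bar>cost (K + H) - cost K\<bar> \<le> (c + L * \<rho>) * norm H"
      using \<rho>(3)[OF K H] unfolding distrib_right by linarith
  qed
qed

section \<open>Compact sublevel sets and the optimal policy\<close>

lemma continuous_on_cost: "continuous_on (sub a) cost"
proof -
  obtain \<rho> L where \<rho>: "\<rho> > 0" "L > 0" "\<And>K H. K \<in> sub a \<Longrightarrow> norm H \<le> \<rho> \<Longrightarrow> \<bar>cost (K + H) - cost K\<bar> \<le> L * norm H"
    using cost_lipschitz by metis
  show ?thesis
    unfolding continuous_on_iff
  proof (intro ballI allI impI)
    fix K and e :: real assume K: "K \<in> sub a" and "e > 0"
    let ?d = "min \<rho> (e / L)"
    have "dist (cost K') (cost K) < e" if "dist K' K < ?d" for K'
    proof -
      have "norm (K' - K) < \<rho>" "norm (K' - K) < e / L" using that by (auto simp: dist_norm)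
      then have "L * norm (K' - K) < e" using \<rho> by (simp add: field_simps)
      with \<rho>(3)[OF K, of "K' - K"] \<open>norm (K' - K) < \<rho>\<close> show ?thesis by (simp add: dist_real_def)
    qed
    then show "\<exists>d>0. \<forall>K'\<in>sub a. dist K' K < d \<longrightarrow> dist (cost K') (cost K) < e"
      using \<rho> \<open>e > 0\<close> by (intro exI[of _ ?d]) auto
  qed
qed

text \<open>The difficulty is that stability could be lost in the limit. The stable neighbourhoods
  of points of \<open>sub a\<close> have a common radius, so a limit lies in one of them.\<close>

lemma closed_sub: "closed (sub a)"
  unfolding closed_sequential_limits
proof (intro allI impI, elim conjE)
  fix Ks K assume Ks: "\<forall>n. Ks n \<in> sub a" and lim: "Ks \<longlonglongrightarrow> K"
  obtain \<rho> L where \<rho>: "\<rho> > 0" "L > 0" "\<And>K H. K \<in> sub a \<Longrightarrow> norm H \<le> \<rho> \<Longrightarrow> 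
       K + H \<in> stab \<and> \<bar>cost (K + H) - cost K\<bar> \<le> L * norm H"
    using cost_lipschitz by metis
  have ev: "\<forall>\<^sub>F n in sequentially. norm (K - Ks n) < \<rho>"
    using tendstoD[OF lim \<rho>(1)] by (simp add: dist_norm norm_minus_commute)
  then obtain n where "norm (K - Ks n) < \<rho>" by (auto simp: eventually_sequentially)
  with \<rho>(3)[of "Ks n" "K - Ks n"] Ks have st: "K \<in> stab" by auto
  have "(\<lambda>n. a + L * norm (K - Ks n)) \<longlonglongrightarrow> a + L * norm (K - K)"
    by (intro tendsto_intros lim)
  then have "cost K \<le> a + L * norm (K - K)"
  proof (rule tendsto_lowerbound)
    show "\<forall>\<^sub>F n in sequentially. cost K \<le> a + L * norm (K - Ks n)"
      using ev
    proof eventually_elim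
      case (elim n)
      then show ?case using \<rho>(3)[of "Ks n" "K - Ks n"] Ks subD(3)[of "Ks n" a] by auto
    qed
  qed auto
  with st show "K \<in> sub a" by (simp add: sub_def)
qed

text \<open>Existence of a minimiser is what gives \<open>arg_min_on\<close> its meaning; it follows
  by compactness of the sublevel set of any stabilizing policy.\<close>

lemma cost_optimal:
  assumes "stab \<noteq> {}"
  shows "\<forall>K\<in>stab. cost (arg_min_on cost stab) \<le> cost K"
proof -
  obtain K0 where K0: "K0 \<in> stab" using assms by blast
  let ?S = "sub (cost K0)"
  obtain k where "\<And>K. K \<in> ?S \<Longrightarrow> norm K \<le> k" using sub_bounded by blast
  then have "bounded ?S" by (auto simp: bounded_iff)
  then have "compact ?S" using closed_sub by (simp add: compact_eq_bounded_closed)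
  moreover have K0S: "K0 \<in> ?S" using K0 by (simp add: sub_def)
  ultimately obtain K1 where K1: "K1 \<in> ?S" "\<And>K. K \<in> ?S \<Longrightarrow> cost K1 \<le> cost K"
    using continuous_attains_inf[OF _ _ continuous_on_cost] by blast
  have min: "cost K1 \<le> cost K" if "K \<in> stab" for K
  proof (cases "cost K \<le> cost K0")
    case True
    then show ?thesis using K1(2)[of K] that by (simp add: sub_def)
  next
    case False
    then show ?thesis using K1(2)[OF K0S] by linarith
  qed
  show ?thesis
    unfolding arg_min_on_def
  proof (rule arg_minI[where x=K1])
    show "K1 \<in> stab" using K1 subD by blast
  next
    show "\<not> cost K < cost K1" if "K \<in> stab" for K using min[OF that] by simp
  next
    fix x assume "x \<in> stab" and "\<forall>y. y \<in> stab \<longrightarrow> \<not> cost y < cost x"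
    then show "\<forall>K\<in>stab. cost x \<le> cost K" by (auto simp: not_less)
  qed
qed

section \<open>Finite horizons and two-point estimates\<close>

lemma finite_cost_eq:
  assumes K: "K \<in> stab" and "0 \<le> \<tau>"
  shows "finite_cost A B Q R \<tau> z K = qform (P K) z - qform (P K) (flow (Acl K) z \<tau>)"
proof -
  have integrand: "x \<bullet> (Q *v x) + (- (K *v x)) \<bullet> (R *v (- (K *v x))) = qform (W K) x" for x
    unfolding W_def qform_add qform_transpose_mult
    by (simp add: qform_def linear_neg[OF matrix_vector_mul_linear])
  have "((\<lambda>t. qform (W K) (flow (Acl K) z t)) has_integral
      (- qform (P K) (flow (Acl K) z \<tau>)) - (- qform (P K) (flow (Acl K) z 0))) {0..\<tau>}"
  proof (rule fundamental_theorem_of_calculus[OF assms(2)])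
    fix t
    have "((\<lambda>t. - qform (P K) (flow (Acl K) z t)) has_real_derivative qform (W K) (flow (Acl K) z t)) (at t)"
      using DERIV_minus[OF qform_flow_has_real_derivative[of "P K" "Acl K" z t]]
      by (simp add: P_eq[OF K] qform_uminus)
    then show "((\<lambda>t. - qform (P K) (flow (Acl K) z t)) has_vector_derivative qform (W K) (flow (Acl K) z t)) 
      (at t within {0..\<tau>})"
      by (simp add: has_real_derivative_iff_has_vector_derivative has_vector_derivative_at_within)
  qed
  then show ?thesis
    unfolding finite_cost_def closed_loop_eq_flow Let_def integrand Acl_def[symmetric]
    by (simp add: integral_unique)
qed

text \<open>The truncation error is the form of \<open>P K\<close> at the final state. The weight
  \<open>W K\<close> is at least \<kappa> times \<open>P K\<close>, so this form decays at rate
  \<kappa>, with \<kappa> depending only on the level.\<close>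

lemma finite_cost_approx:
  "\<exists>c>0. \<exists>\<kappa>>0. \<forall>K\<in>sub a. \<forall>z. \<forall>\<tau>\<ge>0.
     \<bar>finite_cost A B Q R \<tau> z K - qform (P K) z\<bar> \<le> c * (norm z)\<^sup>2 * exp (- \<kappa> * \<tau>)"
proof -
  define c where "c = (real CARD('n))\<^sup>2 * \<bar>a\<bar> + 1"
  have c: "c > 0" by (auto simp: c_def intro!: add_nonneg_pos)
  define \<kappa> where "\<kappa> = q0 / c"
  have \<kappa>: "\<kappa> > 0" using c q0_pos by (simp add: \<kappa>_def)
  have "\<bar>finite_cost A B Q R \<tau> z K - qform (P K) z\<bar> \<le> c * (norm z)\<^sup>2 * exp (- \<kappa> * \<tau>)"
    if K: "K \<in> sub a" and \<tau>: "0 \<le> \<tau>" for K z \<tau>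
  proof -
    note Ks = subD(1)[OF K]
    have "(real CARD('n))\<^sup>2 * a \<le> c" by (auto simp: c_def intro!: order.trans[OF mult_left_mono[of a "\<bar>a\<bar>"]])
    then have "norm (P K) \<le> c" using norm_P_le[OF K] by linarith
    then have qP: "qform (P K) x \<le> c * (norm x)\<^sup>2" for x
      using abs_qform_le[of "P K" x] by (smt (verit) mult_right_mono zero_le_power2)
    have diss: "\<kappa> * qform (P K) x \<le> qform (W K) x" for x
    proof -
      have "\<kappa> * qform (P K) x \<le> \<kappa> * (c * (norm x)\<^sup>2)" using qP \<kappa> by (intro mult_left_mono) auto
      also have "\<dots> = q0 * (norm x)\<^sup>2" using c by (simp add: \<kappa>_def)
      finally show ?thesis using W_lower(2)[of x K] by linarith
    qed
    let ?x = "flow (Acl K) z"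
    let ?h = "\<lambda>t. qform (P K) (?x t) * exp (\<kappa> * t)"
    have "?h \<tau> \<le> ?h 0"
    proof (rule DERIV_nonpos_imp_nonincreasing[OF \<tau>])
      fix t
      have "(?h has_real_derivative (qform (lyap (Acl K) (P K)) (?x t) + \<kappa> * qform (P K) (?x t)) * exp (\<kappa> * t)) (at t)"
        by (auto intro!: derivative_eq_intros qform_flow_has_real_derivative simp: algebra_simps)
      moreover have "(qform (lyap (Acl K) (P K)) (?x t) + \<kappa> * qform (P K) (?x t)) * exp (\<kappa> * t) \<le> 0"
        using diss[of "?x t"] by (intro mult_nonpos_nonneg) (auto simp: P_eq[OF Ks] qform_uminus)
      ultimately show "\<exists>y. (?h has_real_derivative y) (at t) \<and> y \<le> 0" by blast
    qed
    then have "qform (P K) (?x \<tau>) \<le> qform (P K) z * exp (- \<kappa> * \<tau>)"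
      by (simp add: exp_minus field_simps)
    also have "\<dots> \<le> c * (norm z)\<^sup>2 * exp (- \<kappa> * \<tau>)" by (intro mult_right_mono qP) auto
    finally show ?thesis using P_nonneg[OF Ks, of "?x \<tau>"] finite_cost_eq[OF Ks \<tau>, of z] by simp
  qed
  with c \<kappa> show ?thesis by blast
qed

text \<open>In the symmetric difference the zeroth-order terms cancel and the linear terms add up.
  Dividing by \<open>r\<close> leaves a smoothing error of order \<open>r\<close> from the Taylor
  remainder and a truncation error of order \<open>exp (- \<kappa> * \<tau>) / r\<close>.\<close>

lemma grad_estimate_expansion:
  "\<exists>C>0. \<exists>\<kappa>>0. \<exists>\<rho>>0. \<forall>K\<in>sub a. \<forall>U z r \<tau>. 0 < r \<longrightarrow> r * norm U \<le> \<rho> \<longrightarrow> 0 \<le> \<tau> \<longrightarrow>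
     (\<exists>e. grad_estimate A B Q R \<tau> r U z K = (qform (DP K U) z + e) *\<^sub>R U \<and>
        \<bar>e\<bar> \<le> C * (norm z)\<^sup>2 * (r * (norm U)\<^sup>2 + exp (- \<kappa> * \<tau>) / r))"
proof -
  obtain \<rho> b where \<rho>: "\<rho> > 0" "b \<ge> a" "\<And>K H. K \<in> sub a \<Longrightarrow> norm H \<le> \<rho> \<Longrightarrow> K + H \<in> sub b"
    using sub_neighbourhood by blast
  obtain L where L: "L > 0" "\<And>K H. K \<in> sub b \<Longrightarrow> K + H \<in> sub b \<Longrightarrow> norm (P (K + H) - P K - DP K H) \<le> L * (norm H)\<^sup>2"
    using P_taylor by blast
  obtain c \<kappa> where c: "c > 0" "\<kappa> > 0" "\<And>K z \<tau>. K \<in> sub b \<Longrightarrow> \<tau> \<ge> 0 \<Longrightarrow>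
     \<bar>finite_cost A B Q R \<tau> z K - qform (P K) z\<bar> \<le> c * (norm z)\<^sup>2 * exp (- \<kappa> * \<tau>)"
    using finite_cost_approx by metis
  have main: "\<exists>e. grad_estimate A B Q R \<tau> r U z K = (qform (DP K U) z + e) *\<^sub>R U \<and>
        \<bar>e\<bar> \<le> (L + c) * (norm z)\<^sup>2 * (r * (norm U)\<^sup>2 + exp (- \<kappa> * \<tau>) / r)"
    if K: "K \<in> sub a" and r: "0 < r" and rU: "r * norm U \<le> \<rho>" and \<tau>: "0 \<le> \<tau>" for K U z r \<tau>
  proof -
    note Ks = subD(1)[OF K]
    have Kb: "K \<in> sub b" using sub_mono[OF \<rho>(2)] K by blast
    have one: "\<bar>finite_cost A B Q R \<tau> z (K + s *\<^sub>R U) - qform (P K) z - s * qform (DP K U) z\<bar>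
        \<le> (norm z)\<^sup>2 * (c * exp (- \<kappa> * \<tau>) + L * (r\<^sup>2 * (norm U)\<^sup>2))" if s: "\<bar>s\<bar> = r" for s
    proof -
      have KH: "K + s *\<^sub>R U \<in> sub b" by (rule \<rho>(3)[OF K]) (use s rU in simp)
      have D: "DP K (s *\<^sub>R U) = s *\<^sub>R DP K U" by (rule linear_scale[OF DP_linear[OF Ks]])
      have "\<bar>qform (P (K + s *\<^sub>R U) - P K - DP K (s *\<^sub>R U)) z\<bar> \<le> (L * (norm (s *\<^sub>R U))\<^sup>2) * (norm z)\<^sup>2"
        using abs_qform_le[of "P (K + s *\<^sub>R U) - P K - DP K (s *\<^sub>R U)" z] L(2)[OF Kb KH]
        by (smt (verit) mult_right_mono zero_le_power2)
      moreover have "s\<^sup>2 = r\<^sup>2" using s by (metis power2_abs)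
      ultimately show ?thesis
        using c(3)[OF KH \<tau>, of z] unfolding qform_diff D qform_scaleR norm_scaleR power_mult_distrib power2_abs
          distrib_left
        by (simp add: mult_ac)
    qed
    \<comment> \<open>The error is defined as the exact residual, so the identity for the estimate
      is immediate and only its size remains to be bounded.\<close>
    define e where "e = 1 / (2 * r) * (finite_cost A B Q R \<tau> z (K + r *\<^sub>R U) - finite_cost A B Q R \<tau> z (K - r *\<^sub>R U))
      - qform (DP K U) z"
    have "2 * r * e = finite_cost A B Q R \<tau> z (K + r *\<^sub>R U) - finite_cost A B Q R \<tau> z (K - r *\<^sub>R U)
       - 2 * (r * qform (DP K U) z)"
      using r by (simp add: e_def field_simps)
    moreover have "\<bar>finite_cost A B Q R \<tau> z (K - r *\<^sub>R U) - qform (P K) z + r * qform (DP K U) z\<bar>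
        \<le> (norm z)\<^sup>2 * (c * exp (- \<kappa> * \<tau>) + L * (r\<^sup>2 * (norm U)\<^sup>2))"
      using one[of "- r"] r by simp
    ultimately have "\<bar>2 * r * e\<bar> \<le> 2 * ((norm z)\<^sup>2 * (c * exp (- \<kappa> * \<tau>) + L * (r\<^sup>2 * (norm U)\<^sup>2)))"
      using one[of r] r by linarith
    also have "\<dots> \<le> 2 * r * ((L + c) * (norm z)\<^sup>2 * (r * (norm U)\<^sup>2 + exp (- \<kappa> * \<tau>) / r))"
    proof -
      have "c * exp (- \<kappa> * \<tau>) + L * (r\<^sup>2 * (norm U)\<^sup>2) \<le> (L + c) * (r\<^sup>2 * (norm U)\<^sup>2 + exp (- \<kappa> * \<tau>))"
        using c L by (simp add: algebra_simps)
      then have "(norm z)\<^sup>2 * (c * exp (- \<kappa> * \<tau>) + L * (r\<^sup>2 * (norm U)\<^sup>2)) \<le>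
         (norm z)\<^sup>2 * ((L + c) * (r\<^sup>2 * (norm U)\<^sup>2 + exp (- \<kappa> * \<tau>)))" by (intro mult_left_mono) auto
      also have "\<dots> = r * ((L + c) * (norm z)\<^sup>2 * (r * (norm U)\<^sup>2 + exp (- \<kappa> * \<tau>) / r))"
        using r by (simp add: field_simps power2_eq_square)
      finally show ?thesis by simp
    qed
    finally have "\<bar>e\<bar> \<le> (L + c) * (norm z)\<^sup>2 * (r * (norm U)\<^sup>2 + exp (- \<kappa> * \<tau>) / r)"
      using r by (simp add: abs_mult)
    moreover have "grad_estimate A B Q R \<tau> r U z K = (qform (DP K U) z + e) *\<^sub>R U"
      by (simp add: grad_estimate_def e_def)
    ultimately show ?thesis by blast
  qed
  show ?thesis
    using main \<open>L > 0\<close> c \<rho>(1) by (intro exI[of _ "L + c"] conjI exI[of _ \<kappa>] exI[of _ \<rho>]) auto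
qed

end

section \<open>Descent with delayed gradients\<close>

text \<open>
  With \<open>V k = max (f (x k) - m) \<epsilon>\<close>, the two-sided bound
  \<open>V k (1 - c1 \<eta>) \<le> V (k + 1)\<close> makes all gap values inside a delay window comparable, so that the
  displacement over the window is small relative to the current gradient.
\<close>

lemma delayed_descent_converges:
  fixes f :: "'a::euclidean_space \<Rightarrow> real" and g :: "'a \<Rightarrow> 'a" and x G :: "nat \<Rightarrow> 'a"
  assumes x0: "x 0 \<in> Z" "f (x 0) \<le> a"
    and step: "\<And>j. j < J \<Longrightarrow> x (Suc j) = x j - \<eta> *\<^sub>R G j"
    and delay: "\<And>j i. j < J \<Longrightarrow> i < N \<Longrightarrow> d j i \<le> T"
    and smooth: "\<And>y h. y \<in> Z \<Longrightarrow> f y \<le> a \<Longrightarrow> norm h \<le> \<rho> \<Longrightarrow>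
       y + h \<in> Z \<and> \<bar>f (y + h) - f y - g y \<bullet> h\<bar> \<le> L * (norm h)\<^sup>2"
    and self: "\<And>y. y \<in> Z \<Longrightarrow> f y \<le> a \<Longrightarrow> (norm (g y))\<^sup>2 \<le> c * (f y - m)"
    and dom: "\<And>y. y \<in> Z \<Longrightarrow> f y \<le> a \<Longrightarrow> f y - m \<le> 1 / (2 * \<mu>) * (norm (g y))\<^sup>2"
    and Gbound: "\<And>j X. j < J \<Longrightarrow> 0 \<le> X \<Longrightarrow>
       (\<And>i. i < N \<Longrightarrow> x (j - d j i) \<in> Z \<and> f (x (j - d j i)) \<le> a \<and> max (f (x (j - d j i)) - m) \<epsilon> \<le> X\<^sup>2) \<Longrightarrow>
       norm (G j) \<le> C * X"
    and Gdesc: "\<And>j Y. j < J \<Longrightarrow> 0 \<le> Y \<Longrightarrow> Y \<le> \<rho> \<Longrightarrow> x j \<in> Z \<Longrightarrow> f (x j) \<le> a \<Longrightarrow>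
       (\<And>i. i < N \<Longrightarrow> x (j - d j i) \<in> Z \<and> f (x (j - d j i)) \<le> a \<and> norm (x (j - d j i) - x j) \<le> Y) \<Longrightarrow>
       g (x j) \<bullet> G j \<ge> 1 / 2 * (norm (g (x j)))\<^sup>2 - norm (g (x j)) * (C * Y + e)"
    and pos: "0 < \<eta>" "0 < \<rho>" "0 < L" "0 < c" "0 < \<mu>" "0 < C" "0 < \<epsilon>" "0 \<le> e" "1 \<le> T"
    and gap: "\<epsilon> \<le> f (x 0) - m"
    and c1: "c1 = 2 * C * sqrt c + 4 * L * C\<^sup>2"
    and small: "\<eta> \<le> 1" "4 * real T * c1 * \<eta> \<le> 1" "2 * C * real T * \<eta> * sqrt (a - m) \<le> \<rho>"
      "2 * C\<^sup>2 * real T * \<eta> \<le> sqrt \<mu> / 8" "e \<le> sqrt \<mu> / 8 * sqrt \<epsilon>" "32 * L * C\<^sup>2 * \<eta> \<le> \<mu>" "\<eta> * \<mu> \<le> 1"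
  shows "x J \<in> Z \<and> f (x J) \<le> a \<and> f (x J) - m \<le> max \<epsilon> ((1 - \<eta> * \<mu> / 4) ^ J * (f (x 0) - m))"
proof -
  define \<Delta> where "\<Delta> k = f (x k) - m" for k
  define V where "V k = max (\<Delta> k) \<epsilon>" for k
  define q where "q = 1 - \<eta> * \<mu> / 4"
  have q: "0 \<le> q" "q \<le> 1" using small(7) pos by (auto simp: q_def)
  have V\<epsilon>: "V k \<ge> \<epsilon>" "V k \<ge> \<Delta> k" "V k > 0" for k using pos by (auto simp: V_def)
  have c1p: "c1 > 0" unfolding c1 using pos by (intro add_pos_pos mult_pos_pos) auto
  have T1: "real T \<ge> 1" using pos by simp
  have c1\<eta>: "c1 * \<eta> \<le> 1 / 4"
  proof -
    have "c1 * \<eta> * 1 \<le> c1 * \<eta> * real T" using c1p pos T1 by (intro mult_left_mono) auto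
    then show ?thesis using small(2) by (simp add: mult_ac)
  qed
  \<comment> \<open>The rate is stated relative to the initial gap with floor \<epsilon>, so that it
    also records that the gap never rises above \<epsilon> again.\<close>
  define good where "good k \<longleftrightarrow> x k \<in> Z \<and> f (x k) \<le> a \<and> \<Delta> k \<le> max \<epsilon> (q ^ k * \<Delta> 0)" for k
  have main: "(\<forall>k\<le>j. good k) \<and> (\<forall>k<j. (1 - c1 * \<eta>) * V k \<le> V (Suc k))" if "j \<le> J" for j
    using that
  proof (induction j)
    case 0
    show ?case using x0 by (auto simp: good_def)
  next
    case (Suc j)
    then have jJ: "j < J" and gd: "\<And>k. k \<le> j \<Longrightarrow> good k" and rat: "\<And>k. k < j \<Longrightarrow> (1 - c1 * \<eta>) * V k \<le> V (Suc k)"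
      by auto
    have \<Delta>a: "V k \<le> a - m" if "k \<le> j" for k
      using gd[OF that] gap x0(2) by (auto simp: good_def V_def \<Delta>_def)
    have ratio: "(1 - c1 * \<eta>) ^ p * V (j - p) \<le> V j" if "p \<le> j" for p
      using that
    proof (induction p)
      case (Suc p)
      have "(1 - c1 * \<eta>) ^ Suc p * V (j - Suc p) = (1 - c1 * \<eta>) ^ p * ((1 - c1 * \<eta>) * V (j - Suc p))" by simp
      also have "\<dots> \<le> (1 - c1 * \<eta>) ^ p * V (j - p)"
        using rat[of "j - Suc p"] Suc.prems c1\<eta> by (intro mult_left_mono) (auto simp: Suc_diff_Suc)
      also have "\<dots> \<le> V j" using Suc by simp
      finally show ?case .
    qed simp
    \<comment> \<open>The window has length \<open>2 * T\<close>: a step at most \<open>T\<close>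
      before \<open>j\<close> was computed from policies up to \<open>T\<close> older still.
      Bernoulli's inequality keeps the accumulated loss within a factor 2.\<close>
    have win: "V (j - p) \<le> 2 * V j" if "p \<le> 2 * T" for p
    proof -
      let ?p = "min p j"
      have "1 + real ?p * (- (c1 * \<eta>)) \<le> (1 + - (c1 * \<eta>)) ^ ?p"
        by (rule Bernoulli_inequality) (use c1\<eta> in simp)
      moreover have "real ?p * (c1 * \<eta>) \<le> 1 / 2"
      proof -
        have "real ?p * (c1 * \<eta>) \<le> 2 * real T * (c1 * \<eta>)" using that c1p pos by (intro mult_right_mono) auto
        then show ?thesis using small(2) by (simp add: mult_ac)
      qed
      ultimately have "1 / 2 \<le> (1 - c1 * \<eta>) ^ ?p" by simp
      then have "1 / 2 * V (j - ?p) \<le> (1 - c1 * \<eta>) ^ ?p * V (j - ?p)" using V\<epsilon>(3)[of "j - ?p"] by (intro mult_right_mono) auto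
      with ratio[of ?p] have "V (j - ?p) \<le> 2 * V j" by simp
      moreover have "j - ?p = j - p" by simp
      ultimately show ?thesis by simp
    qed
    define s where "s = sqrt (V j)"
    have s: "s > 0" "s\<^sup>2 = V j" using V\<epsilon>(3)[of j] by (auto simp: s_def)
    have nG: "norm (G k) \<le> 2 * C * s" if "k \<le> j" "j - k \<le> T" for k
    proof -
      have "norm (G k) \<le> C * (2 * s)"
      proof (rule Gbound)
        fix i assume "i < N"
        then have dT: "d k i \<le> T" using delay[of k i] that jJ by simp
        have eq: "j - (j - k + d k i) = k - d k i" using that by simp
        have "V (k - d k i) \<le> 2 * V j" using win[of "j - k + d k i"] dT that unfolding eq by simp
        also have "\<dots> \<le> (2 * s)\<^sup>2" using s V\<epsilon>(3)[of j] by (simp add: power_mult_distrib)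
        finally show "x (k - d k i) \<in> Z \<and> f (x (k - d k i)) \<le> a \<and> max (f (x (k - d k i)) - m) \<epsilon> \<le> (2 * s)\<^sup>2"
          using gd[of "k - d k i"] that by (auto simp: good_def V_def \<Delta>_def)
      qed (use that jJ s in auto)
      then show ?thesis by simp
    qed
    have disp: "norm (x (j - p) - x j) \<le> real p * (\<eta> * (2 * C * s))" if "p \<le> T" for p
      using that
    proof (induction p)
      case (Suc p)
      show ?case
      proof (cases "Suc p \<le> j")
        case True
        let ?k = "j - Suc p"
        have Sk: "Suc ?k = j - p" using True by simp
        have "x (j - p) = x ?k - \<eta> *\<^sub>R G ?k" using step[of ?k] jJ unfolding Sk by simp
        then have "norm (x ?k - x j) \<le> norm (x (j - p) - x j) + \<eta> * norm (G ?k)"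
          using norm_triangle_ineq[of "x (j - p) - x j" "\<eta> *\<^sub>R G ?k"] pos by (simp add: algebra_simps)
        also have "\<dots> \<le> real p * (\<eta> * (2 * C * s)) + \<eta> * (2 * C * s)"
          using Suc nG[of ?k] pos by (intro add_mono mult_left_mono) auto
        finally show ?thesis by (simp add: algebra_simps)
      next
        case False
        then have "j - Suc p = j - p" by simp
        then have "norm (x (j - Suc p) - x j) \<le> real p * (\<eta> * (2 * C * s))" using Suc by simp
        also have "\<dots> \<le> real (Suc p) * (\<eta> * (2 * C * s))" using pos s by (intro mult_right_mono) auto
        finally show ?thesis .
      qed
    qed simp
    have gj: "x j \<in> Z" "f (x j) \<le> a" "\<Delta> j \<le> max \<epsilon> (q ^ j * \<Delta> 0)" using gd[of j] by (auto simp: good_def)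
    have s_le: "s \<le> sqrt (a - m)" unfolding s_def using \<Delta>a[of j] by simp
    define h where "h = - (\<eta> *\<^sub>R G j)"
    have xS: "x (Suc j) = x j + h" by (simp add: h_def step[OF jJ])
    have nGj: "norm (G j) \<le> 2 * C * s" using nG[of j] by simp
    have nh: "norm h \<le> 2 * C * \<eta> * s" using mult_left_mono[OF nGj, of \<eta>] pos by (simp add: h_def mult_ac)
    \<comment> \<open>The largest distance the iterates can travel in \<open>T\<close> steps of
      length at most \<open>2 * C * \<eta> * s\<close>; it bounds the displacement between a delayed
      policy and the current one.\<close>
    define Y where "Y = 2 * C * real T * \<eta> * s"
    have Y\<rho>: "Y \<le> \<rho>"
    proof -
      have "Y \<le> 2 * C * real T * \<eta> * sqrt (a - m)" unfolding Y_def using s_le pos by (intro mult_left_mono) auto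
      then show ?thesis using small(3) by linarith
    qed
    have Y0: "0 \<le> Y" unfolding Y_def using pos s by simp
    have hY: "norm h \<le> Y"
    proof -
      have "2 * C * \<eta> * s * 1 \<le> 2 * C * \<eta> * s * real T" using T1 pos s by (intro mult_left_mono) auto
      then show ?thesis using nh by (simp add: Y_def mult_ac)
    qed
    have sm: "x j + h \<in> Z" "\<bar>f (x j + h) - f (x j) - g (x j) \<bullet> h\<bar> \<le> L * (norm h)\<^sup>2"
      using smooth[OF gj(1,2), of h] hY Y\<rho> by auto
    have h2: "L * (norm h)\<^sup>2 \<le> \<eta> * (4 * L * C\<^sup>2 * \<eta> * V j)"
    proof -
      have "(norm h)\<^sup>2 \<le> (2 * C * \<eta> * s)\<^sup>2" using nh by (intro power_mono) auto
      also have "\<dots> = 4 * C\<^sup>2 * \<eta>\<^sup>2 * V j" using s(2) by (simp add: power_mult_distrib)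
      finally have "L * (norm h)\<^sup>2 \<le> L * (4 * C\<^sup>2 * \<eta>\<^sup>2 * V j)" using pos by (intro mult_left_mono) auto
      then show ?thesis by (simp add: power2_eq_square mult_ac)
    qed
    have ng: "norm (g (x j)) \<le> sqrt c * s"
    proof -
      have "(norm (g (x j)))\<^sup>2 \<le> c * V j"
        using self[OF gj(1,2)] V\<epsilon>(2)[of j] pos by (smt (verit) \<Delta>_def mult_left_mono)
      also have "\<dots> = (sqrt c * s)\<^sup>2" using pos s by (simp add: power_mult_distrib)
      finally show ?thesis using pos s by (intro power2_le_imp_le[of "norm (g (x j))"]) auto
    qed
    have gh: "g (x j) \<bullet> h = - (\<eta> * (g (x j) \<bullet> G j))" by (simp add: h_def)
    have "\<bar>g (x j) \<bullet> h\<bar> \<le> \<eta> * (2 * C * sqrt c * V j)"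
    proof -
      have "\<bar>g (x j) \<bullet> h\<bar> \<le> norm (g (x j)) * norm h" by (rule Cauchy_Schwarz_ineq2)
      also have "\<dots> \<le> (sqrt c * s) * (2 * C * \<eta> * s)" using ng nh by (intro mult_mono) (auto simp: pos s less_imp_le)
      also have "\<dots> = \<eta> * (2 * C * sqrt c * s\<^sup>2)" by (simp add: power2_eq_square mult_ac)
      finally show ?thesis unfolding s(2) .
    qed
    moreover have "\<eta> * (4 * L * C\<^sup>2 * \<eta> * V j) \<le> \<eta> * (4 * L * C\<^sup>2 * 1 * V j)"
      using small(1) pos V\<epsilon>(3)[of j] by (intro mult_left_mono mult_right_mono) auto
    ultimately have two: "\<bar>\<Delta> (Suc j) - \<Delta> j\<bar> \<le> c1 * \<eta> * V j"
      using sm(2) h2 by (simp add: xS \<Delta>_def c1 algebra_simps)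
    have ratS: "(1 - c1 * \<eta>) * V j \<le> V (Suc j)"
    proof (cases "\<Delta> j \<ge> \<epsilon>")
      case True
      then have "V j = \<Delta> j" by (simp add: V_def)
      then show ?thesis using two V\<epsilon>(2)[of "Suc j"] by (simp add: algebra_simps abs_le_iff)
    next
      case False
      then have "V j = \<epsilon>" by (simp add: V_def)
      moreover have "(1 - c1 * \<eta>) * \<epsilon> \<le> 1 * \<epsilon>" using c1p pos by (intro mult_right_mono) auto
      ultimately show ?thesis using V\<epsilon>(1)[of "Suc j"] by simp
    qed
    \<comment> \<open>Below \<open>\<epsilon> / 2\<close> no descent is claimed: one step changes
      the gap by at most \<open>\<epsilon> / 4\<close>, so it cannot overshoot \<epsilon>. Otherwise
      \<open>V j\<close> is comparable with the gap and gradient dominance applies.\<close>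
    have decr: "\<Delta> (Suc j) \<le> max \<epsilon> (q * \<Delta> j)"
    proof (cases "\<Delta> j < \<epsilon> / 2")
      case True
      then have "V j = \<epsilon>" using pos by (simp add: V_def)
      moreover have "c1 * \<eta> * V j \<le> 1 / 4 * V j" using c1\<eta> V\<epsilon>(3)[of j] by (intro mult_right_mono) auto
      ultimately have "\<Delta> (Suc j) \<le> \<epsilon>" using two True pos(7) by linarith
      then show ?thesis by simp
    next
      case False
      let ?n = "norm (g (x j))"
      have "V j \<le> 2 * \<Delta> j" using False pos by (auto simp: V_def)
      moreover have dm: "2 * \<mu> * \<Delta> j \<le> ?n\<^sup>2"
        using dom[OF gj(1,2)] pos by (simp add: \<Delta>_def field_simps)
      then have "\<mu> * (2 * \<Delta> j) \<le> ?n\<^sup>2" by simp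
      ultimately have Vn: "\<mu> * V j \<le> ?n\<^sup>2"
        using pos by (smt (verit) mult_left_mono)
      have sn: "sqrt \<mu> * s \<le> ?n"
        using Vn pos s by (intro power2_le_imp_le[of "sqrt \<mu> * s"]) (auto simp: power_mult_distrib)
      have "e \<le> sqrt \<mu> / 8 * s"
      proof -
        have "sqrt \<mu> / 8 * sqrt \<epsilon> \<le> sqrt \<mu> / 8 * s"
          unfolding s_def using V\<epsilon>(1)[of j] pos by (intro mult_left_mono) auto
        then show ?thesis using small(5) by linarith
      qed
      moreover have "C * Y \<le> sqrt \<mu> / 8 * s"
        using mult_right_mono[OF small(4), of s] s by (simp add: Y_def power2_eq_square mult_ac)
      \<comment> \<open>Delay and bias each take one eighth of the gradient norm. Of the guaranteed
        half of the squared norm, one quarter is lost here and one eighth to curvature, leaving one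
        eighth for the descent.\<close>
      ultimately have "C * Y + e \<le> 1 / 4 * ?n" using sn by simp
      then have "?n * (C * Y + e) \<le> ?n * (1 / 4 * ?n)" by (intro mult_left_mono) auto
      moreover have "g (x j) \<bullet> G j \<ge> 1 / 2 * ?n\<^sup>2 - ?n * (C * Y + e)"
      proof (rule Gdesc[OF jJ Y0 Y\<rho> gj(1,2)])
        fix i assume "i < N"
        then have dT: "d j i \<le> T" using delay jJ by simp
        have "norm (x (j - d j i) - x j) \<le> real (d j i) * (\<eta> * (2 * C * s))" by (rule disp[OF dT])
        also have "\<dots> \<le> real T * (\<eta> * (2 * C * s))" using dT pos s by (intro mult_right_mono) auto
        finally show "x (j - d j i) \<in> Z \<and> f (x (j - d j i)) \<le> a \<and> norm (x (j - d j i) - x j) \<le> Y"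
          using gd[of "j - d j i"] by (simp add: good_def Y_def mult_ac)
      qed
      ultimately have "g (x j) \<bullet> G j \<ge> 1 / 4 * ?n\<^sup>2" by (simp add: power2_eq_square)
      then have "\<eta> * (g (x j) \<bullet> G j) \<ge> \<eta> * (1 / 4 * ?n\<^sup>2)" using pos by (intro mult_left_mono) auto
      moreover have "4 * L * C\<^sup>2 * \<eta> * V j \<le> 1 / 8 * ?n\<^sup>2"
      proof -
        have "32 * L * C\<^sup>2 * \<eta> * V j \<le> \<mu> * V j"
          by (rule mult_right_mono[OF small(6)]) (use V\<epsilon>(3)[of j] in simp)
        then show ?thesis using Vn by linarith
      qed
      then have "\<eta> * (4 * L * C\<^sup>2 * \<eta> * V j) \<le> \<eta> * (1 / 8 * ?n\<^sup>2)" using pos by (intro mult_left_mono) auto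
      ultimately have "\<Delta> (Suc j) \<le> \<Delta> j - \<eta> * (1 / 8 * ?n\<^sup>2)"
        using sm(2) h2 gh by (simp add: xS \<Delta>_def abs_le_iff)
      moreover have "\<eta> * (1 / 8 * (2 * \<mu> * \<Delta> j)) \<le> \<eta> * (1 / 8 * ?n\<^sup>2)" using dm pos by (intro mult_left_mono) auto
      ultimately have "\<Delta> (Suc j) \<le> q * \<Delta> j" by (simp add: q_def algebra_simps)
      then show ?thesis by simp
    qed
    have "\<Delta> (Suc j) \<le> max \<epsilon> (q ^ Suc j * \<Delta> 0)"
    proof -
      have "q * \<Delta> j \<le> q * max \<epsilon> (q ^ j * \<Delta> 0)" using gj(3) q by (intro mult_left_mono) auto
      also have "\<dots> = max (q * \<epsilon>) (q ^ Suc j * \<Delta> 0)" using q by (simp add: max_mult_distrib_left mult.assoc)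
      also have "\<dots> \<le> max \<epsilon> (q ^ Suc j * \<Delta> 0)"
        using q pos mult_right_mono[of q 1 \<epsilon>] by (intro max.mono) auto
      finally show ?thesis using decr by simp
    qed
    moreover have "\<Delta> (Suc j) \<le> \<Delta> 0"
    proof -
      have "q ^ Suc j * \<Delta> 0 \<le> 1 * \<Delta> 0" using q gap pos by (intro mult_right_mono power_le_one) (auto simp: \<Delta>_def)
      moreover have "\<epsilon> \<le> \<Delta> 0" using gap by (simp add: \<Delta>_def)
      ultimately show ?thesis using \<open>\<Delta> (Suc j) \<le> max \<epsilon> (q ^ Suc j * \<Delta> 0)\<close> by linarith
    qed
    then have "f (x (Suc j)) \<le> a" using x0(2) by (simp add: \<Delta>_def)
    ultimately have "good (Suc j)" using sm(1) by (simp add: good_def xS)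
    then show ?case using gd rat ratS by (auto simp: le_Suc_eq less_Suc_eq)
  qed
  from main[of J] have "good J" by simp
  then show ?thesis by (simp add: good_def \<Delta>_def q_def)
qed

section \<open>Delays\<close>

text \<open>Consecutive pushes of a worker can be arbitrarily close, since only the pulls are
  spaced; hence \<open>Suc p\<close> runs guarantee only \<open>p\<close> full periods.\<close>

lemma push_gap:
  assumes wt: "worker_timing tmin tmax M pull push" and "w < M"
  shows "push w k + real p * tmin < push w (k + Suc p)"
proof -
  have st: "pull w k < push w k" "push w k \<le> pull w (Suc k)" "tmin \<le> pull w (Suc k) - pull w k" for k
    using assms by (auto simp: worker_timing_def)
  have "pull w (Suc k) + real p * tmin \<le> pull w (k + Suc p)"
  proof (induction p)
    case (Suc p)
    then show ?case using st(3)[of "k + Suc p"] by (simp add: algebra_simps)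
  qed simp
  then show ?thesis using st(1)[of "k + Suc p"] st(2)[of k] by linarith
qed

text \<open>The spare 2 has two sources: counting both ends of a range, and the period lost in
  \<open>push_gap\<close>.\<close>

lemma pushes_in_window_le:
  assumes wt: "worker_timing tmin tmax M pull push" and "w < M" and t: "0 < tmin" "tmin < tmax"
    and "finite S" and S: "\<And>k. k \<in> S \<Longrightarrow> t0 < push w k \<and> push w k \<le> t0 + tmax"
  shows "real (card S) \<le> of_int \<lfloor>tmax / tmin\<rfloor> + 2"
proof (cases "S = {}")
  case True
  then show ?thesis using t by simp
next
  case False
  define k where "k = Min S"
  have k: "k \<in> S" "\<And>l. l \<in> S \<Longrightarrow> k \<le> l" using False \<open>finite S\<close> by (auto simp: k_def)
  define q where "q = nat \<lfloor>tmax / tmin\<rfloor>"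
  have qr: "real q = of_int \<lfloor>tmax / tmin\<rfloor>" using t by (simp add: q_def)
  have "S \<subseteq> {k..k + Suc q}"
  proof
    fix l assume l: "l \<in> S"
    have "l \<le> k + Suc q"
    proof (rule ccontr)
      assume "\<not> l \<le> k + Suc q"
      then obtain p where p: "l = k + Suc p" "p \<ge> Suc q"
        by (metis add_Suc_right le_add_diff_inverse less_imp_Suc_add not_le not_less_eq_eq add_le_cancel_left
           Suc_le_mono k(2)[OF l] add.commute less_eq_Suc_le)
      have "real p * tmin < tmax" using push_gap[OF wt \<open>w < M\<close>, of k p] S[OF l] S[OF k(1)] p by simp
      then have "real p < tmax / tmin" using t by (simp add: field_simps)
      moreover have "tmax / tmin < real q + 1" unfolding qr by linarith
      ultimately show False using p(2) by linarith
    qed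
    then show "l \<in> {k..k + Suc q}" using k(2)[OF l] by simp
  qed
  then have "card S \<le> card {k..k + Suc q}" by (intro card_mono) auto
  then show ?thesis using qr by simp
qed

text \<open>An estimate is pushed at most \<open>tmax\<close> after its pull, so the updates it
  misses fall into a window of that length. Each update consumes \<open>N\<close> arrivals, whereas
  at most \<open>C0 * N\<close> workers each send a bounded number in the window.\<close>

lemma delay_bound:
  assumes wt: "worker_timing tmin tmax M pull push" and ao: "arrival_order M push arr"
    and t: "0 < tmin" "tmin < tmax" and "0 < C0" and M: "real M \<le> C0 * real N" and i: "i < N"
  shows "real (delay pull push arr N j i) \<le> 3 * (C0 * of_int \<lfloor>tmax / tmin\<rfloor> + 1)"
proof -
  define P where "P s = case_prod push (arr s)" for s
  have mono: "P s \<le> P s'" if "s \<le> s'" for s s'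
    using ao that by (auto simp: arrival_order_def P_def mono_def)
  have inj: "inj arr" and ran: "fst (arr s) < M" for s
    using ao by (auto simp: arrival_order_def bij_betw_def) (metis SigmaD1 lessThan_iff prod.collapse rangeI)
  define q :: real where "q = of_int \<lfloor>tmax / tmin\<rfloor>"
  have q1: "q \<ge> 1" using t by (simp add: q_def le_floor_iff)
  define u where "u = update_time push arr N"
  have u: "u l = P (l * N + (N - 1))" for l by (simp add: u_def update_time_def P_def)
  obtain w k where wk: "arr (j * N + i) = (w, k)" by fastforce
  have wM: "w < M" using ran[of "j * N + i"] wk by simp
  define t0 where "t0 = pull w k"
  have Pji: "P (j * N + i) = push w k" by (simp add: P_def wk)
  have pt: "t0 < push w k" "push w k \<le> t0 + tmax"
    using wt wM unfolding worker_timing_def t0_def by (auto, smt (verit))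
  define C where "C = {l. u l \<le> t0}"
  define c where "c = card C"
  have dl: "delay pull push arr N j i = j - c"
    by (simp add: delay_def latest_index_def wk c_def C_def u_def t0_def)
  have Cj: "C \<subseteq> {..<j}"
  proof
    fix l assume "l \<in> C"
    then have "P (l * N + (N - 1)) < P (j * N + i)" using pt Pji by (simp add: C_def u)
    then have "l * N + (N - 1) < j * N + i" using mono by (meson not_le)
    show "l \<in> {..<j}"
    proof (rule ccontr)
      assume "l \<notin> {..<j}"
      then have "j * N \<le> l * N" by simp
      with \<open>l * N + (N - 1) < j * N + i\<close> i show False by linarith
    qed
  qed
  then have finC: "finite C" using finite_subset by blast
  \<comment> \<open>Pigeonhole: \<open>C\<close> has only \<open>c\<close> elements, so one of the
    \<open>c + 1\<close> indices up to \<open>c\<close> is missing. As update times are monotone,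
    update \<open>c\<close> itself comes after the pull.\<close>
  have "\<exists>l\<le>c. l \<notin> C"
  proof (rule ccontr)
    assume "\<not> (\<exists>l\<le>c. l \<notin> C)"
    then have "{..c} \<subseteq> C" by auto
    then have "card {..c} \<le> c" unfolding c_def by (intro card_mono finC)
    then show False by simp
  qed
  then obtain l0 where l0: "l0 \<le> c" "u l0 > t0" by (auto simp: C_def)
  have uc: "u c > t0"
  proof -
    have "u l0 \<le> u c" unfolding u by (rule mono) (use l0 in simp)
    then show ?thesis using l0 by simp
  qed
  have "real (j - c) \<le> C0 * (q + 2) + 1"
  proof (cases "c < j")
    case False
    then show ?thesis using \<open>0 < C0\<close> q1 by simp
  next
    case True
    \<comment> \<open>From the arrival that completes update \<open>c\<close> to the last one before
      iteration \<open>j\<close>: all of these lie in the window, and there are at least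
      \<open>N\<close> for every missed update but one.\<close>
    define I where "I = {c * N + (N - 1)..<j * N}"
    have win: "t0 < P s \<and> P s \<le> t0 + tmax" if "s \<in> I" for s
      using mono[of "c * N + (N - 1)" s] mono[of s "j * N + i"] that uc u[of c] Pji pt by (auto simp: I_def)
    define S where "S w = {k. (w, k) \<in> arr ` I}" for w
    have sub: "arr ` I \<subseteq> (SIGMA w:{..<M}. S w)"
    proof
      fix y assume y: "y \<in> arr ` I"
      then have "fst y < M" using ran by auto
      then show "y \<in> (SIGMA w:{..<M}. S w)" using y by (cases y) (auto simp: S_def)
    qed
    have finS: "finite (S w)" for w
    proof -
      have "S w \<subseteq> snd ` arr ` I" by (auto simp: S_def) (metis image_eqI snd_conv)
      then show ?thesis by (rule finite_subset) (simp add: I_def)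
    qed
    have cS: "real (card (S w)) \<le> q + 2" if "w < M" for w
      unfolding q_def
    proof (rule pushes_in_window_le[OF wt that t finS])
      fix k assume "k \<in> S w"
      then obtain s where "s \<in> I" "arr s = (w, k)" by (auto simp: S_def)
      with win[of s] show "t0 < push w k \<and> push w k \<le> t0 + tmax" by (simp add: P_def)
    qed
    have "card I = card (arr ` I)" using inj by (simp add: card_image inj_on_subset)
    also have "\<dots> \<le> card (SIGMA w:{..<M}. S w)" by (intro card_mono sub finite_SigmaI finS) auto
    also have "\<dots> = (\<Sum>w<M. card (S w))" by (simp add: card_SigmaI finS)
    finally have "real (card I) \<le> (\<Sum>w<M. real (card (S w)))" by (metis of_nat_le_iff of_nat_sum)
    also have "\<dots> \<le> (\<Sum>w<M. q + 2)" by (intro sum_mono cS) auto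
    also have "\<dots> = real M * (q + 2)" by simp
    also have "\<dots> \<le> C0 * real N * (q + 2)" using M q1 by (intro mult_right_mono) auto
    finally have "real (card I) \<le> C0 * real N * (q + 2)" .
    moreover obtain p where p: "j = c + Suc p" using True less_iff_Suc_add by auto
    have "p * N \<le> card I"
    proof -
      have "j * N = c * N + p * N + N" by (simp add: p algebra_simps)
      then show ?thesis using i by (simp add: I_def)
    qed
    then have "real p * real N \<le> real (card I)" by (metis of_nat_le_iff of_nat_mult)
    ultimately have "real p * real N \<le> (C0 * (q + 2)) * real N" by (simp add: mult_ac)
    then have "real p \<le> C0 * (q + 2)" using i by simp
    then show ?thesis by (simp add: p)
  qed
  \<comment> \<open>The floor is at least 1 because \<open>tmin < tmax\<close>, so the additive 2 is
    absorbed by the factor 3.\<close>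
  also have "\<dots> \<le> 3 * (C0 * q + 1)"
  proof -
    have "C0 * 1 \<le> C0 * q" using q1 \<open>0 < C0\<close> by (intro mult_left_mono) auto
    then show ?thesis by (simp add: algebra_simps)
  qed
  finally show ?thesis unfolding dl q_def .
qed

section \<open>Spheres and product measures\<close>

lemma lborel_distr_swap:
  fixes b c :: "'a::euclidean_space"
  assumes bc: "b \<in> Basis" "c \<in> Basis"
  defines "p \<equiv> (\<lambda>d. if d = b then c else if d = c then b else d)"
  defines "T \<equiv> (\<lambda>x. \<Sum>d\<in>Basis. (x \<bullet> p d) *\<^sub>R d)"
  shows "distr lborel borel T = lborel"
proof (rule lborel_eqI[symmetric])
  have T[measurable]: "T \<in> borel_measurable borel" unfolding T_def by measurable
  have pB: "p d \<in> Basis" if "d \<in> Basis" for d using bc that by (auto simp: p_def)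
  have pp: "p (p d) = d" for d by (auto simp: p_def)
  have bij: "bij_betw p Basis Basis" by (rule bij_betw_byWitness[where f'=p]) (auto simp: pp pB)
  have Td: "T x \<bullet> d = x \<bullet> p d" if "d \<in> Basis" for x d
    unfolding T_def using that by (simp add: inner_sum_left inner_Basis if_distrib cong: if_cong)
  fix l u :: 'a assume le: "\<And>b. b \<in> Basis \<Longrightarrow> l \<bullet> b \<le> u \<bullet> b"
  have "T -` box l u = box (T l) (T u)"
  proof (intro set_eqI iffI)
    fix x assume x: "x \<in> T -` box l u"
    show "x \<in> box (T l) (T u)" unfolding mem_box
    proof
      fix d :: 'a assume d: "d \<in> Basis"
      then show "T l \<bullet> d < x \<bullet> d \<and> x \<bullet> d < T u \<bullet> d"
        using x[unfolded vimage_eq mem_box, rule_format, OF pB[OF d]] by (simp add: Td pB pp)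
    qed
  next
    fix x assume x: "x \<in> box (T l) (T u)"
    show "x \<in> T -` box l u" unfolding mem_box vimage_eq
    proof
      fix d :: 'a assume d: "d \<in> Basis"
      then show "l \<bullet> d < T x \<bullet> d \<and> T x \<bullet> d < u \<bullet> d"
        using x[unfolded mem_box, rule_format, OF pB[OF d]] by (simp add: Td pB pp)
    qed
  qed
  then have "emeasure (distr lborel borel T) (box l u) = emeasure lborel (box (T l) (T u))"
    by (simp add: emeasure_distr)
  also have "\<dots> = ennreal (\<Prod>d\<in>Basis. (T u - T l) \<bullet> d)"
    by (subst emeasure_lborel_box) (auto simp: Td le pB)
  also have "(\<Prod>d\<in>Basis. (T u - T l) \<bullet> d) = (\<Prod>d\<in>Basis. (u - l) \<bullet> p d)"
    by (rule prod.cong) (auto simp: Td inner_diff_left)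
  also have "\<dots> = (\<Prod>d\<in>Basis. (u - l) \<bullet> d)" by (rule prod.reindex_bij_betw[OF bij])
  finally show "emeasure (distr lborel borel T) (box l u) = ennreal (\<Prod>b\<in>Basis. (u - l) \<bullet> b)" .
qed simp

lemma lborel_distr_reflect:
  fixes b :: "'a::euclidean_space"
  assumes "b \<in> Basis"
  defines "T \<equiv> (\<lambda>x. \<Sum>d\<in>Basis. ((if d = b then - 1 else 1) * (x \<bullet> d)) *\<^sub>R d)"
  shows "distr lborel borel T = lborel"
proof -
  have "lborel = density (distr lborel borel T) (\<lambda>_. ennreal (\<Prod>d\<in>(Basis::'a set). \<bar>if d = b then - 1 else 1\<bar>))"
    using lborel_affine_euclidean[of "\<lambda>d. if d = b then - 1 else 1" 0] by (simp add: T_def)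
  also have "(\<lambda>_. ennreal (\<Prod>d\<in>(Basis::'a set). \<bar>if d = b then - 1 else 1\<bar>)) = (\<lambda>_ :: 'a. 1)"
  proof -
    have "(\<Prod>d\<in>(Basis::'a set). \<bar>if d = b then - 1 else 1\<bar>) = (1::real)" by (rule prod.neutral) auto
    then show ?thesis by simp
  qed
  finally show ?thesis by (simp add: density_1)
qed

lemma prob_space_unit_ball:
  "prob_space (uniform_measure lborel (ball (0::'a::euclidean_space) 1))"
proof (rule prob_space_uniform_measure)
  show "emeasure lborel (ball (0::'a) 1) \<noteq> 0"
    using content_ball_pos[of 1 "0::'a"] by (auto simp: measure_def)
  show "emeasure lborel (ball (0::'a) 1) \<noteq> \<infinity>"
    using emeasure_lborel_ball_finite[of "0::'a" 1] by simp
qed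

lemma sets_uniform_sphere [simp, measurable_cong]: "sets (uniform_sphere \<rho>) = sets borel"
  by (simp add: uniform_sphere_def)
lemma space_uniform_sphere [simp]: "space (uniform_sphere \<rho>) = UNIV"
  by (simp add: uniform_sphere_def)

lemma prob_space_uniform_sphere: "prob_space (uniform_sphere \<rho> :: 'a::euclidean_space measure)"
  unfolding uniform_sphere_def
  by (rule prob_space.prob_space_distr[OF prob_space_unit_ball]) simp

text \<open>The radial projection fails only at the origin, which it fixes because division by 0
  yields 0; the origin is a null set.\<close>

lemma AE_uniform_sphere_norm: "0 \<le> \<rho> \<Longrightarrow> AE x in uniform_sphere \<rho>. norm (x :: 'a::euclidean_space) = \<rho>"
proof -
  assume "0 \<le> \<rho>"
  have "AE x in lborel. x \<noteq> (0::'a)"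
    by (rule AE_I[of _ _ "{0}"]) auto
  then have "AE x in uniform_measure lborel (ball (0::'a) 1). x \<noteq> 0"
    by (intro AE_uniform_measureI) auto
  then have "AE x in uniform_measure lborel (ball (0::'a) 1). norm ((\<rho> / norm x) *\<^sub>R x) = \<rho>"
    by eventually_elim (use \<open>0 \<le> \<rho>\<close> in auto)
  then show ?thesis unfolding uniform_sphere_def by (subst AE_distr_iff) auto
qed

text \<open>A linear norm-preserving map commutes with the radial projection and preserves the
  ball.\<close>

lemma uniform_sphere_distr:
  fixes T :: "'a::euclidean_space \<Rightarrow> 'a"
  assumes lin: "linear T" and iso: "\<And>x. norm (T x) = norm x" and inv: "distr lborel borel T = lborel"
  shows "distr (uniform_sphere \<rho>) borel T = uniform_sphere \<rho>"
proof -
  let ?U = "uniform_measure lborel (ball (0::'a) 1)"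
  have T[measurable]: "T \<in> borel_measurable borel"
    by (intro borel_measurable_continuous_onI linear_continuous_on linear_conv_bounded_linear[THEN iffD1] lin)
  have U: "distr ?U borel T = ?U"
  proof -
    define f where "f = (\<lambda>x::'a. indicator (ball 0 1) x / emeasure lborel (ball (0::'a) 1))"
    have f[measurable]: "f \<in> borel_measurable borel" unfolding f_def
      by (intro borel_measurable_divide_ennreal borel_measurable_indicator borel_measurable_const) auto
    have fT: "f (T x) = f x" for x by (simp add: f_def indicator_def iso)
    have "distr ?U borel T = distr (density lborel (\<lambda>x. f (T x))) borel T"
      by (simp add: fT) (simp add: f_def uniform_measure_def)
    also have "\<dots> = density (distr lborel borel T) f" by (rule density_distr[symmetric]) auto
    also have "\<dots> = ?U" by (simp add: inv) (simp add: f_def uniform_measure_def)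
    finally show ?thesis .
  qed
  have "distr (uniform_sphere \<rho>) borel T = distr ?U borel (\<lambda>x. T ((\<rho> / norm x) *\<^sub>R x))"
    unfolding uniform_sphere_def by (subst distr_distr) (auto simp: comp_def)
  also have "\<dots> = distr ?U borel (\<lambda>x. (\<rho> / norm (T x)) *\<^sub>R T x)" by (simp add: linear_scale[OF lin] iso)
  also have "\<dots> = distr (distr ?U borel T) borel (\<lambda>x. (\<rho> / norm x) *\<^sub>R x)" by (subst distr_distr) (auto simp: comp_def)
  finally show ?thesis unfolding U uniform_sphere_def .
qed

lemma uniform_sphere_integral_invariant:
  fixes T :: "'a::euclidean_space \<Rightarrow> 'a" and h :: "'a \<Rightarrow> real"
  assumes "linear T" "\<And>x. norm (T x) = norm x" "distr lborel borel T = lborel" and h[measurable]: "h \<in> borel_measurable borel"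
  shows "(\<integral>x. h (T x) \<partial>uniform_sphere \<rho>) = (\<integral>x. h x \<partial>uniform_sphere \<rho>)"
proof -
  have T[measurable]: "T \<in> borel_measurable borel"
    by (intro borel_measurable_continuous_onI linear_continuous_on linear_conv_bounded_linear[THEN iffD1] assms)
  have "(\<integral>x. h x \<partial>uniform_sphere \<rho>) = (\<integral>x. h x \<partial>distr (uniform_sphere \<rho>) borel T)"
    by (simp add: uniform_sphere_distr[OF assms(1-3)])
  also have "\<dots> = (\<integral>x. h (T x) \<partial>uniform_sphere \<rho>)" by (rule integral_distr) (auto simp: measurable_cong_sets[OF sets_uniform_sphere refl])
  finally show ?thesis by simp
qed

lemma uniform_sphere_integrable_inner:
  fixes v w :: "'a::euclidean_space"
  assumes "0 \<le> \<rho>"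
  shows "integrable (uniform_sphere \<rho>) (\<lambda>x. (x \<bullet> v) * (x \<bullet> w))"
proof -
  interpret prob_space "uniform_sphere \<rho> :: 'a measure" by (rule prob_space_uniform_sphere)
  show ?thesis
  proof (rule integrable_const_bound[where B="\<rho> * norm v * (\<rho> * norm w)"])
    show "AE x in uniform_sphere \<rho>. norm ((x \<bullet> v) * (x \<bullet> w)) \<le> \<rho> * norm v * (\<rho> * norm w)"
      using AE_uniform_sphere_norm[OF assms]
    proof eventually_elim
      case (elim x)
      show ?case unfolding norm_mult
        using Cauchy_Schwarz_ineq2[of x v] Cauchy_Schwarz_ineq2[of x w] assms elim by (intro mult_mono) auto
    qed
  qed (simp add: measurable_cong_sets[OF sets_uniform_sphere refl])
qed

text \<open>Isotropy from coordinate symmetries: reflecting one coordinate kills the mixed moments,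
  swapping two coordinates equates the diagonal ones, and these add up to
  \<open>\<rho>\<^sup>2\<close>.\<close>

lemma uniform_sphere_second_moment:
  fixes v :: "'a::euclidean_space"
  assumes \<rho>: "0 \<le> \<rho>"
  shows "(\<integral>x. (x \<bullet> v)\<^sup>2 \<partial>uniform_sphere \<rho>) = \<rho>\<^sup>2 / real DIM('a) * (norm v)\<^sup>2"
proof -
  let ?M = "uniform_sphere \<rho> :: 'a measure"
  interpret prob_space ?M by (rule prob_space_uniform_sphere)
  note int = uniform_sphere_integrable_inner[OF \<rho>]
  have off: "(\<integral>x. (x \<bullet> b) * (x \<bullet> c) \<partial>?M) = 0" if bc: "b \<in> Basis" "c \<in> Basis" "b \<noteq> c" for b c
  proof -
    let ?T = "\<lambda>x::'a. \<Sum>d\<in>Basis. ((if d = b then - 1 else 1) * (x \<bullet> d)) *\<^sub>R d"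
    have Td: "?T x \<bullet> d = (if d = b then - 1 else 1) * (x \<bullet> d)" if "d \<in> Basis" for x d
      using that by (simp add: inner_sum_left inner_Basis if_distrib cong: if_cong)
    have "linear ?T"
      by (rule linearI) (auto simp: inner_add_left algebra_simps sum.distrib scaleR_sum_right intro!: sum.cong)
    moreover have "norm (?T x) = norm x" for x
      unfolding norm_eq_sqrt_inner euclidean_inner[of "?T x" "?T x"] euclidean_inner[of x x]
      by (intro arg_cong[where f=sqrt] sum.cong) (simp_all only: Td, auto)
    ultimately have "(\<integral>x. (?T x \<bullet> b) * (?T x \<bullet> c) \<partial>?M) = (\<integral>x. (x \<bullet> b) * (x \<bullet> c) \<partial>?M)"
      by (intro uniform_sphere_integral_invariant[where h="\<lambda>x. (x \<bullet> b) * (x \<bullet> c)"] lborel_distr_reflect bc) auto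
    then show ?thesis using bc by (simp add: Td)
  qed
  have dg: "(\<integral>x. (x \<bullet> b) * (x \<bullet> b) \<partial>?M) = (\<integral>x. (x \<bullet> c) * (x \<bullet> c) \<partial>?M)" if bc: "b \<in> Basis" "c \<in> Basis" for b c
  proof -
    let ?p = "\<lambda>d. if d = b then c else if d = c then b else d"
    let ?T = "\<lambda>x::'a. \<Sum>d\<in>Basis. (x \<bullet> ?p d) *\<^sub>R d"
    have Td: "?T x \<bullet> d = x \<bullet> ?p d" if "d \<in> Basis" for x d
      using that by (simp add: inner_sum_left inner_Basis if_distrib[where f="\<lambda>y. y * _"] if_distrib[where f="\<lambda>y. _ * y"] cong: if_cong)
    have bij: "bij_betw ?p Basis Basis" by (rule bij_betw_byWitness[where f'="?p"]) (use bc in auto)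
    have "linear ?T"
      by (rule linearI) (auto simp: inner_add_left algebra_simps sum.distrib scaleR_sum_right intro!: sum.cong)
    moreover have "norm (?T x) = norm x" for x
    proof -
      have "(\<Sum>d\<in>Basis. (?T x \<bullet> d) * (?T x \<bullet> d)) = (\<Sum>d\<in>Basis. (x \<bullet> ?p d) * (x \<bullet> ?p d))"
        by (intro sum.cong refl) (simp only: Td)
      also have "\<dots> = (\<Sum>d\<in>Basis. (x \<bullet> d) * (x \<bullet> d))" by (rule sum.reindex_bij_betw[OF bij])
      finally show ?thesis
        unfolding norm_eq_sqrt_inner euclidean_inner[of "?T x" "?T x"] euclidean_inner[of x x] by simp
    qed
    ultimately have "(\<integral>x. (?T x \<bullet> b) * (?T x \<bullet> b) \<partial>?M) = (\<integral>x. (x \<bullet> b) * (x \<bullet> b) \<partial>?M)"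
      by (intro uniform_sphere_integral_invariant[where h="\<lambda>x. (x \<bullet> b) * (x \<bullet> b)"] lborel_distr_swap bc) auto
    moreover have "?T x \<bullet> b = x \<bullet> c" for x using Td[OF bc(1), of x] by simp
    ultimately show ?thesis by simp
  qed
  have diag: "(\<integral>x. (x \<bullet> b) * (x \<bullet> b) \<partial>?M) = \<rho>\<^sup>2 / real DIM('a)" if b: "b \<in> Basis" for b
  proof -
    have "\<rho>\<^sup>2 = (\<integral>x. \<rho>\<^sup>2 \<partial>?M)" using prob_space by simp
    also have "\<dots> = (\<integral>x. (\<Sum>c\<in>Basis. (x \<bullet> c) * (x \<bullet> c)) \<partial>?M)"
    proof (rule integral_cong_AE)
      show "AE x in ?M. \<rho>\<^sup>2 = (\<Sum>c\<in>Basis. (x \<bullet> c) * (x \<bullet> c))"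
        using AE_uniform_sphere_norm[OF \<rho>] by eventually_elim (simp add: euclidean_inner[symmetric] dot_square_norm)
    qed (auto simp: measurable_cong_sets[OF sets_uniform_sphere refl])
    also have "\<dots> = (\<Sum>c\<in>Basis. (\<integral>x. (x \<bullet> c) * (x \<bullet> c) \<partial>?M))" by (intro Bochner_Integration.integral_sum int)
    also have "\<dots> = (\<Sum>c\<in>(Basis::'a set). (\<integral>x. (x \<bullet> b) * (x \<bullet> b) \<partial>?M))" by (intro sum.cong refl dg b)
    finally show ?thesis by simp
  qed
  have "(\<integral>x. (x \<bullet> v)\<^sup>2 \<partial>?M) = (\<integral>x. (\<Sum>b\<in>Basis. \<Sum>c\<in>Basis. (v \<bullet> b) * (v \<bullet> c) * ((x \<bullet> b) * (x \<bullet> c))) \<partial>?M)"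
  proof (intro Bochner_Integration.integral_cong refl)
    fix x :: 'a
    have "x \<bullet> v = (\<Sum>b\<in>Basis. (v \<bullet> b) * (x \<bullet> b))" by (simp add: euclidean_inner[of x v] mult.commute)
    then show "(x \<bullet> v)\<^sup>2 = (\<Sum>b\<in>Basis. \<Sum>c\<in>Basis. (v \<bullet> b) * (v \<bullet> c) * ((x \<bullet> b) * (x \<bullet> c)))"
      unfolding power2_eq_square by (simp only: sum_product) (simp add: mult_ac)
  qed
  also have "\<dots> = (\<Sum>b\<in>Basis. \<Sum>c\<in>Basis. (v \<bullet> b) * (v \<bullet> c) * (\<integral>x. (x \<bullet> b) * (x \<bullet> c) \<partial>?M))"
    by (subst Bochner_Integration.integral_sum, intro Bochner_Integration.integrable_sum integrable_mult_right int)
      (intro sum.cong refl, subst Bochner_Integration.integral_sum, intro integrable_mult_right int, simp)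
  also have "\<dots> = (\<Sum>b\<in>Basis. \<Sum>c\<in>Basis. if c = b then (v \<bullet> b) * (v \<bullet> b) * (\<rho>\<^sup>2 / real DIM('a)) else 0)"
    by (intro sum.cong refl) (auto simp: off diag)
  also have "\<dots> = (\<Sum>b\<in>Basis. (v \<bullet> b) * (v \<bullet> b)) * (\<rho>\<^sup>2 / real DIM('a))"
    by (simp add: sum_distrib_right sum_divide_distrib)
  also have "(\<Sum>b\<in>Basis. (v \<bullet> b) * (v \<bullet> b)) = (norm v)\<^sup>2" by (simp add: euclidean_inner[symmetric] dot_square_norm)
  finally show ?thesis by simp
qed

section \<open>Independence and concentration under product measures\<close>

lemma indep_vars_PiM_coordinates:
  assumes M: "\<And>i. i \<in> I \<Longrightarrow> prob_space (M i)" and "I \<noteq> {}"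
  shows "prob_space.indep_vars (PiM I M) M (\<lambda>i \<omega>. \<omega> i) I"
proof -
  interpret prob_space "PiM I M" by (rule prob_space_PiM[OF M])
  have "distr (PiM I M) (PiM I M) (\<lambda>\<omega>. \<lambda>i\<in>I. \<omega> i) = distr (PiM I M) (PiM I M) (\<lambda>\<omega>. \<omega>)"
    by (rule distr_cong) (auto simp: space_PiM)
  also have "\<dots> = PiM I M" by (rule distr_id)
  also have "\<dots> = PiM I (\<lambda>i. distr (PiM I M) (M i) (\<lambda>\<omega>. \<omega> i))"
    by (intro PiM_cong refl distr_PiM_component[symmetric] M)
  finally show ?thesis by (subst indep_vars_iff_distr_eq_PiM') (use \<open>I \<noteq> {}\<close> in auto)
qed

text \<open>This is conditioning in the form of Fubini: restrictions to disjoint index sets have a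
  product law, so a bound on every section bounds the whole event. In the application
  \<open>A\<close> labels the past samples and \<open>B\<close> the current batch.\<close>

lemma PiM_conditional_bound:
  assumes \<nu>: "prob_space \<nu>" and fin: "finite A" "finite B" and sub: "A \<subseteq> I" "B \<subseteq> I" and AB: "A \<inter> B = {}" and "I \<noteq> {}"
    and bad: "bad \<in> sets (PiM A (\<lambda>_. \<nu>) \<Otimes>\<^sub>M PiM B (\<lambda>_. \<nu>))"
    and le: "\<And>x. x \<in> space (PiM A (\<lambda>_. \<nu>)) \<Longrightarrow>
       measure (PiM B (\<lambda>_. \<nu>)) {y \<in> space (PiM B (\<lambda>_. \<nu>)). (x, y) \<in> bad} \<le> p" and p: "0 \<le> p"
  shows "measure (PiM I (\<lambda>_. \<nu>)) {\<omega> \<in> space (PiM I (\<lambda>_. \<nu>)). (restrict \<omega> A, restrict \<omega> B) \<in> bad} \<le> p"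
proof -
  let ?P = "\<lambda>I. PiM I (\<lambda>_. \<nu>)"
  have restr: "distr (?P I) (?P J) (\<lambda>\<omega>. restrict \<omega> J) = ?P J" if "finite J" "J \<subseteq> I" for J
    by (rule product_prob_space.distr_PiM_restrict_finite[OF product_prob_spaceI that]) (rule \<nu>)
  interpret I: prob_space "?P I" by (intro prob_space_PiM \<nu>)
  interpret A: prob_space "?P A" by (intro prob_space_PiM \<nu>)
  interpret B: prob_space "?P B" by (intro prob_space_PiM \<nu>)
  have mA: "(\<lambda>\<omega>. restrict \<omega> A) \<in> ?P I \<rightarrow>\<^sub>M ?P A" and mB: "(\<lambda>\<omega>. restrict \<omega> B) \<in> ?P I \<rightarrow>\<^sub>M ?P B"
    using sub by (auto intro!: measurable_restrict_subset)
  have "I.indep_var (?P A) (\<lambda>\<omega>. restrict (\<lambda>i. \<omega> i) A) (?P B) (\<lambda>\<omega>. restrict (\<lambda>i. \<omega> i) B)"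
    by (rule I.indep_var_restrict[OF indep_vars_PiM_coordinates AB sub]) (use \<nu> \<open>I \<noteq> {}\<close> in auto)
  then have "distr (?P I) (?P A \<Otimes>\<^sub>M ?P B) (\<lambda>\<omega>. (restrict \<omega> A, restrict \<omega> B)) = ?P A \<Otimes>\<^sub>M ?P B"
    unfolding I.indep_var_distribution_eq using restr fin sub by simp
  then have "emeasure (?P I) {\<omega> \<in> space (?P I). (restrict \<omega> A, restrict \<omega> B) \<in> bad} = emeasure (?P A \<Otimes>\<^sub>M ?P B) bad"
    using emeasure_distr[of "\<lambda>\<omega>. (restrict \<omega> A, restrict \<omega> B)" "?P I" "?P A \<Otimes>\<^sub>M ?P B" bad] bad mA mB
    by (simp add: vimage_def Int_def conj_commute)
  also have "\<dots> = (\<integral>\<^sup>+x. emeasure (?P B) (Pair x -` bad) \<partial>?P A)"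
    by (rule B.emeasure_pair_measure_alt[OF bad])
  also have "\<dots> \<le> (\<integral>\<^sup>+x. ennreal p \<partial>?P A)"
  proof (rule nn_integral_mono)
    fix x assume x: "x \<in> space (?P A)"
    have "Pair x -` bad = {y \<in> space (?P B). (x, y) \<in> bad}"
      using sets.sets_into_space[OF bad] by (auto simp: space_pair_measure)
    then show "emeasure (?P B) (Pair x -` bad) \<le> ennreal p"
      using le[OF x] by (simp add: B.emeasure_eq_measure ennreal_leI)
  qed
  also have "\<dots> = ennreal p" by (simp add: A.emeasure_space_1)
  finally show ?thesis using p by (simp add: I.emeasure_eq_measure)
qed

text \<open>Hoeffding with range \<open>2 * b\<close> and deviation half of the mean. The exponent
  sees only the ratio \<open>m / b\<close>, hence is invariant under scaling of
  \<open>Y\<close>.\<close>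

lemma PiM_average_concentration:
  fixes Y :: "'a \<Rightarrow> real"
  assumes \<nu>: "prob_space \<nu>" and B: "finite B" "B \<noteq> {}" and Y[measurable]: "Y \<in> borel_measurable \<nu>"
    and bd: "AE x in \<nu>. \<bar>Y x\<bar> \<le> b" and b: "0 < b" and m: "(\<integral>x. Y x \<partial>\<nu>) = m" "0 \<le> m"
  shows "measure (PiM B (\<lambda>_. \<nu>)) {y \<in> space (PiM B (\<lambda>_. \<nu>)). (\<Sum>i\<in>B. Y (y i)) \<le> real (card B) * m / 2}
    \<le> exp (- (real (card B) * m\<^sup>2 / (8 * b\<^sup>2)))"
proof -
  let ?P = "PiM B (\<lambda>_. \<nu>)"
  interpret prob_space ?P by (intro prob_space_PiM \<nu>)
  have "indep_vars (\<lambda>_. \<nu>) (\<lambda>i \<omega>. \<omega> i) B" by (rule indep_vars_PiM_coordinates) (use \<nu> B in auto)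
  then have ind: "indep_vars (\<lambda>_. borel) (\<lambda>i y. Y (y i)) B" by (rule indep_vars_compose2) simp
  interpret H: Hoeffding_ineq ?P B "\<lambda>i y. Y (y i)" "\<lambda>_. - b" "\<lambda>_. b" "\<Sum>i\<in>B. expectation (\<lambda>y. Y (y i))"
  proof unfold_locales
    fix i assume "i \<in> B"
    have "AE x in \<nu>. Y x \<in> {- b..b}" using bd by (auto simp: abs_le_iff elim!: AE_mp)
    then show "AE y in ?P. Y (y i) \<in> {- b..b}" by (rule AE_PiM_component[rotated 2]) (use \<nu> \<open>i \<in> B\<close> in auto)
  qed (use B ind in auto)
  have ex: "expectation (\<lambda>y. Y (y i)) = m" if "i \<in> B" for i
  proof -
    have "m = (\<integral>x. Y x \<partial>distr ?P \<nu> (\<lambda>y. y i))" using distr_PiM_component[of B "\<lambda>_. \<nu>" i] \<nu> that m by simp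
    also have "\<dots> = expectation (\<lambda>y. Y (y i))" by (rule integral_distr) (use that in auto)
    finally show ?thesis by simp
  qed
  let ?n = "real (card B)"
  have n: "?n > 0" using B by (simp add: card_gt_0_iff)
  have s: "(\<Sum>i\<in>B. (b - - b)\<^sup>2) = ?n * (4 * b\<^sup>2)" by (simp add: power_mult_distrib)
  have "prob {y \<in> space ?P. (\<Sum>i\<in>B. Y (y i)) \<le> (\<Sum>i\<in>B. expectation (\<lambda>y. Y (y i))) - ?n * m / 2}
     \<le> exp (- 2 * (?n * m / 2)\<^sup>2 / (\<Sum>i\<in>B. (b - - b)\<^sup>2))"
    by (rule H.Hoeffding_ineq_le) (use n b m s in \<open>auto intro!: mult_pos_pos\<close>)
  also have "(\<Sum>i\<in>B. expectation (\<lambda>y. Y (y i))) - ?n * m / 2 = ?n * m / 2" by (simp add: ex)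
  also have "- 2 * (?n * m / 2)\<^sup>2 / (\<Sum>i\<in>B. (b - - b)\<^sup>2) = - (?n * m\<^sup>2 / (8 * b\<^sup>2))"
    unfolding s using n b by (simp add: power2_eq_square field_simps)
  finally show ?thesis .
qed

section \<open>Descent along a sample path\<close>

context lqr
begin

text \<open>The deterministic half of the argument; its last premise is the good event. It evaluates
  the derivative at the current policy even though the estimates use delayed ones, so that the
  summands are one and the same function of fresh samples.\<close>

definition sample_descent :: "real \<Rightarrow> real \<Rightarrow> real \<Rightarrow> real \<Rightarrow> real \<Rightarrow> real \<Rightarrow> real \<Rightarrow> real \<Rightarrow> real \<Rightarrow> bool" where
  "sample_descent \<sigma> \<delta> a \<mu> m r0 \<theta>1 \<theta>2 h0 \<longleftrightarrow> (\<forall>\<epsilon> r \<tau> \<eta> N J T d U z x.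
    0 < \<epsilon> \<longrightarrow> \<epsilon> \<le> cost (x 0) - m \<longrightarrow> x 0 \<in> sub a \<longrightarrow>
    0 < r \<longrightarrow> r < min r0 (\<theta>1 * sqrt \<epsilon>) \<longrightarrow> \<theta>2 * ln (1 / (\<epsilon> * r)) \<le> \<tau> \<longrightarrow>
    0 < \<eta> \<longrightarrow> 1 \<le> T \<longrightarrow> \<eta> * real T \<le> h0 \<longrightarrow> 0 < N \<longrightarrow>
    8 / (\<eta> * \<mu>) * ln ((cost (x 0) - m) / \<epsilon>) \<le> real J \<longrightarrow>
    (\<forall>j<J. \<forall>i<N. d j i \<le> T \<and> norm (U j i) \<le> \<sigma> \<and> norm (z j i) \<le> \<delta>) \<longrightarrow>
    (\<forall>j<J. x (Suc j) = x j - \<eta> *\<^sub>R ((1 / real N) *\<^sub>R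
        (\<Sum>i<N. grad_estimate A B Q R \<tau> r (U j i) (z j i) (x (j - d j i))))) \<longrightarrow>
    (\<forall>j<J. x j \<in> sub a \<longrightarrow> real N * (norm (cost_grad (x j)))\<^sup>2 / 2 \<le>
        (\<Sum>i<N. qform (DP (x j) (U j i)) (z j i) * (cost_grad (x j) \<bullet> U j i))) \<longrightarrow>
    x J \<in> stab \<and> cost (x J) - m \<le> \<epsilon>)"

lemma descent_of_samples:
  assumes \<sigma>: "0 < \<sigma>" and \<delta>: "0 < \<delta>" and \<mu>: "0 < \<mu>" and m: "\<forall>K\<in>stab. m \<le> cost K"
    and dom: "\<forall>K\<in>sub a. cost K - m \<le> 1 / (2 * \<mu>) * (norm (cost_grad K))\<^sup>2"
  shows "\<exists>r0>0. \<exists>\<theta>1>0. \<exists>\<theta>2>0. \<exists>h0>0. sample_descent \<sigma> \<delta> a \<mu> m r0 \<theta>1 \<theta>2 h0"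
proof -
  obtain Ce \<kappa> \<rho>e where ce: "Ce > 0" "\<kappa> > 0" "\<rho>e > 0" "\<And>K U z r \<tau>. K \<in> sub a \<Longrightarrow> 0 < r \<Longrightarrow> r * norm U \<le> \<rho>e \<Longrightarrow> 0 \<le> \<tau> \<Longrightarrow>
     (\<exists>e. grad_estimate A B Q R \<tau> r U z K = (qform (DP K U) z + e) *\<^sub>R U \<and>
        \<bar>e\<bar> \<le> Ce * (norm z)\<^sup>2 * (r * (norm U)\<^sup>2 + exp (- \<kappa> * \<tau>) / r))"
    using grad_estimate_expansion by metis
  obtain \<rho> L where L: "\<rho> > 0" "L > 0" "\<And>K H. K \<in> sub a \<Longrightarrow> norm H \<le> \<rho> \<Longrightarrow>
     K + H \<in> stab \<and> \<bar>cost (K + H) - cost K - cost_grad K \<bullet> H\<bar> \<le> L * (norm H)\<^sup>2"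
    using cost_taylor by metis
  obtain c where c: "c > 0" "\<And>K. K \<in> sub a \<Longrightarrow> (norm (cost_grad K))\<^sup>2 \<le> c * (cost K - m)"
    using cost_grad_self_bound m by metis
  obtain cd where cd: "cd > 0" "\<And>K V. K \<in> sub a \<Longrightarrow> norm (DP K V) \<le> cd * norm (cost_grad K) * norm V"
    using DP_bound by metis
  obtain Ld where Ld: "Ld > 0" "\<And>K H V. K \<in> sub a \<Longrightarrow> K + H \<in> sub a \<Longrightarrow> norm (DP (K + H) V - DP K V) \<le> Ld * norm H * norm V"
    using DP_lipschitz by metis
  \<comment> \<open>One constant serves both the size and the descent estimate: the first summand
    pays for the delay, the second for the size of \<open>DP\<close> in terms of the gap, the third
    for the bias.\<close>
  define C where "C = \<sigma>\<^sup>2 * Ld * \<delta>\<^sup>2 + cd * \<delta>\<^sup>2 * \<sigma>\<^sup>2 * sqrt c + sqrt \<mu>"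
  have C: "C > 0" unfolding C_def using \<sigma> \<delta> \<mu> Ld cd c by (intro add_pos_pos mult_pos_pos) auto
  define c1 where "c1 = 2 * C * sqrt c + 4 * L * C\<^sup>2"
  have c1: "c1 > 0" unfolding c1_def using C L c by (intro add_pos_pos mult_pos_pos) auto
  define b where "b = \<bar>a - m\<bar>"
  \<comment> \<open>The first bound keeps the perturbed policies in the stable neighbourhood; the
    second forces \<open>\<epsilon> * r \<le> 1\<close>, so that the logarithm and hence \<tau> are
    nonnegative.\<close>
  define r0 where "r0 = min (\<rho>e / \<sigma>) (1 / (b + 1))"
  define Be where "Be = \<sigma> * Ce * \<delta>\<^sup>2 * (\<sigma>\<^sup>2 + b\<^sup>2)"
  have Be: "Be > 0" unfolding Be_def using \<sigma> \<delta> ce by (intro mult_pos_pos add_pos_nonneg) auto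
  \<comment> \<open>Calibrated so that the total bias, at most \<open>Be * r\<close>, stays below
    \<open>sqrt \<mu> / 8 * sqrt \<epsilon>\<close>.\<close>
  define \<theta>1 where "\<theta>1 = sqrt \<mu> / (8 * Be)"
  \<comment> \<open>The 2 turns the horizon condition into
    \<open>exp (- \<kappa> * \<tau>) \<le> (\<epsilon> * r)\<^sup>2\<close>; after division by
    \<open>r\<close> the truncation error is still proportional to \<open>r\<close>, like the
    smoothing error.\<close>
  define \<theta>2 where "\<theta>2 = 2 / \<kappa>"
  \<comment> \<open>One entry for each stepsize condition of
    \<open>delayed_descent_converges\<close>.\<close>
  define h0 where "h0 = Min {1, 1 / (4 * c1), \<rho> / (2 * C * sqrt b + 1), sqrt \<mu> / (16 * C\<^sup>2), \<mu> / (32 * L * C\<^sup>2), 1 / \<mu>}"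
  have Cb: "2 * C * sqrt b + 1 > 0" using C by (intro add_nonneg_pos mult_nonneg_nonneg) (auto simp: b_def)
  have h0: "h0 > 0" unfolding h0_def using c1 L C \<mu> Cb by auto
  have h0_le: "h0 \<le> 1" "h0 \<le> 1 / (4 * c1)" "h0 \<le> \<rho> / (2 * C * sqrt b + 1)" "h0 \<le> sqrt \<mu> / (16 * C\<^sup>2)"
     "h0 \<le> \<mu> / (32 * L * C\<^sup>2)" "h0 \<le> 1 / \<mu>"
    unfolding h0_def by (rule Min_le; simp)+
  show ?thesis
    unfolding sample_descent_def
  proof (intro exI conjI allI impI)
    show "r0 > 0" using ce \<sigma> by (auto simp: r0_def b_def intro!: divide_pos_pos)
    show "\<theta>1 > 0" using \<mu> Be by (simp add: \<theta>1_def)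
    show "\<theta>2 > 0" using ce by (simp add: \<theta>2_def)
    show "h0 > 0" by (rule h0)
    fix \<epsilon> r \<tau> \<eta> :: real and N J T :: nat and d :: "nat \<Rightarrow> nat \<Rightarrow> nat" and U :: "nat \<Rightarrow> nat \<Rightarrow> real^'n^'m"
      and z :: "nat \<Rightarrow> nat \<Rightarrow> real^'n" and x :: "nat \<Rightarrow> real^'n^'m"
    assume \<epsilon>: "0 < \<epsilon>" and gap: "\<epsilon> \<le> cost (x 0) - m" and x0: "x 0 \<in> sub a"
      and r: "0 < r" "r < min r0 (\<theta>1 * sqrt \<epsilon>)" and \<tau>: "\<theta>2 * ln (1 / (\<epsilon> * r)) \<le> \<tau>"
      and \<eta>: "0 < \<eta>" and T: "1 \<le> T" and \<eta>T: "\<eta> * real T \<le> h0" and N: "0 < N"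
      and J: "8 / (\<eta> * \<mu>) * ln ((cost (x 0) - m) / \<epsilon>) \<le> real J"
      and smp: "\<forall>j<J. \<forall>i<N. d j i \<le> T \<and> norm (U j i) \<le> \<sigma> \<and> norm (z j i) \<le> \<delta>"
      and step: "\<forall>j<J. x (Suc j) = x j - \<eta> *\<^sub>R ((1 / real N) *\<^sub>R
        (\<Sum>i<N. grad_estimate A B Q R \<tau> r (U j i) (z j i) (x (j - d j i))))"
      and conc: "\<forall>j<J. x j \<in> sub a \<longrightarrow> real N * (norm (cost_grad (x j)))\<^sup>2 / 2 \<le>
        (\<Sum>i<N. qform (DP (x j) (U j i)) (z j i) * (cost_grad (x j) \<bullet> U j i))"
    define G where "G j = (1 / real N) *\<^sub>R (\<Sum>i<N. grad_estimate A B Q R \<tau> r (U j i) (z j i) (x (j - d j i)))" for j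
    have am: "a - m = b" using subD(3)[OF x0] gap \<epsilon> by (simp add: b_def)
    have \<epsilon>b: "\<epsilon> \<le> b" using subD(3)[OF x0] gap am by linarith
    have \<epsilon>r: "\<epsilon> * r \<le> 1"
    proof -
      have "\<epsilon> * r \<le> b * (1 / (b + 1))" using \<epsilon>b \<epsilon> r by (intro mult_mono) (auto simp: r0_def)
      also have "\<dots> \<le> 1" using \<epsilon>b \<epsilon> by (simp add: field_simps)
      finally show ?thesis .
    qed
    have "0 \<le> ln (1 / (\<epsilon> * r))" using \<epsilon>r \<epsilon> r by (simp add: ln_div)
    then have \<tau>0: "0 \<le> \<tau>" using \<tau> ce by (smt (verit) \<theta>2_def divide_nonneg_pos mult_nonneg_nonneg)
    have expb: "exp (- \<kappa> * \<tau>) / r \<le> \<epsilon>\<^sup>2 * r"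
    proof -
      have "\<kappa> * (\<theta>2 * ln (1 / (\<epsilon> * r))) \<le> \<kappa> * \<tau>" using \<tau> ce by (intro mult_left_mono) auto
      then have "- \<kappa> * \<tau> \<le> 2 * ln (\<epsilon> * r)" using ce \<epsilon> r by (simp add: \<theta>2_def ln_div)
      then have "exp (- \<kappa> * \<tau>) \<le> exp (2 * ln (\<epsilon> * r))" by simp
      also have "\<dots> = (\<epsilon> * r)\<^sup>2" using \<epsilon> r exp_of_nat_mult[of 2 "ln (\<epsilon> * r)"] by simp
      finally show ?thesis using r by (simp add: field_simps power2_eq_square)
    qed
    define em where "em = Ce * \<delta>\<^sup>2 * (r * \<sigma>\<^sup>2 + exp (- \<kappa> * \<tau>) / r)"
    have em0: "em \<ge> 0" unfolding em_def using ce r by (intro mult_nonneg_nonneg add_nonneg_nonneg) auto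
    have em: "\<sigma> * em \<le> sqrt \<mu> / 8 * sqrt \<epsilon>"
    proof -
      have "exp (- \<kappa> * \<tau>) / r \<le> b\<^sup>2 * r"
      proof -
        have "\<epsilon>\<^sup>2 * r \<le> b\<^sup>2 * r" using \<epsilon>b \<epsilon> r by (intro mult_right_mono power_mono) auto
        with expb show ?thesis by linarith
      qed
      then have "\<sigma> * em \<le> \<sigma> * (Ce * \<delta>\<^sup>2 * (r * \<sigma>\<^sup>2 + b\<^sup>2 * r))"
        unfolding em_def using \<sigma> ce by (intro mult_left_mono add_left_mono) auto
      also have "\<dots> = Be * r" by (simp add: Be_def algebra_simps)
      also have "\<dots> \<le> Be * (\<theta>1 * sqrt \<epsilon>)" using Be r by (intro mult_left_mono) auto
      finally show ?thesis using Be by (simp add: \<theta>1_def)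
    qed
    have est: "\<exists>e. grad_estimate A B Q R \<tau> r (U j i) (z j i) K = (qform (DP K (U j i)) (z j i) + e) *\<^sub>R U j i \<and> \<bar>e\<bar> \<le> em"
      if "j < J" "i < N" and K: "K \<in> sub a" for j i K
    proof -
      have nU: "norm (U j i) \<le> \<sigma>" and nz: "norm (z j i) \<le> \<delta>" using smp that by auto
      have "r * norm (U j i) \<le> r0 * \<sigma>" using r nU by (intro mult_mono) auto
      also have "\<dots> \<le> (\<rho>e / \<sigma>) * \<sigma>" using \<sigma> by (intro mult_right_mono) (auto simp: r0_def)
      finally have "r * norm (U j i) \<le> \<rho>e" using \<sigma> by simp
      from ce(4)[OF K r(1) this \<tau>0, of "z j i"] obtain e where
        e: "grad_estimate A B Q R \<tau> r (U j i) (z j i) K = (qform (DP K (U j i)) (z j i) + e) *\<^sub>R U j i"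
        "\<bar>e\<bar> \<le> Ce * (norm (z j i))\<^sup>2 * (r * (norm (U j i))\<^sup>2 + exp (- \<kappa> * \<tau>) / r)" by blast
      note e(2)
      also have "Ce * (norm (z j i))\<^sup>2 * (r * (norm (U j i))\<^sup>2 + exp (- \<kappa> * \<tau>) / r) \<le> em"
        unfolding em_def using ce r nU nz
        by (intro mult_mono mult_left_mono add_mono power_mono) (auto intro!: add_nonneg_nonneg)
      finally show ?thesis using e(1) by blast
    qed
    have qf: "\<bar>qform Y (z j i)\<bar> \<le> norm Y * \<delta>\<^sup>2" if "j < J" "i < N" for Y j i
    proof -
      have "norm (z j i) \<le> \<delta>" using smp that by auto
      then have "norm Y * (norm (z j i))\<^sup>2 \<le> norm Y * \<delta>\<^sup>2" by (intro mult_left_mono power_mono) auto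
      with abs_qform_le[of Y "z j i"] show ?thesis by linarith
    qed
    have sqrt_b: "sqrt (a - m) = sqrt b" by (simp add: am)
    have T1: "real T \<ge> 1" using T by simp
    have \<eta>h: "\<eta> \<le> h0"
    proof -
      have "\<eta> * 1 \<le> \<eta> * real T" using \<eta> T1 by (intro mult_left_mono) auto
      with \<eta>T show ?thesis by simp
    qed
    have avg: "norm ((1 / real N) *\<^sub>R (\<Sum>i<N. v i)) \<le> X" if "\<And>i. i < N \<Longrightarrow> norm (v i) \<le> X" for v :: "nat \<Rightarrow> real^'n^'m" and X
    proof -
      have "norm (\<Sum>i<N. v i) \<le> (\<Sum>i<N. X)" by (intro sum_norm_le) (use that in auto)
      then show ?thesis using N by (simp add: field_simps)
    qed
    have "x J \<in> stab \<and> cost (x J) \<le> a \<and> cost (x J) - m \<le> max \<epsilon> ((1 - \<eta> * \<mu> / 4) ^ J * (cost (x 0) - m))"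
    proof (rule delayed_descent_converges[where f=cost and g=cost_grad and x=x and G=G and Z=stab and N=N and d=d
          and T=T and \<rho>=\<rho> and L=L and c=c and C=C and e="\<sigma> * em" and \<epsilon>=\<epsilon> and \<eta>=\<eta> and \<mu>=\<mu> and a=a and m=m and ?c1.0=c1])
      show "x 0 \<in> stab" "cost (x 0) \<le> a" using subD[OF x0] by auto
      show "\<And>j. j < J \<Longrightarrow> x (Suc j) = x j - \<eta> *\<^sub>R G j" using step by (auto simp: G_def)
      show "\<And>j i. j < J \<Longrightarrow> i < N \<Longrightarrow> d j i \<le> T" using smp by auto
      show "\<And>y h. y \<in> stab \<Longrightarrow> cost y \<le> a \<Longrightarrow> norm h \<le> \<rho> \<Longrightarrow>
         y + h \<in> stab \<and> \<bar>cost (y + h) - cost y - cost_grad y \<bullet> h\<bar> \<le> L * (norm h)\<^sup>2"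
        using L(3) by (auto simp: sub_def)
      show "\<And>y. y \<in> stab \<Longrightarrow> cost y \<le> a \<Longrightarrow> (norm (cost_grad y))\<^sup>2 \<le> c * (cost y - m)"
        using c(2) by (auto simp: sub_def)
      show "\<And>y. y \<in> stab \<Longrightarrow> cost y \<le> a \<Longrightarrow> cost y - m \<le> 1 / (2 * \<mu>) * (norm (cost_grad y))\<^sup>2"
        using dom by (auto simp: sub_def)
      show "norm (G j) \<le> C * X" if "j < J" "0 \<le> X" and X: "\<And>i. i < N \<Longrightarrow> x (j - d j i) \<in> stab \<and> cost (x (j - d j i)) \<le> a \<and>
           max (cost (x (j - d j i)) - m) \<epsilon> \<le> X\<^sup>2" for j X
        unfolding G_def
      proof (rule avg)
        fix i assume i: "i < N"
        let ?K = "x (j - d j i)"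
        have K: "?K \<in> sub a" using X[OF i] by (simp add: sub_def)
        have nU: "norm (U j i) \<le> \<sigma>" using smp that i by auto
        obtain e where e: "grad_estimate A B Q R \<tau> r (U j i) (z j i) ?K = (qform (DP ?K (U j i)) (z j i) + e) *\<^sub>R U j i" "\<bar>e\<bar> \<le> em"
          using est[OF \<open>j < J\<close> i K] by blast
        have "\<epsilon> \<le> X\<^sup>2" using X[OF i] by simp
        then have "sqrt \<epsilon> \<le> X" using \<open>0 \<le> X\<close> by (simp add: real_le_lsqrt)
        have "(norm (cost_grad ?K))\<^sup>2 \<le> c * X\<^sup>2"
          using c(2)[OF K] X[OF i] mult_left_mono[of "cost ?K - m" "X\<^sup>2" c] c(1) by linarith
        also have "\<dots> = (sqrt c * X)\<^sup>2" using c(1) by (simp add: power_mult_distrib)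
        finally have ng: "norm (cost_grad ?K) \<le> sqrt c * X"
          by (rule power2_le_imp_le) (use c \<open>0 \<le> X\<close> in auto)
        have "\<bar>qform (DP ?K (U j i)) (z j i)\<bar> \<le> norm (DP ?K (U j i)) * \<delta>\<^sup>2" by (rule qf[OF \<open>j < J\<close> i])
        also have "\<dots> \<le> (cd * norm (cost_grad ?K) * norm (U j i)) * \<delta>\<^sup>2" by (intro mult_right_mono cd K) auto
        also have "\<dots> \<le> (cd * (sqrt c * X) * \<sigma>) * \<delta>\<^sup>2"
          using cd ng nU \<open>0 \<le> X\<close> c by (intro mult_right_mono mult_mono mult_left_mono) auto
        finally have "\<bar>qform (DP ?K (U j i)) (z j i) + e\<bar> \<le> cd * (sqrt c * X) * \<sigma> * \<delta>\<^sup>2 + em" using e(2) by linarith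
        then have "\<bar>qform (DP ?K (U j i)) (z j i) + e\<bar> * norm (U j i) \<le> (cd * (sqrt c * X) * \<sigma> * \<delta>\<^sup>2 + em) * \<sigma>"
          using nU \<sigma> by (intro mult_mono) auto
        also have "\<dots> = cd * \<delta>\<^sup>2 * \<sigma>\<^sup>2 * sqrt c * X + \<sigma> * em" by (simp add: power2_eq_square algebra_simps)
        also have "\<sigma> * em \<le> sqrt \<mu> * X"
        proof -
          have "sqrt \<mu> / 8 * sqrt \<epsilon> \<le> sqrt \<mu> * X" using \<open>sqrt \<epsilon> \<le> X\<close> \<mu> \<epsilon> by (intro mult_mono) auto
          with em show ?thesis by linarith
        qed
        also have "cd * \<delta>\<^sup>2 * \<sigma>\<^sup>2 * sqrt c * X + sqrt \<mu> * X \<le> C * X"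
        proof -
          have "0 \<le> \<sigma>\<^sup>2 * Ld * \<delta>\<^sup>2 * X" using Ld \<open>0 \<le> X\<close> by simp
          then show ?thesis by (simp add: C_def algebra_simps)
        qed
        finally show "norm (grad_estimate A B Q R \<tau> r (U j i) (z j i) ?K) \<le> C * X" by (simp add: e(1))
      qed
      show "1 / 2 * (norm (cost_grad (x j)))\<^sup>2 - norm (cost_grad (x j)) * (C * Y + \<sigma> * em) \<le> cost_grad (x j) \<bullet> G j"
        if "j < J" "0 \<le> Y" "Y \<le> \<rho>" and xj: "x j \<in> stab" "cost (x j) \<le> a" and
         Y: "\<And>i. i < N \<Longrightarrow> x (j - d j i) \<in> stab \<and> cost (x (j - d j i)) \<le> a \<and> norm (x (j - d j i) - x j) \<le> Y" for j Y
      proof -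
        let ?g = "cost_grad (x j)"
        have xs: "x j \<in> sub a" using xj by (simp add: sub_def)
        have term_le: "qform (DP (x j) (U j i)) (z j i) * (?g \<bullet> U j i) - norm ?g * (C * Y + \<sigma> * em) \<le>
           ?g \<bullet> grad_estimate A B Q R \<tau> r (U j i) (z j i) (x (j - d j i))" if i: "i < N" for i
        proof -
          let ?K = "x (j - d j i)"
          have K: "?K \<in> sub a" using Y[OF i] by (simp add: sub_def)
          have nU: "norm (U j i) \<le> \<sigma>" using smp \<open>j < J\<close> i by auto
          obtain e where e: "grad_estimate A B Q R \<tau> r (U j i) (z j i) ?K = (qform (DP ?K (U j i)) (z j i) + e) *\<^sub>R U j i" "\<bar>e\<bar> \<le> em"
            using est[OF \<open>j < J\<close> i K] by blast
          \<comment> \<open>The change of derivative from the current to the delayed policy; it is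
            treated as an error like \<open>e\<close>, so that the concentration premise can be used
            at the current policy.\<close>
          define D1 where "D1 = DP ?K (U j i) - DP (x j) (U j i)"
          have "norm D1 \<le> Ld * norm (?K - x j) * norm (U j i)"
            unfolding D1_def using Ld(2)[OF xs, of "?K - x j" "U j i"] K by simp
          also have "\<dots> \<le> Ld * Y * \<sigma>" using Y[OF i] nU Ld \<open>0 \<le> Y\<close> by (intro mult_mono) auto
          finally have "norm D1 * \<delta>\<^sup>2 \<le> Ld * Y * \<sigma> * \<delta>\<^sup>2" by (intro mult_right_mono) auto
          then have q1: "\<bar>qform D1 (z j i) + e\<bar> \<le> Ld * Y * \<sigma> * \<delta>\<^sup>2 + em" using qf[OF \<open>j < J\<close> i, of D1] e(2) by linarith
          have gU: "\<bar>?g \<bullet> U j i\<bar> \<le> norm ?g * \<sigma>"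
            using Cauchy_Schwarz_ineq2[of ?g "U j i"] mult_left_mono[OF nU, of "norm ?g"] by simp
          have "\<bar>(qform D1 (z j i) + e) * (?g \<bullet> U j i)\<bar> \<le> (Ld * Y * \<sigma> * \<delta>\<^sup>2 + em) * (norm ?g * \<sigma>)"
            unfolding abs_mult using q1 gU by (intro mult_mono) auto
          also have "\<dots> = norm ?g * ((\<sigma>\<^sup>2 * Ld * \<delta>\<^sup>2) * Y + \<sigma> * em)" by (simp add: power2_eq_square algebra_simps)
          also have "\<dots> \<le> norm ?g * (C * Y + \<sigma> * em)"
          proof (intro mult_left_mono add_right_mono mult_right_mono)
            have "0 \<le> cd * \<delta>\<^sup>2 * \<sigma>\<^sup>2 * sqrt c + sqrt \<mu>" using cd c \<mu> by (intro add_nonneg_nonneg mult_nonneg_nonneg) auto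
            then show "\<sigma>\<^sup>2 * Ld * \<delta>\<^sup>2 \<le> C" by (simp add: C_def)
          qed (use \<open>0 \<le> Y\<close> in auto)
          finally have "- (norm ?g * (C * Y + \<sigma> * em)) \<le> (qform D1 (z j i) + e) * (?g \<bullet> U j i)" by linarith
          moreover have "?g \<bullet> grad_estimate A B Q R \<tau> r (U j i) (z j i) ?K =
             qform (DP (x j) (U j i)) (z j i) * (?g \<bullet> U j i) + (qform D1 (z j i) + e) * (?g \<bullet> U j i)"
            unfolding e(1) D1_def qform_diff by (simp add: algebra_simps)
          ultimately show ?thesis by linarith
        qed
        have "real N * (norm ?g)\<^sup>2 / 2 - real N * (norm ?g * (C * Y + \<sigma> * em)) \<le>
           (\<Sum>i<N. qform (DP (x j) (U j i)) (z j i) * (?g \<bullet> U j i) - norm ?g * (C * Y + \<sigma> * em))"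
          using conc \<open>j < J\<close> xs by (simp add: sum_subtractf)
        also have "\<dots> \<le> (\<Sum>i<N. ?g \<bullet> grad_estimate A B Q R \<tau> r (U j i) (z j i) (x (j - d j i)))"
          by (intro sum_mono term_le) auto
        also have "\<dots> = real N * (?g \<bullet> G j)" using N by (simp add: G_def inner_sum_right)
        finally have "real N * (1 / 2 * (norm ?g)\<^sup>2 - norm ?g * (C * Y + \<sigma> * em)) \<le> real N * (?g \<bullet> G j)"
          by (simp add: algebra_simps)
        then show ?thesis using N by simp
      qed
      show "c1 = 2 * C * sqrt c + 4 * L * C\<^sup>2" by (rule c1_def)
      show "\<eta> \<le> 1" using \<eta>h h0_le by linarith
      have "\<eta> * real T \<le> 1 / (4 * c1)" using \<eta>T h0_le by linarith
      then show "4 * real T * c1 * \<eta> \<le> 1" using c1 by (simp add: field_simps)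
      have "\<eta> * real T * (2 * C * sqrt b) \<le> \<eta> * real T * (2 * C * sqrt b + 1)" using \<eta> by (intro mult_left_mono) auto
      also have "\<dots> \<le> \<rho> / (2 * C * sqrt b + 1) * (2 * C * sqrt b + 1)"
        using \<eta>T h0_le Cb by (intro mult_right_mono) auto
      also have "\<dots> = \<rho>" using Cb by simp
      finally show "2 * C * real T * \<eta> * sqrt (a - m) \<le> \<rho>" unfolding sqrt_b by (simp add: mult_ac)
      have "\<eta> * real T \<le> sqrt \<mu> / (16 * C\<^sup>2)" using \<eta>T h0_le by linarith
      then show "2 * C\<^sup>2 * real T * \<eta> \<le> sqrt \<mu> / 8" using C by (simp add: field_simps)
      show "\<sigma> * em \<le> sqrt \<mu> / 8 * sqrt \<epsilon>" by (rule em)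
      have "\<eta> \<le> \<mu> / (32 * L * C\<^sup>2)" using \<eta>h h0_le by linarith
      then show "32 * L * C\<^sup>2 * \<eta> \<le> \<mu>" using C L by (simp add: field_simps)
      have "\<eta> \<le> 1 / \<mu>" using \<eta>h h0_le by linarith
      then show "\<eta> * \<mu> \<le> 1" using \<mu> by (simp add: field_simps)
    qed (use \<epsilon> \<eta> \<mu> L C c em0 \<sigma> T gap in auto)
    \<comment> \<open>The guaranteed rate is \<open>\<eta> * \<mu> / 4\<close> per step, so
      \<open>8 / (\<eta> * \<mu>)\<close> times the logarithm gives twice the exponent that is
      required.\<close>
    moreover have "(1 - \<eta> * \<mu> / 4) ^ J * (cost (x 0) - m) \<le> \<epsilon>"
    proof -
      let ?\<Delta> = "cost (x 0) - m"
      have \<Delta>: "?\<Delta> > 0" "?\<Delta> \<ge> \<epsilon>" using gap \<epsilon> by auto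
      have "\<eta> \<le> 1 / \<mu>" using \<eta>h h0_le by linarith
      then have "\<eta> * \<mu> \<le> 1" using \<mu> by (simp add: field_simps)
      then have "(1 - \<eta> * \<mu> / 4) ^ J \<le> exp (- (\<eta> * \<mu> / 4)) ^ J"
        using exp_ge_add_one_self[of "- (\<eta> * \<mu> / 4)"] by (intro power_mono) auto
      also have "\<dots> = exp (- (\<eta> * \<mu> / 4 * real J))" by (simp add: exp_of_nat_mult[symmetric] mult_ac)
      also have "\<dots> \<le> exp (- ln (?\<Delta> / \<epsilon>))"
      proof -
        have l0: "0 \<le> ln (?\<Delta> / \<epsilon>)" using \<Delta> \<epsilon> by simp
        have "\<eta> * \<mu> / 4 * (8 / (\<eta> * \<mu>) * ln (?\<Delta> / \<epsilon>)) \<le> \<eta> * \<mu> / 4 * real J"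
          using J \<eta> \<mu> by (intro mult_left_mono) auto
        then have "2 * ln (?\<Delta> / \<epsilon>) \<le> \<eta> * \<mu> / 4 * real J" using \<eta> \<mu> by simp
        with l0 show ?thesis by simp
      qed
      also have "\<dots> = \<epsilon> / ?\<Delta>" using \<Delta> \<epsilon> by (simp add: exp_minus)
      finally have "(1 - \<eta> * \<mu> / 4) ^ J * ?\<Delta> \<le> \<epsilon> / ?\<Delta> * ?\<Delta>" using \<Delta> by (intro mult_right_mono) auto
      then show ?thesis using \<Delta> by simp
    qed
    ultimately show "x J \<in> stab" "cost (x J) - m \<le> \<epsilon>" by auto
  qed
qed

end

section \<open>Measurability and concentration\<close>

lemma continuous_on_matrix_vector_mult:
  fixes f :: "'a::topological_space \<Rightarrow> real^'n^'m"
  assumes "continuous_on S f" "continuous_on S g"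
  shows "continuous_on S (\<lambda>x. f x *v g x)"
  unfolding matrix_vector_mult_def by (intro continuous_intros assms)

lemma continuous_on_matrix_mult:
  fixes f :: "'a::topological_space \<Rightarrow> real^'n^'m" and g :: "'a \<Rightarrow> real^'k^'n"
  assumes "continuous_on S f" "continuous_on S g"
  shows "continuous_on S (\<lambda>x. f x ** g x)"
  unfolding matrix_matrix_mult_def by (intro continuous_intros assms)

lemma borel_measurable_matrix_vector_mult [measurable (raw)]:
  fixes f :: "'a \<Rightarrow> real^'n^'m"
  assumes [measurable]: "f \<in> borel_measurable M" "g \<in> borel_measurable M"
  shows "(\<lambda>x. f x *v g x) \<in> borel_measurable M"
proof -
  have "(\<lambda>p :: (real^'n^'m) \<times> (real^'n). fst p *v snd p) \<in> borel_measurable (borel \<Otimes>\<^sub>M borel)"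
    unfolding borel_prod by (intro borel_measurable_continuous_onI continuous_on_matrix_vector_mult continuous_intros)
  from measurable_compose[OF measurable_Pair[OF assms] this] show ?thesis by simp
qed

lemma borel_measurable_flow' [measurable (raw)]:
  fixes F :: "'a \<Rightarrow> real^'n^'n"
  assumes [measurable]: "F \<in> borel_measurable M" "z \<in> borel_measurable M" "t \<in> borel_measurable M"
  shows "(\<lambda>x. flow (F x) (z x) (t x)) \<in> borel_measurable M"
proof -
  have "(\<lambda>(F, z, t). flow F z t) \<in> borel_measurable (borel \<Otimes>\<^sub>M (borel \<Otimes>\<^sub>M borel) :: ((real^'n^'n) \<times> (real^'n) \<times> real) measure)"
    unfolding borel_prod by (rule borel_measurable_flow)
  from measurable_compose[OF _ this, of "\<lambda>x. (F x, z x, t x)" M] show ?thesis by simp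
qed

lemma borel_measurable_closed_loop [measurable (raw)]:
  fixes B :: "real^'m^'n"
  assumes [measurable]: "K \<in> borel_measurable M" "z \<in> borel_measurable M" "t \<in> borel_measurable M"
  shows "(\<lambda>x. closed_loop A B (K x) (z x) (t x)) \<in> borel_measurable M"
proof -
  have [measurable]: "(\<lambda>K. A - B ** K) \<in> borel_measurable borel"
    by (intro borel_measurable_continuous_onI continuous_intros continuous_on_matrix_mult)
  show ?thesis unfolding closed_loop_eq_flow by measurable
qed

lemma continuous_on_closed_loop: "continuous_on S (closed_loop A B K z)"
  unfolding closed_loop_eq_flow
  by (intro continuous_at_imp_continuous_on ballI has_vector_derivative_continuous[OF flow_has_vector_derivative])

text \<open>The cost is defined by a gauge integral; measurability in a parameter is available for
  the Lebesgue integral.\<close>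

lemma finite_cost_eq_lebesgue:
  "finite_cost A B Q R \<tau> z K = (\<integral>t. indicator {0..\<tau>} t *\<^sub>R
     (let x = closed_loop A B K z t; u = - (K *v x) in x \<bullet> (Q *v x) + u \<bullet> (R *v u)) \<partial>lborel)"
proof -
  have "set_integrable lborel {0..\<tau>} (\<lambda>t. let x = closed_loop A B K z t; u = - (K *v x) in x \<bullet> (Q *v x) + u \<bullet> (R *v u))"
    unfolding set_integrable_def Let_def
    by (intro borel_integrable_compact continuous_intros continuous_on_matrix_vector_mult continuous_on_closed_loop) auto
  from set_borel_integral_eq_integral(2)[OF this] show ?thesis
    unfolding finite_cost_def set_lebesgue_integral_def by simp
qed

lemma borel_measurable_finite_cost [measurable (raw)]:
  fixes K :: "'a \<Rightarrow> real^'n^'m"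
  assumes [measurable]: "K \<in> borel_measurable M" "z \<in> borel_measurable M"
  shows "(\<lambda>x. finite_cost A B Q R \<tau> (z x) (K x)) \<in> borel_measurable M"
  unfolding finite_cost_eq_lebesgue Let_def by measurable

lemma borel_measurable_grad_estimate [measurable (raw)]:
  fixes K :: "'a \<Rightarrow> real^'n^'m"
  assumes [measurable]: "K \<in> borel_measurable M" "z \<in> borel_measurable M" "U \<in> borel_measurable M"
  shows "(\<lambda>x. grad_estimate A B Q R \<tau> r (U x) (z x) (K x)) \<in> borel_measurable M"
  unfolding grad_estimate_def by measurable

text \<open>Iterate \<open>j\<close> reads samples of earlier iterations only, so it lives on the
  product over any index set containing their labels; this is what separates past and present. The
  induction is strong because delays reach back.\<close>

lemma delayed_descent_measurable:
  fixes Gf :: "'s \<Rightarrow> 'a \<Rightarrow> 'a::euclidean_space"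
  assumes Gf: "(\<lambda>(s, K). Gf s K) \<in> borel_measurable (\<nu> \<Otimes>\<^sub>M borel)"
    and idx: "\<And>j' i. j' < j \<Longrightarrow> i < N \<Longrightarrow> idx j' i \<in> A"
  shows "(\<lambda>\<omega>. delayed_descent K0 \<eta> N d (\<lambda>j i K. Gf (\<omega> (idx j i)) K) j) \<in> borel_measurable (PiM A (\<lambda>_. \<nu>))"
  using idx
proof (induction j rule: less_induct)
  case (less j)
  show ?case
  proof (cases j)
    case (Suc k)
    let ?x = "\<lambda>\<omega>. delayed_descent K0 \<eta> N d (\<lambda>j i K. Gf (\<omega> (idx j i)) K)"
    have IH: "(\<lambda>\<omega>. ?x \<omega> l) \<in> borel_measurable (PiM A (\<lambda>_. \<nu>))" if "l \<le> k" for l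
      using less.IH[of l] less.prems that Suc by simp
    have "(\<lambda>\<omega>. Gf (\<omega> (idx k i)) (?x \<omega> (k - d k i))) \<in> borel_measurable (PiM A (\<lambda>_. \<nu>))" if "i < N" for i
    proof -
      have "(\<lambda>\<omega>. (\<omega> (idx k i), ?x \<omega> (k - d k i))) \<in> PiM A (\<lambda>_. \<nu>) \<rightarrow>\<^sub>M \<nu> \<Otimes>\<^sub>M borel"
        using less.prems[of k i] Suc that by (intro measurable_Pair IH measurable_component_singleton) auto
      from measurable_compose[OF this Gf] show ?thesis by simp
    qed
    then show ?thesis unfolding Suc delayed_descent.simps
      by (intro borel_measurable_diff borel_measurable_scaleR borel_measurable_const borel_measurable_sum IH) auto
  qed simp
qed

lemma delayed_descent_cong:
  assumes "\<And>j' i K. j' < j \<Longrightarrow> i < N \<Longrightarrow> G j' i K = G' j' i K"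
  shows "delayed_descent K0 \<eta> N d G j = delayed_descent K0 \<eta> N d G' j"
  using assms
proof (induction j rule: less_induct)
  case (less j)
  show ?case
  proof (cases j)
    case (Suc k)
    have IH: "delayed_descent K0 \<eta> N d G l = delayed_descent K0 \<eta> N d G' l" if "l \<le> k" for l
      using less.IH[of l] less.prems that Suc by simp
    show ?thesis unfolding Suc delayed_descent.simps using less.prems Suc by (simp add: IH)
  qed simp
qed

text \<open>The second moments are 1 on the diagonal and 0 elsewhere, so only the trace survives;
  bounded support supplies integrability.\<close>

lemma integral_qform_eq_trace:
  fixes D :: "(real^'n) measure"
  assumes "prob_space D" and setsD[measurable_cong]: "sets D = sets borel" and sm: "second_moment D = mat 1"
    and bd: "AE z in D. norm z \<le> \<delta>"
  shows "(\<integral>z. qform Y z \<partial>D) = trace Y" and "integrable D (qform Y)"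
proof -
  interpret prob_space D by fact
  have comp: "(\<lambda>z. z $ i) \<in> borel_measurable D" for i
    by (rule measurable_compose[OF _ borel_measurable_continuous_onI[of "\<lambda>z. z $ i"]])
      (auto intro!: continuous_intros simp: measurable_cong_sets[OF setsD refl])
  have int: "integrable D (\<lambda>z. z $ i * z $ j)" for i j
  proof (rule integrable_const_bound[where B="\<delta> * \<delta>"])
    show "AE z in D. norm (z $ i * z $ j) \<le> \<delta> * \<delta>"
      using bd
    proof eventually_elim
      case (elim z)
      have "\<bar>z $ i\<bar> \<le> \<delta>" "\<bar>z $ j\<bar> \<le> \<delta>" "0 \<le> \<delta>"
        using component_le_norm_cart[of z i] component_le_norm_cart[of z j] elim norm_ge_zero[of z] by linarith+
      then show ?case by (simp add: abs_mult mult_mono)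
    qed
  qed (intro borel_measurable_times comp)
  have E: "(\<integral>z. z $ i * z $ j \<partial>D) = (if i = j then 1 else 0)" for i j
    using arg_cong[OF sm, of "\<lambda>X. X $ i $ j"] by (simp add: second_moment_def mat_def)
  have eq: "qform Y = (\<lambda>z. \<Sum>i\<in>UNIV. \<Sum>j\<in>UNIV. Y $ i $ j * (z $ i * z $ j))"
    by (auto simp: fun_eq_iff qform_def inner_vec_def matrix_vector_mult_def sum_distrib_left mult_ac)
  show "integrable D (qform Y)" unfolding eq
    by (intro Bochner_Integration.integrable_sum integrable_mult_right int)
  have "(\<integral>z. qform Y z \<partial>D) = (\<Sum>i\<in>UNIV. \<Sum>j\<in>UNIV. Y $ i $ j * (\<integral>z. z $ i * z $ j \<partial>D))"
    unfolding eq by (subst Bochner_Integration.integral_sum, intro Bochner_Integration.integrable_sum integrable_mult_right int)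
      (intro sum.cong refl, subst Bochner_Integration.integral_sum, intro integrable_mult_right int, simp)
  also have "\<dots> = trace Y" by (simp add: E trace_def if_distrib cong: if_cong)
  finally show "(\<integral>z. qform Y z \<partial>D) = trace Y" .
qed

context lqr
begin

text \<open>
  Outside the sublevel set the derivative is replaced by 0, which makes it a Borel function of the
  policy and turns the concentration inequality there into the trivial \<open>0 \<le> 0\<close>.
\<close>

definition DP_on :: "real \<Rightarrow> real^'n^'m \<Rightarrow> real^'n^'m \<Rightarrow> real^'n^'n" where
  "DP_on a K U = (\<Sum>b\<in>Basis. (U \<bullet> b) *\<^sub>R (indicator (sub a) K *\<^sub>R DP K b))"

definition grad_on :: "real \<Rightarrow> real^'n^'m \<Rightarrow> real^'n^'m" where
  "grad_on a K = (\<Sum>b\<in>Basis. trace (indicator (sub a) K *\<^sub>R DP K b) *\<^sub>R b)"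

text \<open>Inner product with the gradient of the leading part
  \<open>qform (DP K U) z *\<^sub>R U\<close> of an estimate.\<close>

definition correlation :: "real \<Rightarrow> real^'n^'m \<Rightarrow> (real^'n^'m) \<times> (real^'n) \<Rightarrow> real" where
  "correlation a K s = qform (DP_on a K (fst s)) (snd s) * (grad_on a K \<bullet> fst s)"

lemma DP_on_eq: "K \<in> sub a \<Longrightarrow> DP_on a K U = DP K U"
proof -
  assume K: "K \<in> sub a"
  note lin = DP_linear[OF subD(1)[OF K]]
  have "DP K U = DP K (\<Sum>b\<in>Basis. (U \<bullet> b) *\<^sub>R b)" by (simp add: euclidean_representation)
  also have "\<dots> = (\<Sum>b\<in>Basis. (U \<bullet> b) *\<^sub>R DP K b)"
    using linear_sum[OF lin, of "\<lambda>b. (U \<bullet> b) *\<^sub>R b" Basis] linear_scale[OF lin] by simp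
  finally show ?thesis using K by (simp add: DP_on_def)
qed

lemma grad_on_eq: "K \<in> sub a \<Longrightarrow> grad_on a K = cost_grad K"
  by (simp add: grad_on_def cost_grad_def)

lemma grad_on_outside: "K \<notin> sub a \<Longrightarrow> grad_on a K = 0"
  by (simp add: grad_on_def)

text \<open>On the closed set \<open>sub a\<close> the derivative is Lipschitz in the policy, hence
  continuous.\<close>

lemma measurable_DP_indicator [measurable]:
  "(\<lambda>K. indicator (sub a) K *\<^sub>R DP K b) \<in> borel_measurable borel"
proof (rule borel_measurable_continuous_on_indicator)
  show "sub a \<in> sets borel" using closed_sub by (rule borel_closed)
  obtain L where L: "L > 0" "\<And>K H V. K \<in> sub a \<Longrightarrow> K + H \<in> sub a \<Longrightarrow> norm (DP (K + H) V - DP K V) \<le> L * norm H * norm V"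
    using DP_lipschitz by metis
  show "continuous_on (sub a) (\<lambda>K. DP K b)"
  proof (rule lipschitz_on_continuous_on)
    show "(L * norm b)-lipschitz_on (sub a) (\<lambda>K. DP K b)"
    proof (rule lipschitz_onI)
      fix K K' assume "K \<in> sub a" "K' \<in> sub a"
      then show "dist (DP K b) (DP K' b) \<le> L * norm b * dist K K'"
        using L(2)[of K' "K - K'" b] by (simp add: dist_norm mult_ac)
    qed (use L in simp)
  qed
qed

lemma measurable_DP_on [measurable (raw)]:
  assumes [measurable]: "K \<in> borel_measurable M" "U \<in> borel_measurable M"
  shows "(\<lambda>x. DP_on a (K x) (U x)) \<in> borel_measurable M"
  unfolding DP_on_def
  by (intro borel_measurable_sum borel_measurable_scaleR borel_measurable_inner measurable_compose[OF assms(1) measurable_DP_indicator]) auto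

lemma measurable_grad_on [measurable (raw)]:
  assumes [measurable]: "K \<in> borel_measurable M"
  shows "(\<lambda>x. grad_on a (K x)) \<in> borel_measurable M"
proof -
  have tr: "trace \<in> borel_measurable (borel :: (real^'n^'n) measure)"
    unfolding trace_def[abs_def] by (intro borel_measurable_continuous_onI continuous_intros)
  show ?thesis
    unfolding grad_on_def
    by (intro borel_measurable_sum borel_measurable_scaleR borel_measurable_const
      measurable_compose[OF measurable_compose[OF assms(1) measurable_DP_indicator] tr])
qed

lemma measurable_correlation [measurable (raw)]:
  assumes [measurable]: "K \<in> borel_measurable M" "U \<in> borel_measurable M" "z \<in> borel_measurable M"
  shows "(\<lambda>x. correlation a (K x) (U x, z x)) \<in> borel_measurable M"
  unfolding correlation_def qform_def fst_conv snd_conv by measurable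

text \<open>Quadratic in the gradient norm, as is the mean, thanks to \<open>DP_bound\<close>. The
  explicit constant for a one-dimensional state keeps the later rate free of the level
  \<open>a\<close> when \<open>mn = 1\<close>.\<close>

lemma correlation_bound:
  assumes "0 \<le> \<delta>"
  shows "\<exists>c>0. (CARD('n) = 1 \<longrightarrow> c = \<delta>\<^sup>2 + 1) \<and> (\<forall>K U z. norm z \<le> \<delta> \<longrightarrow>
     \<bar>correlation a K (U, z)\<bar> \<le> c * (norm (grad_on a K))\<^sup>2 * (norm U)\<^sup>2)"
proof -
  obtain cd where cd: "cd > 0" "\<And>K V. K \<in> sub a \<Longrightarrow> norm (DP K V) \<le> cd * norm (cost_grad K) * norm V"
    using DP_bound by metis
  \<comment> \<open>For a scalar state the form of \<open>DP K U\<close> at \<open>z\<close> is the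
    squared norm of \<open>z\<close> times the directional derivative of the cost, so no constant
    from the sublevel set enters.\<close>
  define c where "c = (if CARD('n) = 1 then \<delta>\<^sup>2 + 1 else cd * \<delta>\<^sup>2 + 1)"
  have c: "c > 0" using cd by (auto simp: c_def intro!: add_nonneg_pos)
  have q: "\<bar>qform (DP K U) z\<bar> \<le> c * norm (cost_grad K) * norm U" if K: "K \<in> sub a" and z: "norm z \<le> \<delta>" for K U z
  proof (cases "CARD('n) = 1")
    case True
    then obtain i :: 'n where UN: "UNIV = {i}" by (auto simp: card_1_singleton_iff)
    have "qform Y z = z $ i * z $ i * trace Y" for Y :: "real^'n^'n"
      unfolding qform_def inner_vec_def matrix_vector_mult_def trace_def UN by simp
    moreover have "z $ i * z $ i = (norm z)\<^sup>2"
      unfolding dot_square_norm[symmetric] inner_vec_def UN by simp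
    ultimately have "qform (DP K U) z = (norm z)\<^sup>2 * (cost_grad K \<bullet> U)" by (simp add: trace_DP[OF subD(1)[OF K]])
    then have "\<bar>qform (DP K U) z\<bar> = (norm z)\<^sup>2 * \<bar>cost_grad K \<bullet> U\<bar>" by (simp add: abs_mult)
    also have "\<dots> \<le> c * (norm (cost_grad K) * norm U)"
    proof (rule mult_mono)
      have "(norm z)\<^sup>2 \<le> \<delta>\<^sup>2" using z by (intro power_mono) auto
      then show "(norm z)\<^sup>2 \<le> c" using True by (simp add: c_def)
    qed (use c Cauchy_Schwarz_ineq2 in auto)
    finally show ?thesis by (simp add: mult_ac)
  next
    case False
    have "\<bar>qform (DP K U) z\<bar> \<le> norm (DP K U) * (norm z)\<^sup>2" by (rule abs_qform_le)
    also have "\<dots> \<le> (cd * norm (cost_grad K) * norm U) * \<delta>\<^sup>2"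
      using cd z K by (intro mult_mono power_mono) auto
    also have "\<dots> \<le> c * norm (cost_grad K) * norm U" using False by (simp add: c_def algebra_simps)
    finally show ?thesis .
  qed
  have "\<bar>correlation a K (U, z)\<bar> \<le> c * (norm (grad_on a K))\<^sup>2 * (norm U)\<^sup>2" if z: "norm z \<le> \<delta>" for K U z
  proof (cases "K \<in> sub a")
    case True
    have "\<bar>correlation a K (U, z)\<bar> = \<bar>qform (DP K U) z\<bar> * \<bar>cost_grad K \<bullet> U\<bar>"
      using True by (simp add: correlation_def DP_on_eq grad_on_eq abs_mult)
    also have "\<dots> \<le> (c * norm (cost_grad K) * norm U) * (norm (cost_grad K) * norm U)"
      using c by (intro mult_mono q[OF True z] Cauchy_Schwarz_ineq2) auto
    finally show ?thesis using True by (simp add: grad_on_eq power2_eq_square mult_ac)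
  qed (simp add: correlation_def grad_on_outside)
  moreover have "CARD('n) = 1 \<longrightarrow> c = \<delta>\<^sup>2 + 1" by (simp add: c_def)
  ultimately show ?thesis using c by blast
qed

end

locale lqr_sampling = lqr A B Q R q0 \<rho>0
  for A :: "real^'n^'n" and B :: "real^'m^'n" and Q R q0 \<rho>0 +
  fixes D :: "(real^'n) measure" and \<delta> :: real
  assumes D_prob: "prob_space D" and D_sets [measurable_cong]: "sets D = sets borel"
    and D_moment: "second_moment D = mat 1" and \<delta>_pos: "0 < \<delta>" and D_bounded: "AE z in D. norm z \<le> \<delta>"
begin

section \<open>The law of a single sample\<close>

definition mn :: real where "mn = real CARD('m) * real CARD('n)"

lemma mn_pos: "0 < mn" by (simp add: mn_def)

definition \<nu> :: "((real^'n^'m) \<times> (real^'n)) measure" where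
  "\<nu> = uniform_sphere (sqrt mn) \<Otimes>\<^sub>M D"

lemma \<nu>_prob: "prob_space \<nu>"
  unfolding \<nu>_def by (intro prob_space_pair prob_space_uniform_sphere D_prob)

lemma sets_\<nu>: "sets \<nu> = sets (borel \<Otimes>\<^sub>M borel)"
  unfolding \<nu>_def by (intro sets_pair_measure_cong D_sets) simp

lemma measurable_\<nu>: "f \<in> borel_measurable (borel \<Otimes>\<^sub>M borel) \<Longrightarrow> f \<in> borel_measurable \<nu>"
  by (simp add: measurable_cong_sets[OF sets_\<nu> refl])

lemma AE_\<nu>: "AE s in \<nu>. norm (fst s) \<le> sqrt mn \<and> norm (snd s) \<le> \<delta>"
proof -
  interpret D: prob_space D by (rule D_prob)
  interpret U: prob_space "uniform_sphere (sqrt mn) :: (real^'n^'m) measure" by (rule prob_space_uniform_sphere)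
  interpret pair_prob_space "uniform_sphere (sqrt mn) :: (real^'n^'m) measure" D ..
  have "AE U in uniform_sphere (sqrt mn). norm (U :: real^'n^'m) = sqrt mn"
    using AE_uniform_sphere_norm[of "sqrt mn"] mn_pos by auto
  then have "AE U in uniform_sphere (sqrt mn). AE z in D.
      norm (fst (U :: real^'n^'m, z)) \<le> sqrt mn \<and> norm (snd (U, z)) \<le> \<delta>"
  proof eventually_elim
    case (elim U)
    show ?case using D_bounded by eventually_elim (simp add: elim)
  qed
  moreover have "{s \<in> space \<nu>. norm (fst s) \<le> sqrt mn \<and> norm (snd s) \<le> \<delta>} \<in> sets \<nu>"
    by (simp add: sets_eq_imp_space_eq[OF sets_\<nu>] sets_\<nu>)
  ultimately show ?thesis unfolding \<nu>_def by (intro AE_pair_measure)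
qed

text \<open>Averaging over \<open>z\<close> first turns the form into \<open>trace (DP K U)\<close>,
  the directional derivative. On the sphere of radius \<open>sqrt mn\<close> in dimension
  \<open>mn\<close> the second moment is the identity, which is why the estimate needs no
  rescaling.\<close>

lemma correlation_integral:
  assumes c: "\<And>U z. norm z \<le> \<delta> \<Longrightarrow> \<bar>correlation a K (U, z)\<bar> \<le> c * (norm (grad_on a K))\<^sup>2 * (norm U)\<^sup>2" and "0 < c"
  shows "(\<integral>s. correlation a K s \<partial>\<nu>) = (norm (grad_on a K))\<^sup>2"
    and "AE s in \<nu>. \<bar>correlation a K s\<bar> \<le> c * (norm (grad_on a K))\<^sup>2 * mn"
    and "(\<lambda>s. correlation a K s) \<in> borel_measurable \<nu>"
proof -
  interpret D: prob_space D by (rule D_prob)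
  interpret U: prob_space "uniform_sphere (sqrt mn) :: (real^'n^'m) measure" by (rule prob_space_uniform_sphere)
  interpret pair_prob_space "uniform_sphere (sqrt mn) :: (real^'n^'m) measure" D ..
  interpret \<nu>: prob_space \<nu> by (rule \<nu>_prob)
  have "(\<lambda>s. correlation a K (fst s, snd s)) \<in> borel_measurable (borel \<Otimes>\<^sub>M borel)" by measurable
  then show meas: "(\<lambda>s. correlation a K s) \<in> borel_measurable \<nu>" by (intro measurable_\<nu>) simp
  show bd: "AE s in \<nu>. \<bar>correlation a K s\<bar> \<le> c * (norm (grad_on a K))\<^sup>2 * mn"
    using AE_\<nu>
  proof eventually_elim
    case (elim s)
    have "\<bar>correlation a K (fst s, snd s)\<bar> \<le> c * (norm (grad_on a K))\<^sup>2 * (norm (fst s))\<^sup>2" using c elim by blast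
    also have "\<dots> \<le> c * (norm (grad_on a K))\<^sup>2 * (sqrt mn)\<^sup>2"
      using elim \<open>0 < c\<close> by (intro mult_left_mono power_mono) auto
    finally show ?case using mn_pos by simp
  qed
  have int: "integrable \<nu> (\<lambda>s. correlation a K s)"
    by (rule \<nu>.integrable_const_bound[OF _ meas]) (use bd in simp)
  show "(\<integral>s. correlation a K s \<partial>\<nu>) = (norm (grad_on a K))\<^sup>2"
  proof (cases "K \<in> sub a")
    case True
    let ?g = "cost_grad K"
    have "(\<integral>s. correlation a K s \<partial>\<nu>) = (\<integral>U. (\<integral>z. correlation a K (U, z) \<partial>D) \<partial>uniform_sphere (sqrt mn))"
      using int unfolding \<nu>_def by (rule integral_fst'[symmetric])
    also have "\<dots> = (\<integral>U. (U \<bullet> ?g)\<^sup>2 \<partial>uniform_sphere (sqrt mn))"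
    proof (rule Bochner_Integration.integral_cong[OF refl])
      fix U
      have "(\<integral>z. correlation a K (U, z) \<partial>D) = trace (DP K U) * (?g \<bullet> U)"
        using integral_qform_eq_trace[OF D_prob D_sets D_moment D_bounded, of "DP K U"] True
        by (simp add: correlation_def DP_on_eq grad_on_eq)
      then show "(\<integral>z. correlation a K (U, z) \<partial>D) = (U \<bullet> ?g)\<^sup>2"
        by (simp add: trace_DP[OF subD(1)[OF True]] power2_eq_square inner_commute)
    qed
    also have "\<dots> = (sqrt mn)\<^sup>2 / real DIM(real^'n^'m) * (norm ?g)\<^sup>2"
      using mn_pos by (intro uniform_sphere_second_moment) auto
    also have "\<dots> = (norm ?g)\<^sup>2" using mn_pos by (simp add: mn_def)
    finally show ?thesis using True by (simp add: grad_on_eq)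
  qed (simp add: correlation_def grad_on_outside)
qed

text \<open>Mean \<open>G\<close> and bound \<open>c * G * mn\<close> share the factor
  \<open>G\<close>, which cancels in Hoeffding's exponent. A vanishing gradient is separated because
  the bound must be positive; the event is then empty.\<close>

lemma correlation_concentration:
  assumes c: "\<And>U z. norm z \<le> \<delta> \<Longrightarrow> \<bar>correlation a K (U, z)\<bar> \<le> c * (norm (grad_on a K))\<^sup>2 * (norm U)\<^sup>2" and "0 < c"
    and S: "finite S" "S \<noteq> {}"
  shows "measure (PiM S (\<lambda>_. \<nu>)) {y \<in> space (PiM S (\<lambda>_. \<nu>)).
      (\<Sum>i\<in>S. correlation a K (y i)) < real (card S) * (norm (grad_on a K))\<^sup>2 / 2}
    \<le> exp (- (1 / (8 * c\<^sup>2 * mn\<^sup>2)) * real (card S))"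
proof (cases "grad_on a K = 0")
  case True
  then have "correlation a K s = 0" for s by (simp add: correlation_def)
  then show ?thesis using True by simp
next
  case False
  let ?G = "(norm (grad_on a K))\<^sup>2" and ?P = "PiM S (\<lambda>_. \<nu>)"
  interpret P: prob_space ?P by (intro prob_space_PiM \<nu>_prob)
  have G: "?G > 0" using False by simp
  note ci = correlation_integral[of a K c, OF c \<open>0 < c\<close>]
  have [measurable]: "(\<lambda>s. correlation a K s) \<in> borel_measurable \<nu>" using ci(3) .
  have "P.prob {y \<in> space ?P. (\<Sum>i\<in>S. correlation a K (y i)) < real (card S) * ?G / 2}
     \<le> P.prob {y \<in> space ?P. (\<Sum>i\<in>S. correlation a K (y i)) \<le> real (card S) * ?G / 2}"
    by (intro P.finite_measure_mono) auto
  also have "\<dots> \<le> exp (- (real (card S) * ?G\<^sup>2 / (8 * (c * ?G * mn)\<^sup>2)))"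
    by (rule PiM_average_concentration[OF \<nu>_prob S ci(3,2) _ ci(1)]) (use G \<open>0 < c\<close> mn_pos in auto)
  also have "real (card S) * ?G\<^sup>2 / (8 * (c * ?G * mn)\<^sup>2) = 1 / (8 * c\<^sup>2 * mn\<^sup>2) * real (card S)"
    using G by (simp add: power_mult_distrib field_simps)
  finally show ?thesis by simp
qed

text \<open>The asynchronous schedule is reduced to bounded delays \<open>d\<close> and a labelling
  \<open>idx\<close> that never uses a sample twice.\<close>

definition success_guarantee :: "real \<Rightarrow> real \<Rightarrow> real \<Rightarrow> real \<Rightarrow> real \<Rightarrow> real \<Rightarrow> real \<Rightarrow> real \<Rightarrow> bool" where
  "success_guarantee a \<mu> m r0 \<theta>1 \<theta>2 h0 \<kappa> \<longleftrightarrow>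
    (\<forall>\<epsilon> r \<tau> \<eta> N J T d K0 (idx :: nat \<Rightarrow> nat \<Rightarrow> nat \<times> nat) I.
    0 < \<epsilon> \<longrightarrow> \<epsilon> \<le> cost K0 - m \<longrightarrow> K0 \<in> sub a \<longrightarrow>
    0 < r \<longrightarrow> r < min r0 (\<theta>1 * sqrt \<epsilon>) \<longrightarrow> \<theta>2 * ln (1 / (\<epsilon> * r)) \<le> \<tau> \<longrightarrow>
    0 < \<eta> \<longrightarrow> 1 \<le> T \<longrightarrow> \<eta> * real T \<le> h0 \<longrightarrow> 0 < N \<longrightarrow>
    8 / (\<eta> * \<mu>) * ln ((cost K0 - m) / \<epsilon>) \<le> real J \<longrightarrow>
    (\<forall>j<J. \<forall>i<N. d j i \<le> T) \<longrightarrow> (\<forall>j i. idx j i \<in> I) \<longrightarrow>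
    (\<forall>j j' i i'. i < N \<longrightarrow> i' < N \<longrightarrow> idx j i = idx j' i' \<longrightarrow> j = j' \<and> i = i') \<longrightarrow>
    1 - real J * exp (- \<kappa> * real N) \<le> measure (PiM I (\<lambda>_. \<nu>))
      {\<omega> \<in> space (PiM I (\<lambda>_. \<nu>)).
         (let K = delayed_descent K0 \<eta> N d
           (\<lambda>j i K. case \<omega> (idx j i) of (U, z) \<Rightarrow> grad_estimate A B Q R \<tau> r U z K) J
          in K \<in> stab \<and> cost K - m \<le> \<epsilon>)})"

lemma azopg_success_probability:
  fixes a \<mu> m :: real
  assumes \<mu>: "0 < \<mu>" and m: "\<forall>K\<in>stab. m \<le> cost K"
    and dom: "\<forall>K\<in>sub a. cost K - m \<le> 1 / (2 * \<mu>) * (norm (cost_grad K))\<^sup>2"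
  shows "\<exists>r0>0. \<exists>\<theta>1>0. \<exists>\<theta>2>0. \<exists>h0>0. \<exists>\<kappa>>0. (mn = 1 \<longrightarrow> \<kappa> = 1 / (8 * (\<delta>\<^sup>2 + 1)\<^sup>2)) \<and>
    success_guarantee a \<mu> m r0 \<theta>1 \<theta>2 h0 \<kappa>"
proof -
  have smn: "0 < sqrt mn" using mn_pos by simp
  obtain r0 \<theta>1 \<theta>2 h0 where con: "r0 > 0" "\<theta>1 > 0" "\<theta>2 > 0" "h0 > 0" and
    det: "sample_descent (sqrt mn) \<delta> a \<mu> m r0 \<theta>1 \<theta>2 h0"
    using descent_of_samples[OF smn \<delta>_pos \<mu> m dom] by blast
  obtain c where c: "c > 0" "CARD('n) = 1 \<longrightarrow> c = \<delta>\<^sup>2 + 1"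
    "\<And>K U z. norm z \<le> \<delta> \<Longrightarrow> \<bar>correlation a K (U, z)\<bar> \<le> c * (norm (grad_on a K))\<^sup>2 * (norm U)\<^sup>2"
    using correlation_bound[of \<delta> a] \<delta>_pos by auto
  define \<kappa> where "\<kappa> = 1 / (8 * c\<^sup>2 * mn\<^sup>2)"
  have \<kappa>: "\<kappa> > 0" using c mn_pos by (simp add: \<kappa>_def)
  have \<kappa>1: "\<kappa> = 1 / (8 * (\<delta>\<^sup>2 + 1)\<^sup>2)" if "mn = 1"
  proof -
    have "real (CARD('m) * CARD('n)) = real 1" using that by (simp add: mn_def)
    then have "CARD('m) * CARD('n) = 1" unfolding of_nat_eq_iff .
    then have "CARD('n) = 1" by simp
    then show ?thesis using c(2) that by (simp add: \<kappa>_def)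
  qed
  show ?thesis
    unfolding success_guarantee_def
  proof (intro exI conjI allI impI)
    show "r0 > 0" "\<theta>1 > 0" "\<theta>2 > 0" "h0 > 0" "\<kappa> > 0" using con \<kappa> by auto
    show "\<kappa> = 1 / (8 * (\<delta>\<^sup>2 + 1)\<^sup>2)" if "mn = 1" using \<kappa>1[OF that] .
    fix \<epsilon> r \<tau> \<eta> :: real and N J T :: nat and d :: "nat \<Rightarrow> nat \<Rightarrow> nat" and K0 :: "real^'n^'m"
      and idx :: "nat \<Rightarrow> nat \<Rightarrow> nat \<times> nat" and I
    assume \<epsilon>: "0 < \<epsilon>" "\<epsilon> \<le> cost K0 - m" and K0: "K0 \<in> sub a"
      and r: "0 < r" "r < min r0 (\<theta>1 * sqrt \<epsilon>)" and \<tau>: "\<theta>2 * ln (1 / (\<epsilon> * r)) \<le> \<tau>"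
      and \<eta>: "0 < \<eta>" and T: "1 \<le> T" "\<eta> * real T \<le> h0" and N: "0 < N"
      and J: "8 / (\<eta> * \<mu>) * ln ((cost K0 - m) / \<epsilon>) \<le> real J"
      and d: "\<forall>j<J. \<forall>i<N. d j i \<le> T" and idxI: "\<forall>j i. idx j i \<in> I"
      and idx: "\<forall>j j' i i'. i < N \<longrightarrow> i' < N \<longrightarrow> idx j i = idx j' i' \<longrightarrow> j = j' \<and> i = i'"
    let ?P = "\<lambda>I. PiM I (\<lambda>_. \<nu>)"
    interpret P: prob_space "?P I" by (intro prob_space_PiM \<nu>_prob)
    define Gf where "Gf s K = grad_estimate A B Q R \<tau> r (fst s) (snd s) K" for s :: "(real^'n^'m) \<times> (real^'n)" and K
    define X where "X \<omega> = delayed_descent K0 \<eta> N d (\<lambda>j i K. Gf (\<omega> (idx j i)) K)" for \<omega>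
    have "(\<lambda>p. Gf (fst p) (snd p)) \<in> borel_measurable ((borel \<Otimes>\<^sub>M borel) \<Otimes>\<^sub>M borel)"
      unfolding Gf_def by measurable
    then have Gf: "(\<lambda>(s, K). Gf s K) \<in> borel_measurable (\<nu> \<Otimes>\<^sub>M borel)"
      unfolding split_beta' by (simp add: measurable_cong_sets[OF sets_pair_measure_cong[OF sets_\<nu> refl] refl])
    have Xm: "(\<lambda>\<omega>. X \<omega> j) \<in> borel_measurable (?P S)" if "\<And>j' i. j' < j \<Longrightarrow> i < N \<Longrightarrow> idx j' i \<in> S" for S j
      unfolding X_def by (rule delayed_descent_measurable[OF Gf that])
    have Xcong: "X \<omega> j = X \<omega>' j" if "\<And>j' i. j' < j \<Longrightarrow> i < N \<Longrightarrow> \<omega> (idx j' i) = \<omega>' (idx j' i)" for \<omega> \<omega>' j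
      unfolding X_def by (rule delayed_descent_cong) (simp add: that)
    define goal where "goal = {\<omega> \<in> space (?P I). X \<omega> J \<in> stab \<and> cost (X \<omega> J) - m \<le> \<epsilon>}"
    have goal_sets: "goal \<in> P.events"
    proof -
      \<comment> \<open>The goal is the event of lying in one sublevel set of the cost, and such
        sets are closed.\<close>
      have "goal = (\<lambda>\<omega>. X \<omega> J) -` sub (m + \<epsilon>) \<inter> space (?P I)" by (auto simp: goal_def sub_def)
      also have "\<dots> \<in> P.events" using idxI by (intro measurable_sets[OF Xm] borel_closed closed_sub) auto
      finally show ?thesis .
    qed
    define bad where "bad j = {\<omega> \<in> space (?P I).
       (\<Sum>i<N. correlation a (X \<omega> j) (\<omega> (idx j i))) < real N * (norm (grad_on a (X \<omega> j)))\<^sup>2 / 2}" for j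
    have bad: "bad j \<in> P.events \<and> P.prob (bad j) \<le> exp (- \<kappa> * real N)" for j
    proof -
      \<comment> \<open>\<open>S1\<close> labels the samples that determine the current iterate,
        \<open>S2\<close> those of the current batch; the labelling makes the two disjoint, so given
        the past the batch is fresh.\<close>
      define S1 where "S1 = (\<lambda>(j, i). idx j i) ` ({..<j} \<times> {..<N})"
      define S2 where "S2 = idx j ` {..<N}"
      have inj: "inj_on (idx j) {..<N}" using idx by (auto simp: inj_on_def)
      have cS2: "card S2 = N" unfolding S2_def by (simp add: card_image[OF inj])
      have S12: "finite S1" "finite S2" "S1 \<subseteq> I" "S2 \<subseteq> I" "S2 \<noteq> {}" "I \<noteq> {}"
        using N idxI by (auto simp: S1_def S2_def)
      have disj: "S1 \<inter> S2 = {}"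
      proof -
        have "idx j' i \<noteq> idx j i'" if "j' < j" "i < N" "i' < N" for j' i i' using idx that by fastforce
        then show ?thesis unfolding S1_def S2_def disjoint_iff by (auto elim!: imageE) metis
      qed
      have inS1: "idx j' i \<in> S1" if "j' < j" "i < N" for j' i using that by (auto simp: S1_def)
      have inS2: "idx j i \<in> S2" if "i < N" for i using that by (auto simp: S2_def)
      let ?b = "{p \<in> space (?P S1 \<Otimes>\<^sub>M ?P S2). (\<Sum>i<N. correlation a (X (fst p) j) (snd p (idx j i))) <
          real N * (norm (grad_on a (X (fst p) j)))\<^sup>2 / 2}"
      have Xf[measurable]: "(\<lambda>p. X (fst p) j) \<in> borel_measurable (?P S1 \<Otimes>\<^sub>M ?P S2)"
        using measurable_compose[OF measurable_fst Xm[of j S1]] inS1 by auto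
      have cm: "(\<lambda>p. correlation a (X (fst p) j) (snd p (idx j i))) \<in> borel_measurable (?P S1 \<Otimes>\<^sub>M ?P S2)" if "i < N" for i
      proof -
        have "(\<lambda>p. snd p (idx j i)) \<in> ?P S1 \<Otimes>\<^sub>M ?P S2 \<rightarrow>\<^sub>M \<nu>"
          by (rule measurable_compose[OF measurable_snd measurable_component_singleton[OF inS2[OF that]]])
        then have s: "(\<lambda>p. snd p (idx j i)) \<in> ?P S1 \<Otimes>\<^sub>M ?P S2 \<rightarrow>\<^sub>M borel \<Otimes>\<^sub>M borel"
          by (simp add: measurable_cong_sets[OF refl sets_\<nu>])
        have "(\<lambda>p. correlation a (X (fst p) j) (fst (snd p (idx j i)), snd (snd p (idx j i)))) \<in> borel_measurable (?P S1 \<Otimes>\<^sub>M ?P S2)"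
          by (intro measurable_correlation Xf measurable_compose[OF s measurable_fst] measurable_compose[OF s measurable_snd])
        then show ?thesis by simp
      qed
      have bs: "?b \<in> sets (?P S1 \<Otimes>\<^sub>M ?P S2)"
        by (intro borel_measurable_less borel_measurable_sum borel_measurable_divide borel_measurable_times
           borel_measurable_power borel_measurable_norm measurable_grad_on borel_measurable_const Xf cm) auto
      have mA: "(\<lambda>\<omega>. restrict \<omega> S1) \<in> ?P I \<rightarrow>\<^sub>M ?P S1" and mB: "(\<lambda>\<omega>. restrict \<omega> S2) \<in> ?P I \<rightarrow>\<^sub>M ?P S2"
        using S12 by (auto intro!: measurable_restrict_subset)
      have eq: "bad j = {\<omega> \<in> space (?P I). (restrict \<omega> S1, restrict \<omega> S2) \<in> ?b}"
      proof -
        have "X (restrict \<omega> S1) j = X \<omega> j" for \<omega> by (rule Xcong) (simp add: inS1)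
        moreover have "(restrict \<omega> S1, restrict \<omega> S2) \<in> space (?P S1 \<Otimes>\<^sub>M ?P S2)" if "\<omega> \<in> space (?P I)" for \<omega>
          using measurable_space[OF mA that] measurable_space[OF mB that] by (simp add: space_pair_measure)
        ultimately show ?thesis unfolding bad_def by (auto simp: inS2)
      qed
      have "P.prob (bad j) \<le> exp (- \<kappa> * real N)"
        unfolding eq
      proof (rule PiM_conditional_bound[OF \<nu>_prob S12(1-4) disj S12(6) bs])
        fix x assume x: "x \<in> space (?P S1)"
        have "{y \<in> space (?P S2). (x, y) \<in> ?b} = {y \<in> space (?P S2).
           (\<Sum>i\<in>S2. correlation a (X x j) (y i)) < real (card S2) * (norm (grad_on a (X x j)))\<^sup>2 / 2}"
          using x unfolding cS2 by (auto simp: space_pair_measure S2_def sum.reindex[OF inj])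
        also have "measure (?P S2) \<dots> \<le> exp (- (1 / (8 * c\<^sup>2 * mn\<^sup>2)) * real (card S2))"
          by (rule correlation_concentration[OF c(3) c(1) S12(2,5)])
        finally show "measure (?P S2) {y \<in> space (?P S2). (x, y) \<in> ?b} \<le> exp (- \<kappa> * real N)"
          by (simp add: \<kappa>_def cS2)
      qed simp
      moreover have "bad j \<in> P.events"
        unfolding eq using measurable_sets[OF measurable_Pair[OF mA mB] bs] by (simp add: vimage_def Int_def conj_commute)
      ultimately show ?thesis by blast
    qed
    have AEs: "AE \<omega> in ?P I. \<forall>j\<in>{..<J}. \<forall>i\<in>{..<N}. norm (fst (\<omega> (idx j i))) \<le> sqrt mn \<and> norm (snd (\<omega> (idx j i))) \<le> \<delta>"
      by (intro eventually_ball_finite ballI finite_lessThan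
          AE_PiM_component[where P="\<lambda>s. norm (fst s) \<le> sqrt mn \<and> norm (snd s) \<le> \<delta>"] \<nu>_prob AE_\<nu>) (use idxI in auto)
    have "AE \<omega> in ?P I. \<omega> \<in> goal \<union> (\<Union>j<J. bad j)"
      using AEs AE_space
    proof eventually_elim
      case (elim \<omega>)
      show ?case
      proof (rule ccontr)
        assume not: "\<omega> \<notin> goal \<union> (\<Union>j<J. bad j)"
        have conc: "real N * (norm (grad_on a (X \<omega> j)))\<^sup>2 / 2 \<le> (\<Sum>i<N. correlation a (X \<omega> j) (\<omega> (idx j i)))" if "j < J" for j
          using not elim that by (auto simp: bad_def not_less)
        have "X \<omega> J \<in> stab \<and> cost (X \<omega> J) - m \<le> \<epsilon>"
        proof (rule det[unfolded sample_descent_def, rule_format, where x="X \<omega>" and d=d and T=T and N=N and \<eta>=\<eta> and r=r and \<tau>=\<tau>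
              and U="\<lambda>j i. fst (\<omega> (idx j i))" and z="\<lambda>j i. snd (\<omega> (idx j i))"])
          show "\<epsilon> \<le> cost (X \<omega> 0) - m" "X \<omega> 0 \<in> sub a"
            "8 / (\<eta> * \<mu>) * ln ((cost (X \<omega> 0) - m) / \<epsilon>) \<le> real J"
            using \<epsilon> K0 J by (simp_all add: X_def)
          show "d j i \<le> T \<and> norm (fst (\<omega> (idx j i))) \<le> sqrt mn \<and> norm (snd (\<omega> (idx j i))) \<le> \<delta>"
            if "j < J" "i < N" for j i using d elim that by auto
          show "X \<omega> (Suc j) = X \<omega> j - \<eta> *\<^sub>R ((1 / real N) *\<^sub>R
            (\<Sum>i<N. grad_estimate A B Q R \<tau> r (fst (\<omega> (idx j i))) (snd (\<omega> (idx j i))) (X \<omega> (j - d j i))))" for j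
            by (simp add: X_def Gf_def)
          show "real N * (norm (cost_grad (X \<omega> j)))\<^sup>2 / 2 \<le>
            (\<Sum>i<N. qform (DP (X \<omega> j) (fst (\<omega> (idx j i)))) (snd (\<omega> (idx j i))) * (cost_grad (X \<omega> j) \<bullet> fst (\<omega> (idx j i))))"
            if "j < J" "X \<omega> j \<in> sub a" for j
            using conc[OF that(1)] that(2) by (auto simp: correlation_def DP_on_eq grad_on_eq)
        qed (use \<epsilon> r \<tau> \<eta> T N in auto)
        then show False using not elim by (simp add: goal_def)
      qed
    qed
    \<comment> \<open>Almost every path avoiding all bad events reaches the goal, so a union bound
      over the iterations finishes the estimate.\<close>
    then have "1 = P.prob (goal \<union> (\<Union>j<J. bad j))"
      using P.prob_eq_1[of "goal \<union> (\<Union>j<J. bad j)"] goal_sets bad by auto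
    also have "\<dots> \<le> P.prob goal + P.prob (\<Union>j<J. bad j)"
      using goal_sets bad by (intro measure_Un_le) auto
    also have "P.prob (\<Union>j<J. bad j) \<le> (\<Sum>j<J. P.prob (bad j))"
      using bad by (intro P.finite_measure_subadditive_finite) auto
    also have "\<dots> \<le> (\<Sum>j<J. exp (- \<kappa> * real N))" using bad by (intro sum_mono) auto
    finally have "1 - real J * exp (- \<kappa> * real N) \<le> P.prob goal" by simp
    then show "1 - real J * exp (- \<kappa> * real N) \<le> measure (?P I)
      {\<omega> \<in> space (?P I).
         (let K = delayed_descent K0 \<eta> N d
           (\<lambda>j i K. case \<omega> (idx j i) of (U, z) \<Rightarrow> grad_estimate A B Q R \<tau> r U z K) J
          in K \<in> stab \<and> cost K - m \<le> \<epsilon>)}"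
      by (simp add: goal_def X_def Gf_def Let_def split_beta')
  qed
qed

end

section \<open>Assembling the constants\<close>

lemma exp_le_powr_eventually:
  fixes \<kappa> \<beta> :: real
  assumes "0 < \<kappa>" "0 < \<beta>"
  shows "\<exists>N0::nat. \<forall>N\<ge>N0. exp (- \<kappa> * real N) \<le> real N powr (- \<beta>)"
proof -
  have "\<forall>\<^sub>F x in at_top. ln x / x < \<kappa> / \<beta>"
    by (rule order_tendstoD(2)[OF ln_x_over_x_tendsto_0]) (use assms in auto)
  then obtain x0 where x0: "\<And>x. x \<ge> x0 \<Longrightarrow> ln x / x < \<kappa> / \<beta>" by (auto simp: eventually_at_top_linorder)
  have "exp (- \<kappa> * real N) \<le> real N powr (- \<beta>)" if "N \<ge> nat \<lceil>x0\<rceil> + 1" for N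
  proof -
    have N: "real N \<ge> x0" "real N > 0" using that by linarith+
    have "\<beta> * ln (real N) \<le> \<kappa> * real N" using x0[OF N(1)] N(2) assms by (simp add: field_simps)
    then show ?thesis using N(2) by (simp add: powr_def)
  qed
  then show ?thesis by blast
qed

text \<open>The summand \<open>T * Cg\<close> in the denominator cancels the delay bound
  \<open>4 * T\<close>, and 128 / 4 = 32.\<close>

lemma stepsize_times_delay_le:
  fixes \<eta> \<mu> Cg T H :: real
  assumes \<eta>: "0 < \<eta>" "\<eta> \<le> 1 / (128 * \<mu> * (Cg\<^sup>2 + T * Cg))"
    and "1 \<le> T" "H \<le> Cg" "0 < H" "0 < \<mu>" "real n \<le> 4 * T"
  shows "\<eta> * real n \<le> 1 / (32 * \<mu> * H)"
proof -
  have "T * H \<le> T * Cg" using assms by (intro mult_left_mono) auto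
  then have "T * H \<le> Cg\<^sup>2 + T * Cg" by (simp add: add_increasing)
  moreover have "0 < T * H" using assms by simp
  moreover from calculation have "0 < Cg\<^sup>2 + T * Cg" by linarith
  ultimately have "1 / (128 * \<mu> * (Cg\<^sup>2 + T * Cg)) \<le> 1 / (128 * \<mu> * (T * H))"
    using assms by (intro divide_left_mono mult_left_mono mult_pos_pos) auto
  then have "\<eta> * real n \<le> 1 / (128 * \<mu> * (T * H)) * (4 * T)"
    using assms by (intro mult_mono) auto
  also have "\<dots> = 1 / (32 * \<mu> * H)" using assms by (simp add: field_simps)
  finally show ?thesis .
qed

theorem theorem1:
  fixes A :: "real^'n^'n" and B :: "real^'m^'n" and Q :: "real^'n^'n" and R :: "real^'m^'m"
    and D :: "(real^'n) measure" and \<mu>1 \<mu>2 :: "real \<Rightarrow> real" and \<beta> C0 :: real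
  assumes "controllable A B" and "positive_definite Q" and "positive_definite R"
    and "admissible_init D"
    and "\<And>a. 0 < \<mu>1 a" and "\<And>a. 0 < \<mu>2 a"
    and "\<And>a. grad_dominated_on (lqr_cost A B Q R D) (optimal_policy A B Q R D) (\<mu>1 a)
               (sublevel A B Q R D a)"
    and "\<And>a. smooth_on_set (lqr_cost A B Q R D) (\<mu>2 a) (sublevel A B Q R D a)"
    and "0 < \<beta>" and "0 < C0"
  shows "\<exists>C1 C2 C3 C4 :: real. \<exists>r0 \<theta>1 \<theta>2 \<theta>3 \<theta>' :: real \<Rightarrow> real.
    0 < C1 \<and> 0 < C2 \<and> 0 < C3 \<and> 0 < C4 \<and>
    (\<forall>a. 0 < r0 a \<and> 0 < \<theta>1 a \<and> 0 < \<theta>2 a \<and> 0 < \<theta>3 a \<and> 0 < \<theta>' a) \<and>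
    (\<forall>(tmin::real) (tmax::real) (a::real) (\<epsilon>::real) (K0::real^'n^'m)
       (\<tau>::real) (r::real) (N::nat) (M::nat) (\<eta>::real)
       (pull :: nat \<Rightarrow> nat \<Rightarrow> real) (push :: nat \<Rightarrow> nat \<Rightarrow> real) (arr :: nat \<Rightarrow> nat \<times> nat).
      let f = lqr_cost A B Q R D;
          fmin = f (optimal_policy A B Q R D);
          mn = real CARD('m) * real CARD('n);
          Cg = C4 * \<theta>' a * \<beta> * mn * ln (real N) + 2 * sqrt mn;
          T = C0 * of_int \<lfloor>tmax / tmin\<rfloor> + 1
      in
        0 < tmin \<longrightarrow> tmin < tmax \<longrightarrow>
        worker_timing tmin tmax M pull push \<longrightarrow> arrival_order M push arr \<longrightarrow>
        0 < \<epsilon> \<longrightarrow> K0 \<in> sublevel A B Q R D a \<longrightarrow>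
        0 < r \<longrightarrow> r < min (r0 a) (\<theta>1 a * sqrt \<epsilon>) \<longrightarrow>
        \<theta>2 a * ln (1 / (\<epsilon> * r)) \<le> \<tau> \<longrightarrow>
        C1 * \<beta>^4 * \<theta>3 a * (ln mn)^6 * mn \<le> real N \<longrightarrow>
        1 \<le> M \<longrightarrow> real M \<le> C0 * real N \<longrightarrow>
        0 < \<eta> \<longrightarrow> \<eta> \<le> 1 / (128 * \<mu>2 a * (Cg^2 + T * Cg)) \<longrightarrow>
        (\<exists>j::nat. j \<le> nat \<lceil>8 / (\<eta> * \<mu>1 a) * ln ((f K0 - fmin) / \<epsilon>)\<rceil> \<and>
          1 - real j * (C2 * real N powr (- \<beta>) + C3 * exp (- real N))
            \<le> measure (sample_space D M)
                {\<omega> \<in> space (sample_space D M).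
                  azopg A B Q R \<tau> r N \<eta> pull push arr K0 \<omega> j \<in> stabilizing A B \<and>
                  f (azopg A B Q R \<tau> r N \<eta> pull push arr K0 \<omega> j) - fmin \<le> \<epsilon>}))"
proof -
  obtain q0 where q0: "0 < q0" "\<And>x. q0 * (norm x)\<^sup>2 \<le> qform Q x"
    using positive_definite_lower_bound[OF assms(2)] by blast
  obtain \<rho>0 where \<rho>0: "0 < \<rho>0" "\<And>x. \<rho>0 * (norm x)\<^sup>2 \<le> qform R x"
    using positive_definite_lower_bound[OF assms(3)] by blast
  obtain \<delta> where \<delta>: "0 < \<delta>" "AE z in D. norm z \<le> \<delta>"
    using assms(4) by (auto simp: admissible_init_def)
  have sym: "transpose Q = Q" "transpose R = R"
    using assms(2,3) unfolding positive_definite_def by blast+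
  have D: "prob_space D" "sets D = sets borel" "second_moment D = mat 1"
    using assms(4) unfolding admissible_init_def by blast+
  interpret lqr_sampling A B Q R q0 \<rho>0 D \<delta>
    by (intro lqr_sampling.intro lqr.intro lqr_sampling_axioms.intro sym q0 \<rho>0 D \<delta>)
  have f: "lqr_cost A B Q R D = cost"
    by (auto simp: fun_eq_iff lqr_cost_def lyapunov_sol_eq D_moment cost_def)
  have S: "sublevel A B Q R D a = sub a" for a by (simp add: sublevel_def sub_def f)
  define m where "m = cost (optimal_policy A B Q R D)"
  have m: "\<forall>K\<in>stab. m \<le> cost K"
    using cost_optimal unfolding m_def optimal_policy_def f by blast
  have dom: "\<forall>K\<in>sub a. cost K - m \<le> 1 / (2 * \<mu>1 a) * (norm (cost_grad K))\<^sup>2" for a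
    using assms(7)[of a] gradient_cost[OF subD(1)] unfolding grad_dominated_on_def f S m_def by auto
  have "\<forall>a. \<exists>r0>0. \<exists>\<theta>1>0. \<exists>\<theta>2>0. \<exists>h0>0. \<exists>\<kappa>>0. (mn = 1 \<longrightarrow> \<kappa> = 1 / (8 * (\<delta>\<^sup>2 + 1)\<^sup>2)) \<and>
    success_guarantee a (\<mu>1 a) m r0 \<theta>1 \<theta>2 h0 \<kappa>"
    by (intro allI azopg_success_probability assms(5) m dom)
  then obtain r0 \<theta>1 \<theta>2 h0 \<kappa> where con: "\<And>a. 0 < r0 a" "\<And>a. 0 < \<theta>1 a" "\<And>a. 0 < \<theta>2 a" "\<And>a. 0 < h0 a" "\<And>a. 0 < \<kappa> a"
    and \<kappa>1: "\<And>a. mn = 1 \<Longrightarrow> \<kappa> a = 1 / (8 * (\<delta>\<^sup>2 + 1)\<^sup>2)"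
    and succ: "\<And>a. success_guarantee a (\<mu>1 a) m (r0 a) (\<theta>1 a) (\<theta>2 a) (h0 a) (\<kappa> a)"
    by metis
  have "\<delta>\<^sup>2 + 1 > 0" by (intro add_nonneg_pos) auto
  then have "1 / (8 * (\<delta>\<^sup>2 + 1)\<^sup>2) > 0" by simp
  then obtain N1 :: nat where N1: "\<And>N. N \<ge> N1 \<Longrightarrow> exp (- (1 / (8 * (\<delta>\<^sup>2 + 1)\<^sup>2)) * real N) \<le> real N powr (- \<beta>)"
    using exp_le_powr_eventually[OF _ assms(9)] by blast
  have "\<forall>a. \<exists>N0::nat. \<forall>N\<ge>N0. exp (- \<kappa> a * real N) \<le> real N powr (- \<beta>)"
    using exp_le_powr_eventually[OF con(5) assms(9)] by blast
  then obtain N0 :: "real \<Rightarrow> nat" where N0: "\<And>a N. N \<ge> N0 a \<Longrightarrow> exp (- \<kappa> a * real N) \<le> real N powr (- \<beta>)"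
    by metis
  define w where "w = (ln mn)^6 * mn"
  \<comment> \<open>With \<open>C1 = 1\<close> and \<open>mn \<noteq> 1\<close> the condition on
    \<open>N\<close> becomes \<open>real (N0 a) + 1 \<le> real N\<close>. For \<open>mn = 1\<close>
    the logarithm is 0 and any positive value will do.\<close>
  define \<theta>3 where "\<theta>3 a = (if mn = 1 then 1 else (real (N0 a) + 1) / (\<beta>^4 * w))" for a
  \<comment> \<open>The value that the constant in the stepsize bound must reach: dividing 1 by
    \<open>32 * \<mu>2 a * H a\<close> returns \<open>h0 a\<close>.\<close>
  define H where "H a = 1 / (32 * \<mu>2 a * h0 a)" for a
  define \<theta>' where "\<theta>' a = H a / (\<beta> * mn)" for a
  \<comment> \<open>Makes \<open>C2 * real N powr (- \<beta>)\<close> at least 1 for all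
    \<open>N\<close> below \<open>N1 + 3\<close>, where the claim is then vacuous. The 3 ensures
    \<open>ln N \<ge> 1\<close> for the remaining \<open>N\<close>, as
    \<open>exp 1 \<le> 3\<close>.\<close>
  define C2 where "C2 = (real N1 + 3) powr \<beta>"
  have w: "w > 0" if "mn \<noteq> 1"
  proof -
    have "ln mn \<noteq> 0" using that mn_pos by simp
    then have "(ln mn)^6 > 0" by (intro zero_less_power_eq[THEN iffD2]) simp
    then show ?thesis using mn_pos by (simp add: w_def)
  qed
  have H: "H a > 0" for a using con(4)[of a] assms(6)[of a] by (simp add: H_def)
  show ?thesis
    unfolding f S m_def[symmetric] mn_def[symmetric] Let_def
  proof (rule exI[of _ 1], rule exI[of _ C2], rule exI[of _ 1], rule exI[of _ 1],
      rule exI[of _ r0], rule exI[of _ \<theta>1], rule exI[of _ \<theta>2], rule exI[of _ \<theta>3], rule exI[of _ \<theta>'],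
      intro conjI allI impI)
    show "0 < C2" by (simp add: C2_def)
    show "0 < r0 a" "0 < \<theta>1 a" "0 < \<theta>2 a" "0 < \<theta>3 a" "0 < \<theta>' a" for a
      using con H[of a] mn_pos assms(9) w by (auto simp: \<theta>3_def \<theta>'_def intro!: divide_pos_pos)
    fix tmin tmax a \<epsilon> :: real and K0 :: "real^'n^'m" and \<tau> r :: real and N M :: nat and \<eta> :: real
      and pull push :: "nat \<Rightarrow> nat \<Rightarrow> real" and arr :: "nat \<Rightarrow> nat \<times> nat"
    let ?T = "C0 * of_int \<lfloor>tmax / tmin\<rfloor> + 1" and ?Cg = "1 * \<theta>' a * \<beta> * mn * ln (real N) + 2 * sqrt mn"
    let ?J = "nat \<lceil>8 / (\<eta> * \<mu>1 a) * ln ((cost K0 - m) / \<epsilon>)\<rceil>"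
    assume t: "0 < tmin" "tmin < tmax" and wt: "worker_timing tmin tmax M pull push"
      and ao: "arrival_order M push arr" and \<epsilon>: "0 < \<epsilon>" and K0: "K0 \<in> sub a" and r: "0 < r" "r < min (r0 a) (\<theta>1 a * sqrt \<epsilon>)"
      and \<tau>: "\<theta>2 a * ln (1 / (\<epsilon> * r)) \<le> \<tau>" and N: "1 * \<beta>^4 * \<theta>3 a * (ln mn)^6 * mn \<le> real N"
      and M: "1 \<le> M" "real M \<le> C0 * real N" and \<eta>: "0 < \<eta>" "\<eta> \<le> 1 / (128 * \<mu>2 a * (?Cg^2 + ?T * ?Cg))"
    let ?I = "{..<M} \<times> (UNIV :: nat set)"
    have P: "sample_space D M = PiM ?I (\<lambda>_. \<nu>)"
      by (simp add: sample_space_def \<nu>_def mn_def)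
    interpret P: prob_space "PiM ?I (\<lambda>_. \<nu>)" by (intro prob_space_PiM \<nu>_prob)
    let ?x = "\<lambda>\<omega>. azopg A B Q R \<tau> r N \<eta> pull push arr K0 \<omega>"
    have Npos: "N > 0" using M by (cases N) auto
    show "\<exists>j\<le>?J. 1 - real j * (C2 * real N powr - \<beta> + 1 * exp (- real N)) \<le>
        measure (sample_space D M) {\<omega> \<in> space (sample_space D M). ?x \<omega> j \<in> stab \<and> cost (?x \<omega> j) - m \<le> \<epsilon>}"
    proof (cases "cost K0 - m \<le> \<epsilon>")
      \<comment> \<open>The initial policy is already accurate and the logarithm may be nonpositive;
        \<open>j = 0\<close> succeeds surely.\<close>
      case True
      have "{\<omega> \<in> space (PiM ?I (\<lambda>_. \<nu>)). ?x \<omega> 0 \<in> stab \<and> cost (?x \<omega> 0) - m \<le> \<epsilon>} = space (PiM ?I (\<lambda>_. \<nu>))"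
        using True subD(1)[OF K0] by (auto simp: azopg_def)
      then show ?thesis using P.prob_space by (intro exI[of _ 0]) (simp add: P)
    next
      case False
      have Lpos: "8 / (\<eta> * \<mu>1 a) * ln ((cost K0 - m) / \<epsilon>) > 0"
        using False \<epsilon> \<eta> assms(5)[of a] by (intro mult_pos_pos divide_pos_pos) auto
      then have "0 < ?J" unfolding zero_less_nat_eq zero_less_ceiling .
      then have J1: "real ?J \<ge> 1" by linarith
      have JL: "8 / (\<eta> * \<mu>1 a) * ln ((cost K0 - m) / \<epsilon>) \<le> real ?J" by (rule real_nat_ceiling_ge)
      show ?thesis
      proof (intro exI[of _ ?J] conjI order.refl)
        show "1 - real ?J * (C2 * real N powr - \<beta> + 1 * exp (- real N)) \<le>
          measure (sample_space D M) {\<omega> \<in> space (sample_space D M). ?x \<omega> ?J \<in> stab \<and> cost (?x \<omega> ?J) - m \<le> \<epsilon>}"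
        proof (cases "N < N1 + 3")
          case True
          have "1 \<le> ((real N1 + 3) / real N) powr \<beta>"
            using True Npos assms(9) by (intro ge_one_powr_ge_zero) auto
          also have "\<dots> = C2 * real N powr - \<beta>"
            using Npos by (subst powr_divide) (auto simp: C2_def powr_minus divide_inverse)
          finally have "1 * 1 \<le> real ?J * (C2 * real N powr - \<beta> + 1 * exp (- real N))"
            using J1 by (intro mult_mono) (auto intro: add_increasing2)
          then show ?thesis using measure_nonneg[of "sample_space D M"] by (smt (verit))
        next
          case False
          then have NN: "N \<ge> N1" "N \<ge> 3" by auto
          have ex: "exp (- \<kappa> a * real N) \<le> real N powr (- \<beta>)"
          proof (cases "mn = 1")
            case True
            then show ?thesis using N1[OF NN(1)] \<kappa>1[of a] by simp
          next
            case False
            have "1 * \<beta>^4 * \<theta>3 a * (ln mn)^6 * mn = \<beta>^4 * w * \<theta>3 a" by (simp add: w_def)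
            also have "\<dots> = real (N0 a) + 1" using False w[OF False] assms(9) by (simp add: \<theta>3_def)
            finally have "1 * \<beta>^4 * \<theta>3 a * (ln mn)^6 * mn = real (N0 a) + 1" .
            then show ?thesis using N by (intro N0) linarith
          qed
          have C2: "1 \<le> C2" unfolding C2_def using assms(9) by (intro ge_one_powr_ge_zero) auto
          have q1: "(1::real) \<le> of_int \<lfloor>tmax / tmin\<rfloor>" using t by (simp add: le_floor_iff)
          have T1: "1 \<le> ?T" using q1 assms(10) by simp
          \<comment> \<open>The delay bound \<open>3 * ?T\<close> rounded up to an integer; as
            \<open>?T\<close> is at least 1, rounding keeps it below \<open>4 * ?T\<close>.\<close>
          define Tn where "Tn = nat \<lceil>3 * ?T\<rceil>"
          have "1 \<le> nat \<lceil>3 * y\<rceil> \<and> 3 * y \<le> real (nat \<lceil>3 * y\<rceil>) \<and> real (nat \<lceil>3 * y\<rceil>) \<le> 4 * y" if "1 \<le> y" for y :: real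
            using that by linarith
          from this[OF T1] have Tn: "3 * ?T \<le> real Tn" "real Tn \<le> 4 * ?T" "1 \<le> Tn" unfolding Tn_def by blast+
          have Cg: "?Cg \<ge> H a"
          proof -
            have "exp 1 \<le> (3::real)" by (rule exp_le)
            then have "1 \<le> ln (real N)" using NN(2) by (subst ln_ge_iff) auto
            then have "H a * 1 \<le> H a * ln (real N)" using H[of a] by (intro mult_left_mono) auto
            moreover have "1 * \<theta>' a * \<beta> * mn * ln (real N) = H a * ln (real N)"
              using assms(9) mn_pos by (simp add: \<theta>'_def)
            moreover have "0 \<le> 2 * sqrt mn" using mn_pos by simp
            ultimately show ?thesis by linarith
          qed
          have \<eta>T: "\<eta> * real Tn \<le> h0 a"
          proof -
            have "\<eta> * real Tn \<le> 1 / (32 * \<mu>2 a * H a)"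
              by (rule stepsize_times_delay_le[OF \<eta> T1 Cg H assms(6) Tn(2)])
            also have "\<dots> = h0 a" using con(4)[of a] assms(6)[of a] by (simp add: H_def)
            finally show ?thesis .
          qed
          have dl: "delay pull push arr N j i \<le> Tn" if "i < N" for j i
            using delay_bound[OF wt ao t assms(10) M(2) that, of j] Tn(1) by linarith
          have inj: "inj arr" and ran: "arr s \<in> ?I" for s
            using ao by (auto simp: arrival_order_def bij_betw_def)
          \<comment> \<open>Arrival numbers determine iteration and slot by division with remainder,
            so no sample serves two slots.\<close>
          have idx: "j = j' \<and> i = i'" if "i < N" "i' < N" "arr (j * N + i) = arr (j' * N + i')" for j j' i i'
          proof -
            have e: "j * N + i = j' * N + i'" using inj that(3) by (simp add: inj_def)
            have "(j * N + i) div N = j" "(j' * N + i') div N = j'" using that by auto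
            with e show ?thesis by simp
          qed
          have "1 - real ?J * exp (- \<kappa> a * real N) \<le> measure (PiM ?I (\<lambda>_. \<nu>))
            {\<omega> \<in> space (PiM ?I (\<lambda>_. \<nu>)).
               (let K = delayed_descent K0 \<eta> N (delay pull push arr N)
                 (\<lambda>j i K. case \<omega> (arr (j * N + i)) of (U, z) \<Rightarrow> grad_estimate A B Q R \<tau> r U z K) ?J
                in K \<in> stab \<and> cost K - m \<le> \<epsilon>)}"
          proof (rule succ[of a, unfolded success_guarantee_def, rule_format, where T=Tn and idx="\<lambda>j i. arr (j * N + i)"])
            show "1 \<le> Tn" by (rule Tn)
          qed (use \<epsilon> \<open>\<not> cost K0 - m \<le> \<epsilon>\<close> K0 r \<tau> \<eta>(1) \<eta>T Npos JL dl idx ran in auto)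
          also have "\<dots> = measure (sample_space D M) {\<omega> \<in> space (sample_space D M). ?x \<omega> ?J \<in> stab \<and> cost (?x \<omega> ?J) - m \<le> \<epsilon>}"
            by (simp add: P azopg_def Let_def)
          finally have main: "1 - real ?J * exp (- \<kappa> a * real N) \<le>
            measure (sample_space D M) {\<omega> \<in> space (sample_space D M). ?x \<omega> ?J \<in> stab \<and> cost (?x \<omega> ?J) - m \<le> \<epsilon>}" .
          have "real N powr - \<beta> \<le> C2 * real N powr - \<beta>" using C2 by (simp add: mult_le_cancel_right1)
          then have "exp (- \<kappa> a * real N) \<le> C2 * real N powr - \<beta> + 1 * exp (- real N)"
            using ex by (smt (verit) exp_ge_zero)
          then have "real ?J * exp (- \<kappa> a * real N) \<le> real ?J * (C2 * real N powr - \<beta> + 1 * exp (- real N))"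
            by (intro mult_left_mono) auto
          with main show ?thesis by linarith
        qed
      qed
    qed
  qed (auto)
qed

end
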